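(* Let $\sigma\in\mathrm{NC}_n$ and let $F$ be an indexed forest with $\mathrm{supp}(F)\subseteq[n]$. Then $\mathrm{ev}_\sigma(\mathfrak P_F)=0$ if and only if $\mathrm{ForToNC}(F)\not\le\sigma$ in the Bruhat order on $S_n$.
   Context: $\mathbf x=(x_1,x_2,\dots)$, $\mathbf t=(t_1,t_2,\dots)$; $\mathrm{ev}_\sigma f=f(t_{\sigma(1)},t_{\sigma(2)},\dots;\mathbf t)$ ($\sigma$ fixing integers $>n$). Noncrossing permutations: a set partition of $[n]$ is noncrossing if there are no distinct blocks $P,Q$ with $a,b\in P$, $c,d\in Q$, $a<c<b<d$; the associated permutation acts on each block $\{a_1<\dots<a_p\}$ by $a_j\mapsto a_{j-1}$ ($j\ge2$), $a_1\mapsto a_p$; $\mathrm{NC}_n$ is the set of these, and their cycles (including fixed points) are the blocks. A block $B$ is nested in a different block $C$ if there are $c,c'\in C$ with $c<\min B$ and $\max B<c'$. Indexed forests: sequences $F=(T_1,T_2,\dots)$ of binary plane trees (each node a leaf or an internal node with ordered left/right children), all but finitely many one-node trees; leaves identified with $\mathbb N$ left to right; $\emptyset$ has no internal nodes; $\mathrm{supp}(F)$ = leaves of trees containing an internal node. $\rho_F(v)$ is the leaf reached from internal node $v$ by going repeatedly to left children; terminal: both children leaves; $\mathrm{Qdes}(F)=\{\rho_F(v):v\text{ terminal}\}$; $F/i$ deletes the terminal node with $\rho_F(v)=i$ (replacing it and its leaves by one leaf, relabeling). The code of $F$ is $(c_i)_{i\ge1}$, $c_i=\#\{v:\rho_F(v)=i\}$,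 which determines $F$. $\mathrm{ForToNC}$ is the bijection from $\{F:\mathrm{supp}(F)\subseteq[n]\}$ to $\mathrm{NC}_n$ characterized by: $F=\mathrm{ForToNC}^{-1}(\sigma)$ has code given, for $i$ in the cycle $B$ of $\sigma$, by $c_i=|B|$ if $i=\min B$ and $B$ is nested in some other cycle, $c_i=|B|-1$ if $i=\min B$ and $B$ is nested in no other cycle, and $c_i=0$ otherwise. (Equivalently, $\mathrm{ForToNC}(F)$ is obtained by, for every internal node $v$ of $F$ that is a right child, deleting $v$, detaching its left subtree as a separate tree and attaching its right child to $v$'s parent in $v$'s place, and taking the noncrossing permutation whose blocks are the leaf sets of the resulting trees within $[n]$.) Double forest polynomials: $R_i^-f=f(x_1,\dots,x_{i-1},t_i,x_i,\dots;\mathbf t)$, $R_i^+f=f(x_1,\dots,x_i,t_i,x_{i+1},\dots;\mathbf t)$, $E_if=(R_i^+f-R_i^-f)/(x_i-t_i)$; $\mathfrak P_F$ is the unique homogeneous family ($\deg x_i=\deg t_i=1$) with $\mathfrak P_F(\mathbf t;\mathbf t)=\delta_{F,\emptyset}$ and $E_i\mathfrak P_F=\mathfrak P_{F/i}(\mathbf x;\widehat{\mathbf t}_i)$ if $i\in\mathrm{Qdes}(F)$, else $0$, $\widehat{\mathbf t}_i=(t_1,\dots,t_{i-1},t_{i+1},\dots)$. *)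

theory Defs
  imports Main "HOL-Library.Poly_Mapping" "HOL-Library.Disjoint_Sets" "HOL-Combinatorics.Permutations"
begin

datatype var = X nat | T nat

type_synonym mpoly = "(var \<Rightarrow>\<^sub>0 nat) \<Rightarrow>\<^sub>0 int"

definition Var :: "var \<Rightarrow> mpoly" where
  "Var v = Poly_Mapping.single (Poly_Mapping.single v 1) 1"

definition subst :: "(var \<Rightarrow> mpoly) \<Rightarrow> mpoly \<Rightarrow> mpoly" where
  "subst s p = (\<Sum>m\<in>Poly_Mapping.keys p.
       of_int (Poly_Mapping.lookup p m) * (\<Prod>v\<in>Poly_Mapping.keys m. s v ^ Poly_Mapping.lookup m v))"

definition vars :: "mpoly \<Rightarrow> var set" where
  "vars p = (\<Union>m\<in>Poly_Mapping.keys p. Poly_Mapping.keys m)"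

text \<open>Only the variables x_i, t_i with i >= 1 exist.\<close>
definition admissible_var :: "var \<Rightarrow> bool" where
  "admissible_var v = (case v of X i \<Rightarrow> 1 \<le> i | T i \<Rightarrow> 1 \<le> i)"

definition homogeneous :: "nat \<Rightarrow> mpoly \<Rightarrow> bool" where
  "homogeneous d p = (\<forall>m\<in>Poly_Mapping.keys p. (\<Sum>v\<in>Poly_Mapping.keys m. Poly_Mapping.lookup m v) = d)"

definition Rminus :: "nat \<Rightarrow> mpoly \<Rightarrow> mpoly" where
  "Rminus i = subst (\<lambda>v. case v of
      X j \<Rightarrow> (if j < i then Var (X j) else if j = i then Var (T i) else Var (X (j - 1)))
    | T j \<Rightarrow> Var (T j))"

definition Rplus :: "nat \<Rightarrow> mpoly \<Rightarrow> mpoly" where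
  "Rplus i = subst (\<lambda>v. case v of
      X j \<Rightarrow> (if j \<le> i then Var (X j) else if j = i + 1 then Var (T i) else Var (X (j - 1)))
    | T j \<Rightarrow> Var (T j))"

text \<open>E_i f = (R_i^+ f - R_i^- f)/(x_i - t_i) (exact division in the polynomial ring).\<close>
definition Eop :: "nat \<Rightarrow> mpoly \<Rightarrow> mpoly" where
  "Eop i f = (THE q. q * (Var (X i) - Var (T i)) = Rplus i f - Rminus i f)"

definition at_t :: "mpoly \<Rightarrow> mpoly" where
  "at_t = subst (\<lambda>v. case v of X j \<Rightarrow> Var (T j) | T j \<Rightarrow> Var (T j))"

definition omit_t :: "nat \<Rightarrow> mpoly \<Rightarrow> mpoly" where
  "omit_t i = subst (\<lambda>v. case v of X j \<Rightarrow> Var (X j)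
                                 | T j \<Rightarrow> (if j < i then Var (T j) else Var (T (j + 1))))"

definition ev :: "(nat \<Rightarrow> nat) \<Rightarrow> mpoly \<Rightarrow> mpoly" where
  "ev \<sigma> = subst (\<lambda>v. case v of X j \<Rightarrow> Var (T (\<sigma> j)) | T j \<Rightarrow> Var (T j))"

datatype btree = Lf | Nd btree btree

fun nleaves :: "btree \<Rightarrow> nat" where
  "nleaves Lf = 1"
| "nleaves (Nd l r) = nleaves l + nleaves r"

text \<open>For a tree whose leftmost leaf has label k: the list of internal nodes,
  each given as (rho(v), v is terminal).\<close>
fun nodes :: "nat \<Rightarrow> btree \<Rightarrow> (nat \<times> bool) list" where
  "nodes k Lf = []"
| "nodes k (Nd l r) = (k, l = Lf \<and> r = Lf) # nodes k l @ nodes (k + nleaves l) r"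

fun contract_tree :: "nat \<Rightarrow> nat \<Rightarrow> btree \<Rightarrow> btree" where
  "contract_tree k i Lf = Lf"
| "contract_tree k i (Nd l r) =
     (if l = Lf \<and> r = Lf \<and> k = i then Lf
      else Nd (contract_tree k i l) (contract_tree (k + nleaves l) i r))"

typedef iforest = "{F :: nat \<Rightarrow> btree. finite {j. F j \<noteq> Lf}}"
  by (rule exI[of _ "\<lambda>_. Lf"]) simp

text \<open>Trees are T_0, T_1, ... (Rep_iforest F j); leaves are labelled 1, 2, ... left to right.\<close>
definition tree_offset :: "iforest \<Rightarrow> nat \<Rightarrow> nat" where
  "tree_offset F j = 1 + (\<Sum>m<j. nleaves (Rep_iforest F m))"

definition empty_forest :: iforest where
  "empty_forest = Abs_iforest (\<lambda>_. Lf)"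

definition supp :: "iforest \<Rightarrow> nat set" where
  "supp F = (\<Union>j\<in>{j. Rep_iforest F j \<noteq> Lf}.
               {tree_offset F j..<tree_offset F j + nleaves (Rep_iforest F j)})"

definition Qdes :: "iforest \<Rightarrow> nat set" where
  "Qdes F = {i. \<exists>j. (i, True) \<in> set (nodes (tree_offset F j) (Rep_iforest F j))}"

definition forest_code :: "iforest \<Rightarrow> nat \<Rightarrow> nat" where
  "forest_code F i = card {(j, p). p < length (nodes (tree_offset F j) (Rep_iforest F j))
                               \<and> fst (nodes (tree_offset F j) (Rep_iforest F j) ! p) = i}"

definition contract :: "iforest \<Rightarrow> nat \<Rightarrow> iforest" where
  "contract F i = Abs_iforest (\<lambda>j. contract_tree (tree_offset F j) i (Rep_iforest F j))"

definition forest_poly_spec :: "(iforest \<Rightarrow> mpoly) \<Rightarrow> bool" where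
  "forest_poly_spec P =
    (\<forall>F. (\<exists>d. homogeneous d (P F))
       \<and> (\<forall>v\<in>vars (P F). admissible_var v)
       \<and> at_t (P F) = (if F = empty_forest then 1 else 0)
       \<and> (\<forall>i\<ge>1. Eop i (P F) = (if i \<in> Qdes F then omit_t i (P (contract F i)) else 0)))"

definition forest_poly :: "iforest \<Rightarrow> mpoly" where
  "forest_poly = (THE P. forest_poly_spec P)"

definition noncrossing :: "nat set set \<Rightarrow> bool" where
  "noncrossing \<P> = (\<nexists>P Q a b c d. P \<in> \<P> \<and> Q \<in> \<P> \<and> P \<noteq> Q \<and> a \<in> P \<and> b \<in> P
                      \<and> c \<in> Q \<and> d \<in> Q \<and> a < c \<and> c < b \<and> b < d)"

definition perm_of_partition :: "nat set set \<Rightarrow> nat \<Rightarrow> nat" where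
  "perm_of_partition \<P> a =
     (if \<exists>B\<in>\<P>. a \<in> B then
        (let B = (THE B. B \<in> \<P> \<and> a \<in> B) in
          if a = Min B then Max B else Max {b \<in> B. b < a})
      else a)"

definition NC :: "nat \<Rightarrow> (nat \<Rightarrow> nat) set" where
  "NC n = perm_of_partition ` {\<P>. partition_on {1..n} \<P> \<and> noncrossing \<P>}"

definition cycle_of :: "(nat \<Rightarrow> nat) \<Rightarrow> nat \<Rightarrow> nat set" where
  "cycle_of \<sigma> i = {(\<sigma> ^^ k) i | k. True}"

definition nested :: "nat set \<Rightarrow> nat set \<Rightarrow> bool" where
  "nested B C = (B \<noteq> C \<and> (\<exists>c\<in>C. \<exists>c'\<in>C. c < Min B \<and> Max B < c'))"

definition nc_code :: "(nat \<Rightarrow> nat) \<Rightarrow> nat \<Rightarrow> nat" where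
  "nc_code \<sigma> i =
     (let B = cycle_of \<sigma> i in
       if i = Min B then (if \<exists>j. nested B (cycle_of \<sigma> j) then card B else card B - 1) else 0)"

definition ForToNC :: "nat \<Rightarrow> iforest \<Rightarrow> (nat \<Rightarrow> nat)" where
  "ForToNC n F = (THE \<sigma>. \<sigma> \<in> NC n \<and> (\<forall>i. nc_code \<sigma> i = forest_code F i))"

definition ninv :: "nat \<Rightarrow> (nat \<Rightarrow> nat) \<Rightarrow> nat" where
  "ninv n u = card {(i, j). 1 \<le> i \<and> i < j \<and> j \<le> n \<and> u j < u i}"

definition transp :: "nat \<Rightarrow> nat \<Rightarrow> nat \<Rightarrow> nat" where
  "transp a b x = (if x = a then b else if x = b then a else x)"

definition bruhat_step :: "nat \<Rightarrow> (nat \<Rightarrow> nat) \<Rightarrow> (nat \<Rightarrow> nat) \<Rightarrow> bool" where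
  "bruhat_step n u w = (\<exists>a b. 1 \<le> a \<and> a < b \<and> b \<le> n \<and> w = u \<circ> transp a b \<and> ninv n u < ninv n w)"

definition bruhat_le :: "nat \<Rightarrow> (nat \<Rightarrow> nat) \<Rightarrow> (nat \<Rightarrow> nat) \<Rightarrow> bool" where
  "bruhat_le n u v = (u permutes {1..n} \<and> v permutes {1..n} \<and> (bruhat_step n)\<^sup>*\<^sup>* u v)"

end

theory Submission
  imports Defs "HOL-Combinatorics.Orbits"
begin

text \<open>
  Every non-identity noncrossing permutation \<open>\<sigma>\<close> has an \<open>i\<close> that is the minimum of its block while
  \<open>i + 1\<close> is not. Applying the operator \<open>E_i\<close> to a double forest polynomial and evaluating expresses
  \<open>ev \<sigma>\<close> of it as \<open>ev (\<sigma> s_i)\<close> of it plus \<open>t_b - t_a\<close>, \<open>a < b\<close>, times the evaluation of the polynomial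
  of \<open>F/i\<close> (or 0) at the permutation with \<open>i\<close> deleted. By induction each evaluation is zero or
  positive at all increasing integer values of \<open>t\<close>, and its vanishing is governed by a recursion.

  The Bruhat order on noncrossing permutations satisfies the same recursion: it is the
  pointwise order of the Dyck paths whose heights are given by the numbers of (weak)
  excedances of prefixes, and \<open>\<sigma> \<mapsto> \<sigma> s_i\<close> flattens a peak of such a path.

  Existence of the double forest polynomials is a Poincare lemma: a family of polynomials
  compatible with the commutation relations of the \<open>E_i\<close> has a common antiderivative.
\<close>

text \<open>The recursion for \<open>ev\<close> adds two summands, and a nonzero summand could be
  cancelled by the other one. Positivity at increasing values of t excludes this, so the induction
  carries positivity instead of nonvanishing. It requires the larger index to come with the plus
  sign in t_b - t_a, and choosing i as a block minimum with i + 1 not a minimum ensures that.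

  Forests and permutations are compared only through their codes. Passing from F to F/i and removing
  i from a noncrossing permutation act on codes by the same operation \<open>code_del\<close>, and
  terminal nodes match the chosen i. So \<open>ForToNC\<close> respects the recursion, and no
  picture of detached subtrees is needed.

  Existence must be proved because \<open>forest_poly\<close> is a definite description. The
  obstacle is that E_i removes a position among the x and, in the recursion, also omits a parameter
  t_i, after which position j - 1 belongs to t_j. Separating the two indices, as in
  \<open>ddiff p q\<close>, turns this into plain commutation relations.\<close>

instantiation var :: linorder
begin

text \<open>Any linear order would do. With one on the variables, exponent vectors are linearly
  ordered as well, and the type class instances then give that \<open>mpoly\<close> has no zero
  divisors. All cancellations of x_p - t_q rest on this.\<close>

definition less_eq_var :: "var \<Rightarrow> var \<Rightarrow> bool" where
  "less_eq_var v w = (case (v, w) of (X i, X j) \<Rightarrow> i \<le> j | (X i, T j) \<Rightarrow> True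
     | (T i, X j) \<Rightarrow> False | (T i, T j) \<Rightarrow> i \<le> j)"

definition less_var :: "var \<Rightarrow> var \<Rightarrow> bool" where
  "less_var v w = (v \<le> w \<and> v \<noteq> w)"

instance
  by standard (auto simp: less_eq_var_def less_var_def split: var.splits)

end

section \<open>Evaluation homomorphisms of integer polynomials\<close>

definition mon :: "(var \<Rightarrow> 'a::comm_ring_1) \<Rightarrow> (var \<Rightarrow>\<^sub>0 nat) \<Rightarrow> 'a" where
  "mon s m = (\<Prod>v\<in>Poly_Mapping.keys m. s v ^ Poly_Mapping.lookup m v)"

text \<open>The target is an arbitrary commutative ring: with target \<open>mpoly\<close> this is
  \<open>subst\<close>, with target \<open>int\<close> it is the numerical evaluation used for
  positivity.\<close>

definition insertion :: "(var \<Rightarrow> 'a::comm_ring_1) \<Rightarrow> mpoly \<Rightarrow> 'a" where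
  "insertion s p = (\<Sum>m\<in>Poly_Mapping.keys p. of_int (Poly_Mapping.lookup p m) * mon s m)"

lemma subst_eq_insertion: "subst s = insertion s"
  by (simp add: fun_eq_iff subst_def insertion_def mon_def)

lemma mon_superset:
  assumes "finite A" "Poly_Mapping.keys m \<subseteq> A"
  shows "mon s m = (\<Prod>v\<in>A. s v ^ Poly_Mapping.lookup m v)"
  unfolding mon_def using assms
  by (intro prod.mono_neutral_left) (auto simp: in_keys_iff)

lemma mon_zero [simp]: "mon s 0 = 1"
  by (simp add: mon_def)

lemma mon_add: "mon s (m + m') = mon s m * mon s m'"
proof -
  let ?A = "Poly_Mapping.keys m \<union> Poly_Mapping.keys m'"
  have "mon s (m + m') = (\<Prod>v\<in>?A. s v ^ Poly_Mapping.lookup (m + m') v)"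
    by (intro mon_superset keys_add) simp
  also have "\<dots> = (\<Prod>v\<in>?A. s v ^ Poly_Mapping.lookup m v) * (\<Prod>v\<in>?A. s v ^ Poly_Mapping.lookup m' v)"
    by (simp add: lookup_add power_add prod.distrib)
  also have "\<dots> = mon s m * mon s m'"
    by (simp add: mon_superset[of ?A])
  finally show ?thesis .
qed

lemma insertion_superset:
  assumes "finite A" "Poly_Mapping.keys p \<subseteq> A"
  shows "insertion s p = (\<Sum>m\<in>A. of_int (Poly_Mapping.lookup p m) * mon s m)"
  unfolding insertion_def using assms
  by (intro sum.mono_neutral_left) (auto simp: in_keys_iff)

lemma insertion_0 [simp]: "insertion s 0 = 0"
  by (simp add: insertion_def)

lemma insertion_single: "insertion s (Poly_Mapping.single m c) = of_int c * mon s m"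
  by (subst insertion_superset[of "{m}"]) auto

lemma insertion_1 [simp]: "insertion s 1 = 1"
  using insertion_single[of s 0 1] by simp

lemma insertion_Var [simp]: "insertion s (Var v) = s v"
  by (simp add: Var_def insertion_single mon_def)

lemma insertion_add [simp]: "insertion s (p + q) = insertion s p + insertion s q"
proof -
  let ?A = "Poly_Mapping.keys p \<union> Poly_Mapping.keys q"
  have "insertion s (p + q) = (\<Sum>m\<in>?A. of_int (Poly_Mapping.lookup (p + q) m) * mon s m)"
    by (intro insertion_superset keys_add) simp
  also have "\<dots> = insertion s p + insertion s q"
    by (simp add: insertion_superset[of ?A] lookup_add distrib_right sum.distrib)
  finally show ?thesis .
qed

lemma insertion_uminus [simp]: "insertion s (- p) = - insertion s p"
  using insertion_add[of s p "- p"] by (simp add: add_eq_0_iff)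

lemma insertion_diff [simp]: "insertion s (p - q) = insertion s p - insertion s q"
  using insertion_add[of s p "- q"] by simp

text \<open>Integer polynomials form the free abelian group on the monomials, so closure under
  differences replaces a case for coefficients.\<close>

lemma mpoly_induct [case_names zero monomial diff]:
  assumes "P 0" "\<And>m. P (Poly_Mapping.single m 1)" "\<And>p q. P p \<Longrightarrow> P q \<Longrightarrow> P (p - q)"
  shows "P (p :: mpoly)"
  by (rule frag_induction[of p UNIV P]) (auto intro: assms)

lemma insertion_mult [simp]: "insertion s (p * q) = insertion s p * insertion s q"
proof (induction p rule: mpoly_induct)
  case (monomial m)
  show ?case
    by (induction q rule: mpoly_induct)
      (simp_all add: mult_single insertion_single mon_add right_diff_distrib)
qed (simp_all add: left_diff_distrib)

lemma insertion_power [simp]: "insertion s (p ^ k) = insertion s p ^ k"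
  by (induction k) simp_all

lemma insertion_prod [simp]: "insertion s (prod f A) = (\<Prod>a\<in>A. insertion s (f a))"
  by (induction A rule: infinite_finite_induct) simp_all

lemma insertion_numeral [simp]: "insertion s (numeral k) = numeral k"
  by (metis insertion_single mon_zero mult.right_neutral of_int_numeral single_numeral)

lemma insertion_insertion:
  "insertion s (insertion s' p) = insertion (\<lambda>v. insertion s (s' v)) p"
  by (induction p rule: mpoly_induct) (simp_all add: insertion_single mon_def)

lemma insertion_cong: "(\<And>v. v \<in> vars p \<Longrightarrow> s v = s' v) \<Longrightarrow> insertion s p = insertion s' p"
  unfolding insertion_def mon_def
  by (intro sum.cong refl arg_cong2[of _ _ _ _ "(*)"] prod.cong arg_cong2[of _ _ _ _ "(^)"])
    (auto simp: vars_def)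

lemma Var_power: "Var v ^ k = Poly_Mapping.single (Poly_Mapping.single v k) 1"
  by (induction k) (simp_all add: Var_def mult_single flip: single_add)

lemma prod_single_1:
  "(\<Prod>a\<in>A. Poly_Mapping.single (f a) (1 :: int)) = Poly_Mapping.single (\<Sum>a\<in>A. f a) 1"
  for f :: "_ \<Rightarrow> 'b::comm_monoid_add"
  by (induction A rule: infinite_finite_induct) (simp_all add: mult_single)

lemma mon_Var: "mon (\<lambda>v. Var (\<rho> v)) m =
    Poly_Mapping.single (\<Sum>v\<in>Poly_Mapping.keys m. Poly_Mapping.single (\<rho> v) (Poly_Mapping.lookup m v)) 1"
  by (simp add: mon_def Var_power prod_single_1)

lemma poly_mapping_sum_single:
  "(\<Sum>v\<in>Poly_Mapping.keys m. Poly_Mapping.single v (Poly_Mapping.lookup m v)) = m"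
  by (rule poly_mapping_eqI)
    (auto simp: lookup_sum lookup_single when_def in_keys_iff)

lemma mon_Var_id: "mon Var m = Poly_Mapping.single m 1"
  using mon_Var[of "\<lambda>v. v" m] by (simp add: poly_mapping_sum_single)

lemma insertion_Var_id [simp]: "insertion Var p = p"
  by (induction p rule: mpoly_induct) (simp_all add: insertion_single mon_Var_id)

definition ren :: "(var \<Rightarrow> var) \<Rightarrow> mpoly \<Rightarrow> mpoly" where
  "ren \<rho> = insertion (\<lambda>v. Var (\<rho> v))"

lemma ren_simps [simp]:
  "ren \<rho> 0 = 0" "ren \<rho> 1 = 1" "ren \<rho> (Var v) = Var (\<rho> v)" "ren \<rho> (p + q) = ren \<rho> p + ren \<rho> q"
  "ren \<rho> (p - q) = ren \<rho> p - ren \<rho> q" "ren \<rho> (- p) = - ren \<rho> p" "ren \<rho> (p * q) = ren \<rho> p * ren \<rho> q"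
  by (simp_all add: ren_def)

lemma ren_ren: "ren \<rho> (ren \<pi> p) = ren (\<lambda>v. \<rho> (\<pi> v)) p"
  by (simp add: ren_def insertion_insertion)

lemma insertion_ren: "insertion s (ren \<pi> p) = insertion (\<lambda>v. s (\<pi> v)) p"
  by (simp add: ren_def insertion_insertion)

lemma ren_id [simp]: "ren (\<lambda>v. v) p = p"
  by (simp add: ren_def)

lemma ren_cong: "(\<And>v. v \<in> vars p \<Longrightarrow> \<rho> v = \<pi> v) \<Longrightarrow> ren \<rho> p = ren \<pi> p"
  unfolding ren_def by (rule insertion_cong) simp

lemma vars_ren: "vars (ren \<rho> p) \<subseteq> \<rho> ` vars p"
proof
  fix w assume "w \<in> vars (ren \<rho> p)"
  then obtain m where m: "m \<in> Poly_Mapping.keys (ren \<rho> p)" "w \<in> Poly_Mapping.keys m"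
    by (auto simp: vars_def)
  from m(1) have "Poly_Mapping.lookup (ren \<rho> p) m \<noteq> 0" by (simp add: in_keys_iff)
  then obtain m' where m': "m' \<in> Poly_Mapping.keys p"
    "Poly_Mapping.lookup (of_int (Poly_Mapping.lookup p m') * mon (\<lambda>v. Var (\<rho> v)) m') m \<noteq> 0"
    unfolding ren_def insertion_def lookup_sum by (meson sum.not_neutral_contains_not_neutral)
  have "of_int (Poly_Mapping.lookup p m') * mon (\<lambda>v. Var (\<rho> v)) m' = Poly_Mapping.single
      (\<Sum>v\<in>Poly_Mapping.keys m'. Poly_Mapping.single (\<rho> v) (Poly_Mapping.lookup m' v)) (Poly_Mapping.lookup p m')"
    by (simp add: mon_Var mult_single flip: single_of_int)
  with m' have "m = (\<Sum>v\<in>Poly_Mapping.keys m'. Poly_Mapping.single (\<rho> v) (Poly_Mapping.lookup m' v))"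
    by (auto simp: lookup_single when_def split: if_splits)
  with m(2) have "(\<Sum>v\<in>Poly_Mapping.keys m'. Poly_Mapping.lookup (Poly_Mapping.single (\<rho> v) (Poly_Mapping.lookup m' v)) w) \<noteq> 0"
    by (simp only: in_keys_iff lookup_sum not_False_eq_True)
  then obtain v where "v \<in> Poly_Mapping.keys m'" "\<rho> v = w"
    by (metis (mono_tags, lifting) lookup_single_not_eq sum.neutral)
  with m'(1) show "w \<in> \<rho> ` vars p"
    by (auto simp: vars_def)
qed

text \<open>Doubling all variables multiplies a monomial of degree k by 2^k, and different degrees
  give different powers. Homogeneity thus becomes an equation, which passes through ring
  homomorphisms and survives cancelling a factor.\<close>

lemma homogeneous_iff_scaling:
  "homogeneous d p \<longleftrightarrow> insertion (\<lambda>v. 2 * Var v) p = 2 ^ d * p"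
proof -
  have 2: "(2 :: mpoly) ^ k = Poly_Mapping.single 0 (2 ^ k)" for k
    by (induction k) (simp_all add: mult_single flip: single_numeral)
  have mon: "mon (\<lambda>v. 2 * Var v) m = Poly_Mapping.single m (2 ^ (\<Sum>v\<in>Poly_Mapping.keys m. Poly_Mapping.lookup m v))" for m
  proof -
    have "mon (\<lambda>v. 2 * Var v) m = 2 ^ (\<Sum>v\<in>Poly_Mapping.keys m. Poly_Mapping.lookup m v) * mon Var m"
      by (simp add: mon_def power_mult_distrib prod.distrib power_sum)
    then show ?thesis by (simp add: mon_Var_id 2 mult_single)
  qed
  have scale: "(2 :: mpoly) ^ k * p = Poly_Mapping.single 0 (2 ^ k) * p" for k
    using 2 by simp
  have lk: "Poly_Mapping.lookup (insertion (\<lambda>v. 2 * Var v) p) m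
     = Poly_Mapping.lookup p m * 2 ^ (\<Sum>v\<in>Poly_Mapping.keys m. Poly_Mapping.lookup m v)" for m
    unfolding insertion_def lookup_sum mon
    by (simp add: mult_single lookup_single when_def in_keys_iff flip: single_of_int)
  have lk2: "Poly_Mapping.lookup (2 ^ d * p) m = 2 ^ d * Poly_Mapping.lookup p m" for m
    unfolding scale by (simp flip: mult_map_scale_conv_mult add: Poly_Mapping.map.rep_eq when_def)
  have pow: "(2 :: int) ^ a = 2 ^ b \<longleftrightarrow> a = b" for a b :: nat
    by simp
  show ?thesis
    unfolding homogeneous_def poly_mapping_eq_iff[of "insertion _ _"] fun_eq_iff lk lk2
    by (auto simp: in_keys_iff pow mult.commute)
qed

section \<open>Divided differences\<close>

text \<open>Inserts t_q at position p and shifts the later x. Both R_i^- (p = i) and R_i^+ (p = i +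
  1) have this form with q = i. Position and parameter are independent because they drift apart when
  the operators are iterated.\<close>

definition ipos :: "nat \<Rightarrow> nat \<Rightarrow> var \<Rightarrow> var" where
  "ipos p q v = (case v of X j \<Rightarrow> (if j < p then X j else if j = p then T q else X (j - 1)) | T j \<Rightarrow> T j)"

definition omit_var :: "nat \<Rightarrow> var \<Rightarrow> var" where
  "omit_var i v = (case v of X j \<Rightarrow> X j | T j \<Rightarrow> if j < i then T j else T (j + 1))"

lemma Rminus_eq_ren: "Rminus i = ren (ipos i i)"
  unfolding Rminus_def subst_eq_insertion ren_def
  by (rule arg_cong[where f = insertion]) (auto simp: fun_eq_iff ipos_def split: var.splits)

lemma Rplus_eq_ren: "Rplus i = ren (ipos (Suc i) i)"
  unfolding Rplus_def subst_eq_insertion ren_def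
  by (rule arg_cong[where f = insertion]) (auto simp: fun_eq_iff ipos_def split: var.splits)

lemma omit_t_eq_ren: "omit_t i = ren (omit_var i)"
  unfolding omit_t_def subst_eq_insertion ren_def
  by (rule arg_cong[where f = insertion]) (auto simp: fun_eq_iff omit_var_def split: var.splits)

lemma at_t_eq_ren: "at_t = ren (\<lambda>v. case v of X j \<Rightarrow> T j | T j \<Rightarrow> T j)"
  unfolding at_t_def subst_eq_insertion ren_def
  by (rule arg_cong[where f = insertion]) (auto simp: fun_eq_iff split: var.splits)

lemma ev_eq_ren: "ev \<sigma> = ren (\<lambda>v. case v of X j \<Rightarrow> T (\<sigma> j) | T j \<Rightarrow> T j)"
  unfolding ev_def subst_eq_insertion ren_def
  by (rule arg_cong[where f = insertion]) (auto simp: fun_eq_iff split: var.splits)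

lemma Var_eq_iff [simp]: "Var v = Var w \<longleftrightarrow> v = w"
proof
  assume "Var v = Var w"
  then have "insertion (\<lambda>u. if u = v then 1 else 0 :: int) (Var v)
      = insertion (\<lambda>u. if u = v then 1 else 0) (Var w)" by simp
  then show "v = w" by (auto split: if_splits)
qed simp

lemma Var_diff_nonzero: "Var (X i) - Var (T j) \<noteq> 0"
  by simp

lemma dvd_diff_mult:
  fixes d :: "'a::comm_ring_1"
  assumes "d dvd a - a'" "d dvd b - b'"
  shows "d dvd a * b - a' * b'"
proof -
  have "a * b - a' * b' = (a - a') * b + a' * (b - b')" by (simp add: algebra_simps)
  with assms show ?thesis by simp
qed

lemma dvd_insertion_diff:
  fixes s s' :: "var \<Rightarrow> 'a::comm_ring_1"
  assumes "\<And>v. d dvd s v - s' v"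
  shows "d dvd insertion s p - insertion s' p"
proof -
  have pow: "d dvd s v ^ k - s' v ^ k" for v k
    by (induction k) (auto intro: dvd_diff_mult assms)
  have mon: "d dvd mon s m - mon s' m" for m
  proof -
    have "d dvd (\<Prod>v\<in>A. s v ^ Poly_Mapping.lookup m v) - (\<Prod>v\<in>A. s' v ^ Poly_Mapping.lookup m v)" for A
      by (induction A rule: infinite_finite_induct) (auto intro: dvd_diff_mult pow)
    then show ?thesis by (simp add: mon_def)
  qed
  have "insertion s p - insertion s' p
      = (\<Sum>m\<in>Poly_Mapping.keys p. of_int (Poly_Mapping.lookup p m) * (mon s m - mon s' m))"
    by (simp add: insertion_def right_diff_distrib sum_subtractf)
  also have "d dvd \<dots>" by (intro dvd_sum dvd_mult mon)
  finally show ?thesis .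
qed

definition ddiff :: "nat \<Rightarrow> nat \<Rightarrow> mpoly \<Rightarrow> mpoly" where
  "ddiff p q f = (THE r. r * (Var (X p) - Var (T q)) = ren (ipos (Suc p) q) f - ren (ipos p q) f)"

lemma Eop_eq_ddiff: "Eop i = ddiff i i"
  by (simp add: fun_eq_iff Eop_def ddiff_def Rplus_eq_ren Rminus_eq_ren)

lemma ddiff_eqI:
  assumes "r * (Var (X p) - Var (T q)) = ren (ipos (Suc p) q) f - ren (ipos p q) f"
  shows "ddiff p q f = r"
  unfolding ddiff_def
proof (rule the_equality)
  fix r' assume "r' * (Var (X p) - Var (T q)) = ren (ipos (Suc p) q) f - ren (ipos p q) f"
  with assms have "r' * (Var (X p) - Var (T q)) = r * (Var (X p) - Var (T q))" by simp
  then show "r' = r" by (simp only: mult_cancel_right Var_diff_nonzero simp_thms)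
qed (rule assms)

text \<open>The two renamings differ only on \<open>X p\<close> and \<open>X (Suc p)\<close>, whose
  images x_p and t_q are exchanged. Hence they agree modulo x_p - t_q, so the quotient in the
  definition exists.\<close>

lemma ddiff_mult: "ddiff p q f * (Var (X p) - Var (T q)) = ren (ipos (Suc p) q) f - ren (ipos p q) f"
proof -
  have "Var (X p) - Var (T q) dvd ren (ipos (Suc p) q) f - ren (ipos p q) f"
    unfolding ren_def
  proof (rule dvd_insertion_diff)
    fix v
    consider "ipos (Suc p) q v = ipos p q v" | "ipos (Suc p) q v = X p \<and> ipos p q v = T q"
      | "ipos (Suc p) q v = T q \<and> ipos p q v = X p"
    proof (cases v)
      case (X j)
      then show ?thesis
        using that by (cases j p rule: linorder_cases; cases "j = Suc p") (auto simp: ipos_def)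
    qed (use that in \<open>auto simp: ipos_def\<close>)
    then show "Var (X p) - Var (T q) dvd Var (ipos (Suc p) q v) - Var (ipos p q v)"
      by cases (simp_all, metis dvd_minus_iff dvd_refl minus_diff_eq)
  qed
  then obtain r where "r * (Var (X p) - Var (T q)) = ren (ipos (Suc p) q) f - ren (ipos p q) f"
    by (metis dvdE mult.commute)
  with ddiff_eqI[OF this] show ?thesis by simp
qed

lemma ddiff_add: "ddiff p q (f + g) = ddiff p q f + ddiff p q g"
  by (rule ddiff_eqI) (simp add: distrib_right ddiff_mult)

lemma ddiff_diff: "ddiff p q (f - g) = ddiff p q f - ddiff p q g"
  by (rule ddiff_eqI) (simp add: left_diff_distrib ddiff_mult)

lemma ddiff_0 [simp]: "ddiff p q 0 = 0"
  by (rule ddiff_eqI) simp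

lemma ddiff_1 [simp]: "ddiff p q 1 = 0"
  by (rule ddiff_eqI) simp

lemma ren_ipos_commute:
  assumes "p \<le> q"
  shows "ren (ipos q b) (ren (ipos p a) f) = ren (ipos p a) (ren (ipos (Suc q) b) f)"
  unfolding ren_ren
  by (rule arg_cong[where f = "\<lambda>\<rho>. ren \<rho> f"])
    (use assms in \<open>auto simp: fun_eq_iff ipos_def split: var.splits\<close>)

text \<open>The inner operator at i removes a position before j, so j becomes j - 1 while its
  parameter stays b. The gap of two keeps the insertion positions i, i + 1 and j, j + 1 disjoint.
  The proof multiplies by both linear factors and compares the resulting double insertions.\<close>

lemma ddiff_commute:
  assumes "i + 2 \<le> j"
  shows "ddiff (j - 1) b (ddiff i a f) = ddiff i a (ddiff j b f)"
proof -
  obtain k where k: "j = Suc k" "i < k" using assms by (cases j) auto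
  let ?u = "Var (X i) - Var (T a)" and ?v = "Var (X k) - Var (T b)"
  have "ddiff k b (ddiff i a f) * ?v * ?u
      = (ren (ipos (Suc k) b) (ddiff i a f) - ren (ipos k b) (ddiff i a f)) * ?u"
    by (simp only: ddiff_mult)
  also have "\<dots> = ren (ipos (Suc k) b) (ddiff i a f * ?u) - ren (ipos k b) (ddiff i a f * ?u)"
    using k by (simp add: left_diff_distrib ipos_def)
  also have "\<dots> = ren (ipos (Suc i) a) (ddiff (Suc k) b f * (Var (X (Suc k)) - Var (T b)))
      - ren (ipos i a) (ddiff (Suc k) b f * (Var (X (Suc k)) - Var (T b)))"
    using k by (simp only: ddiff_mult) (simp add: ren_ipos_commute)
  also have "\<dots> = ddiff i a (ddiff (Suc k) b f) * ?v * ?u"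
  proof -
    have "ddiff i a (ddiff (Suc k) b f) * ?v * ?u = ddiff i a (ddiff (Suc k) b f) * ?u * ?v" by simp
    also have "\<dots> = (ren (ipos (Suc i) a) (ddiff (Suc k) b f) - ren (ipos i a) (ddiff (Suc k) b f)) * ?v"
      by (simp only: ddiff_mult)
    finally show ?thesis using k by (simp add: left_diff_distrib ipos_def)
  qed
  finally show ?thesis using k by simp
qed

lemma ddiff_omit:
  "ddiff p (if q < i then q else Suc q) (ren (omit_var i) f) = ren (omit_var i) (ddiff p q f)"
proof (rule ddiff_eqI)
  let ?q = "if q < i then q else Suc q"
  have *: "ren (ipos p ?q) (ren (omit_var i) f) = ren (omit_var i) (ren (ipos p q) f)" for p
    unfolding ren_ren
    by (rule arg_cong[where f = "\<lambda>\<rho>. ren \<rho> f"]) (auto simp: fun_eq_iff ipos_def omit_var_def split: var.splits)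
  have "ren (omit_var i) (ddiff p q f) * (Var (X p) - Var (T ?q))
      = ren (omit_var i) (ddiff p q f * (Var (X p) - Var (T q)))"
    by (simp add: omit_var_def)
  also have "\<dots> = ren (ipos (Suc p) ?q) (ren (omit_var i) f) - ren (ipos p ?q) (ren (omit_var i) f)"
    by (simp only: ddiff_mult ren_simps *)
  finally show "ren (omit_var i) (ddiff p q f) * (Var (X p) - Var (T ?q)) = \<dots>" .
qed

lemma ren_omit_omit:
  assumes "i < j"
  shows "ren (omit_var i) (ren (omit_var (j - 1)) f) = ren (omit_var j) (ren (omit_var i) f)"
  unfolding ren_ren
  by (rule arg_cong[where f = "\<lambda>\<rho>. ren \<rho> f"])
    (use assms in \<open>auto simp: fun_eq_iff omit_var_def split: var.splits\<close>)

section \<open>Polynomials in finitely many of the variables x\<close>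

definition xt_vars :: "nat \<Rightarrow> var set" where
  "xt_vars n = {v. case v of X j \<Rightarrow> 1 \<le> j \<and> j \<le> n | T j \<Rightarrow> 1 \<le> j}"

definition xt_poly :: "nat \<Rightarrow> mpoly \<Rightarrow> bool" where
  "xt_poly n f \<longleftrightarrow> vars f \<subseteq> xt_vars n"

text \<open>Forbidden variables go to \<open>T 1\<close>, which lies in every
  \<open>xt_vars n\<close>. Being a polynomial in the allowed variables thus means being fixed by a
  ring homomorphism, so closure properties become equations and common factors can be
  cancelled.\<close>

definition xt_proj :: "nat \<Rightarrow> var \<Rightarrow> var" where
  "xt_proj n v = (if v \<in> xt_vars n then v else T 1)"

lemma xt_poly_iff: "xt_poly n f \<longleftrightarrow> ren (xt_proj n) f = f"
proof
  assume "xt_poly n f"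
  then have "ren (xt_proj n) f = ren (\<lambda>v. v) f"
    by (intro ren_cong) (auto simp: xt_poly_def xt_proj_def)
  then show "ren (xt_proj n) f = f" by simp
next
  assume "ren (xt_proj n) f = f"
  then have "vars f \<subseteq> xt_proj n ` vars f" using vars_ren[of "xt_proj n" f] by simp
  also have "\<dots> \<subseteq> xt_vars n" by (auto simp: xt_proj_def xt_vars_def split: var.splits)
  finally show "xt_poly n f" by (simp add: xt_poly_def)
qed

lemma xt_poly_add: "xt_poly n f \<Longrightarrow> xt_poly n g \<Longrightarrow> xt_poly n (f + g)"
  and xt_poly_diff: "xt_poly n f \<Longrightarrow> xt_poly n g \<Longrightarrow> xt_poly n (f - g)"
  and xt_poly_mult: "xt_poly n f \<Longrightarrow> xt_poly n g \<Longrightarrow> xt_poly n (f * g)"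
  and xt_poly_0 [simp]: "xt_poly n 0"
  and xt_poly_1 [simp]: "xt_poly n 1"
  by (simp_all add: xt_poly_iff)

lemma xt_poly_Var: "v \<in> xt_vars n \<Longrightarrow> xt_poly n (Var v)"
  by (simp add: xt_poly_iff xt_proj_def)

lemma xt_poly_mono: "xt_poly n f \<Longrightarrow> n \<le> m \<Longrightarrow> xt_poly m f"
  by (force simp: xt_poly_def xt_vars_def split: var.splits)

lemma xt_poly_ren: "xt_poly n f \<Longrightarrow> (\<And>v. v \<in> xt_vars n \<Longrightarrow> \<rho> v \<in> xt_vars m) \<Longrightarrow> xt_poly m (ren \<rho> f)"
  using vars_ren[of \<rho> f] unfolding xt_poly_def by blast

lemma xt_poly_ren_cong:
  "xt_poly n f \<Longrightarrow> (\<And>v. v \<in> xt_vars n \<Longrightarrow> \<rho> v = \<pi> v) \<Longrightarrow> ren \<rho> f = ren \<pi> f"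
  by (rule ren_cong) (auto simp: xt_poly_def)

lemma xt_poly_ren_id: "xt_poly n f \<Longrightarrow> (\<And>v. v \<in> xt_vars n \<Longrightarrow> \<rho> v = v) \<Longrightarrow> ren \<rho> f = f"
  using xt_poly_ren_cong[of n f \<rho> "\<lambda>v. v"] by simp

lemma ddiff_eq_0:
  assumes "xt_poly m f" "m < p"
  shows "ddiff p q f = 0"
proof (rule ddiff_eqI)
  have "ren (ipos (Suc p) q) f = ren (ipos p q) f"
    by (rule xt_poly_ren_cong[OF assms(1)]) (use assms(2) in \<open>auto simp: xt_vars_def ipos_def split: var.splits\<close>)
  then show "0 * (Var (X p) - Var (T q)) = ren (ipos (Suc p) q) f - ren (ipos p q) f" by simp
qed

text \<open>One variable is lost because both insertions shift x_(m+1) down or replace it. For p = m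
  + 1 this fails: the upper insertion then leaves f unchanged, and x_p may survive.\<close>

lemma xt_poly_ddiff:
  assumes "xt_poly (Suc m) f" "1 \<le> p" "p \<le> m" "1 \<le> q"
  shows "xt_poly m (ddiff p q f)"
proof -
  have "xt_poly m (ren (ipos p' q) f)" if "1 \<le> p'" "p' \<le> Suc m" for p'
    by (rule xt_poly_ren[OF assms(1)]) (use assms that in \<open>auto simp: xt_vars_def ipos_def split: var.splits\<close>)
  then have "xt_poly m (ddiff p q f * (Var (X p) - Var (T q)))"
    unfolding ddiff_mult using assms by (intro xt_poly_diff) auto
  moreover have "xt_proj m (X p) = X p" "xt_proj m (T q) = T q"
    using assms by (auto simp: xt_proj_def xt_vars_def)
  ultimately show ?thesis by (simp add: xt_poly_iff)
qed

lemma homogeneous_add: "homogeneous d f \<Longrightarrow> homogeneous d g \<Longrightarrow> homogeneous d (f + g)"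
  and homogeneous_diff: "homogeneous d f \<Longrightarrow> homogeneous d g \<Longrightarrow> homogeneous d (f - g)"
  and homogeneous_0 [simp]: "homogeneous d 0"
  by (simp_all add: homogeneous_iff_scaling algebra_simps)

lemma homogeneous_Var_diff_mult:
  "homogeneous d f \<Longrightarrow> homogeneous (Suc d) ((Var v - Var w) * f)"
  by (simp add: homogeneous_iff_scaling algebra_simps)

lemma homogeneous_ren:
  assumes "homogeneous d f"
  shows "homogeneous d (ren \<rho> f)"
proof -
  have "insertion (\<lambda>v. 2 * Var v) (ren \<rho> f) = ren \<rho> (insertion (\<lambda>v. 2 * Var v) f)"
    by (simp add: insertion_ren ren_def insertion_insertion)
  also have "\<dots> = 2 ^ d * ren \<rho> f"
    using assms by (simp add: homogeneous_iff_scaling ren_def)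
  finally show ?thesis by (simp add: homogeneous_iff_scaling)
qed

lemma homogeneous_ddiff:
  assumes "homogeneous (Suc d) f"
  shows "homogeneous d (ddiff p q f)"
proof -
  have "homogeneous (Suc d) (ddiff p q f * (Var (X p) - Var (T q)))"
    unfolding ddiff_mult by (intro homogeneous_diff homogeneous_ren assms)
  then have "insertion (\<lambda>v. 2 * Var v) (ddiff p q f) * (2 * (Var (X p) - Var (T q)))
      = (2 ^ d * ddiff p q f) * (2 * (Var (X p) - Var (T q)))"
    by (simp add: homogeneous_iff_scaling algebra_simps)
  moreover have "2 * (Var (X p) - Var (T q)) \<noteq> 0" by simp
  ultimately show ?thesis unfolding homogeneous_iff_scaling using mult_right_cancel by blast
qed

definition subst_var :: "nat \<Rightarrow> nat \<Rightarrow> var \<Rightarrow> var" where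
  "subst_var n q v = (if v = X n then T q else v)"

lemma ddiff_subst_var:
  assumes "p + 2 \<le> n"
  shows "ddiff p q (ren (subst_var n b) f) = ren (subst_var (n - 1) b) (ddiff p q f)"
proof (rule ddiff_eqI)
  have *: "ren (ipos p' q) (ren (subst_var n b) f) = ren (subst_var (n - 1) b) (ren (ipos p' q) f)"
    if "p' < n" for p'
    unfolding ren_ren
    by (rule arg_cong[where f = "\<lambda>\<rho>. ren \<rho> f"])
      (use that in \<open>auto simp: fun_eq_iff ipos_def subst_var_def split: var.splits\<close>)
  have "ren (subst_var (n - 1) b) (ddiff p q f) * (Var (X p) - Var (T q))
      = ren (subst_var (n - 1) b) (ddiff p q f * (Var (X p) - Var (T q)))"
    using assms by (cases n) (auto simp: subst_var_def)
  also have "\<dots> = ren (ipos (Suc p) q) (ren (subst_var n b) f) - ren (ipos p q) (ren (subst_var n b) f)"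
    using assms by (simp only: ddiff_mult ren_simps) (simp add: *)
  finally show "ren (subst_var (n - 1) b) (ddiff p q f) * (Var (X p) - Var (T q)) = \<dots>" .
qed

text \<open>The compatibility conditions that \<open>ddiff_commute\<close> imposes on the values of the operators
  \<open>ddiff i i\<close> are sufficient. The polynomial is built by splitting off its part that is divisible
  by \<open>x_n - t_n\<close>; the rest does not involve \<open>x_n\<close>.\<close>

lemma ddiff_antiderivative:
  assumes "\<And>i. 1 \<le> i \<Longrightarrow> i < n \<Longrightarrow> xt_poly (n - 1) (f i)"
    and "1 \<le> n \<Longrightarrow> xt_poly n (f n)"
    and "\<And>i j. 1 \<le> i \<Longrightarrow> i + 2 \<le> j \<Longrightarrow> j \<le> n \<Longrightarrow> ddiff (j - 1) j (f i) = ddiff i i (f j)"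
    and "\<And>i. 1 \<le> i \<Longrightarrow> i \<le> n \<Longrightarrow> homogeneous d (f i)"
  shows "\<exists>g. xt_poly n g \<and> homogeneous (Suc d) g \<and> (\<forall>i. 1 \<le> i \<and> i \<le> n \<longrightarrow> ddiff i i g = f i)"
  using assms
proof (induction n arbitrary: f)
  case 0
  show ?case by (rule exI[of _ 0]) simp
next
  case (Suc n)
  define h where "h = (Var (X (Suc n)) - Var (T (Suc n))) * f (Suc n)"
  define g where "g i = (if i = n then f n - ddiff n n h else ren (subst_var n (Suc n)) (f i))" for i
  have fV: "xt_poly n (f i)" if "1 \<le> i" "i \<le> n" for i using Suc.prems(1)[of i] that by simp
  have fNV: "xt_poly (Suc n) (f (Suc n))" using Suc.prems(2) by simp
  have compat: "ddiff (j - 1) j (f i) = ddiff i i (f j)" if "1 \<le> i" "i + 2 \<le> j" "j \<le> Suc n" for i j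
    using Suc.prems(3) that .
  have fH: "homogeneous d (f i)" if "1 \<le> i" "i \<le> Suc n" for i using Suc.prems(4) that .
  have hV: "xt_poly (Suc n) h"
    unfolding h_def by (intro xt_poly_mult xt_poly_diff xt_poly_Var fNV) (simp_all add: xt_vars_def)
  have hH: "homogeneous (Suc d) h"
    unfolding h_def by (intro homogeneous_Var_diff_mult fH) simp_all
  \<comment> \<open>Compatibility of i with n + 1 turns the difference of \<open>f (Suc n)\<close>
    at i into a difference of \<open>f i\<close> at n. Its two terms are \<open>f i\<close> itself,
    since x_(n+1) does not occur, and \<open>f i\<close> at x_n = t_(n+1).\<close>
  have ddh: "ddiff i i h = f i - ren (subst_var n (Suc n)) (f i)" if i: "1 \<le> i" "i < n" for i
  proof -
    have "ddiff i i h = (Var (X n) - Var (T (Suc n))) * ddiff i i (f (Suc n))"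
    proof (rule ddiff_eqI)
      have "(Var (X n) - Var (T (Suc n))) * ddiff i i (f (Suc n)) * (Var (X i) - Var (T i))
        = (Var (X n) - Var (T (Suc n))) * (ddiff i i (f (Suc n)) * (Var (X i) - Var (T i)))"
        by (simp only: mult.assoc)
      also have "\<dots> = ren (ipos (Suc i) i) h - ren (ipos i i) h"
        unfolding h_def ddiff_mult using i by (simp add: ipos_def right_diff_distrib)
      finally show "(Var (X n) - Var (T (Suc n))) * ddiff i i (f (Suc n)) * (Var (X i) - Var (T i)) = \<dots>" .
    qed
    also have "ddiff i i (f (Suc n)) = ddiff n (Suc n) (f i)"
      using compat[of i "Suc n"] i by simp
    also have "(Var (X n) - Var (T (Suc n))) * ddiff n (Suc n) (f i)
      = ren (ipos (Suc n) (Suc n)) (f i) - ren (ipos n (Suc n)) (f i)"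
      by (metis ddiff_mult mult.commute)
    also have "ren (ipos (Suc n) (Suc n)) (f i) = f i"
      by (rule xt_poly_ren_id[OF fV]) (use i in \<open>auto simp: xt_vars_def ipos_def split: var.splits\<close>)
    also have "ren (ipos n (Suc n)) (f i) = ren (subst_var n (Suc n)) (f i)"
      by (rule xt_poly_ren_cong[OF fV])
        (use i in \<open>auto simp: xt_vars_def ipos_def subst_var_def split: var.splits\<close>)
    finally show ?thesis .
  qed
  have "\<exists>g'. xt_poly n g' \<and> homogeneous (Suc d) g' \<and> (\<forall>i. 1 \<le> i \<and> i \<le> n \<longrightarrow> ddiff i i g' = g i)"
  proof (rule Suc.IH)
    fix i assume i: "1 \<le> i" "i < n"
    then show "xt_poly (n - 1) (g i)"
      unfolding g_def using fV[of i]
      by (auto intro!: xt_poly_ren[of n] simp: xt_vars_def subst_var_def split: var.splits)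
  next
    assume "1 \<le> n"
    then show "xt_poly n (g n)"
      unfolding g_def using fV[of n] hV by (auto intro!: xt_poly_diff xt_poly_ddiff)
  next
    fix i j assume ij: "1 \<le> i" "i + 2 \<le> j" "j \<le> n"
    show "ddiff (j - 1) j (g i) = ddiff i i (g j)"
    proof (cases "j = n")
      case True
      have "ddiff i i (g n) = ddiff i i (f n) - ddiff i i (ddiff n n h)"
        by (simp add: g_def ddiff_diff)
      also have "\<dots> = ddiff (n - 1) n (f i) - ddiff (n - 1) n (ddiff i i h)"
        using compat[of i n] ddiff_commute[of i n n i h] ij True by simp
      also have "\<dots> = ddiff (n - 1) n (f i - ddiff i i h)"
        by (simp add: ddiff_diff)
      also have "f i - ddiff i i h = g i"
        using ddh[of i] ij True by (simp add: g_def)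
      finally show ?thesis using True by simp
    next
      case False
      then show ?thesis
        using ij compat[of i j] by (simp add: g_def ddiff_subst_var)
    qed
  next
    fix i assume "1 \<le> i" "i \<le> n"
    then show "homogeneous d (g i)"
      unfolding g_def by (auto intro!: homogeneous_diff homogeneous_ren homogeneous_ddiff fH hH)
  qed
  then obtain g' where g': "xt_poly n g'" "homogeneous (Suc d) g'"
    "\<And>i. 1 \<le> i \<Longrightarrow> i \<le> n \<Longrightarrow> ddiff i i g' = g i" by blast
  have last: "ddiff (Suc n) (Suc n) h = f (Suc n)"
  proof (rule ddiff_eqI)
    have "ren (ipos (Suc (Suc n)) (Suc n)) h = h"
      by (rule xt_poly_ren_id[OF hV]) (auto simp: xt_vars_def ipos_def split: var.splits)
    moreover have "ren (ipos (Suc n) (Suc n)) h = 0"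
      by (simp add: h_def ipos_def)
    ultimately show "f (Suc n) * (Var (X (Suc n)) - Var (T (Suc n)))
        = ren (ipos (Suc (Suc n)) (Suc n)) h - ren (ipos (Suc n) (Suc n)) h"
      by (simp add: h_def mult.commute)
  qed
  have "ddiff i i (g' + h) = f i" if i: "1 \<le> i" "i \<le> Suc n" for i
  proof -
    consider "i < n" | "i = n" | "i = Suc n" using i(2) by linarith
    then show ?thesis
    proof cases
      case 1
      then show ?thesis using i g'(3)[of i] ddh[of i] by (simp add: ddiff_add g_def)
    next
      case 2
      then show ?thesis using i g'(3)[of i] by (simp add: ddiff_add g_def)
    next
      case 3
      then show ?thesis using ddiff_eq_0[OF g'(1), of "Suc n"] by (simp add: ddiff_add last)
    qed
  qed
  moreover have "xt_poly (Suc n) (g' + h)"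
    by (intro xt_poly_add hV xt_poly_mono[OF g'(1)]) simp
  moreover have "homogeneous (Suc d) (g' + h)"
    by (intro homogeneous_add g'(2) hH)
  ultimately show ?case by blast
qed

section \<open>Codes and their polynomials\<close>

text \<open>In terms of codes: i is the leftmost leaf of a terminal node.\<close>

definition code_ready :: "(nat \<Rightarrow> nat) \<Rightarrow> nat \<Rightarrow> bool" where
  "code_ready c i \<longleftrightarrow> 0 < c i \<and> c (Suc i) = 0"

text \<open>The code of F/i when i is ready: one node over leaf i disappears, the leaves i and i + 1
  merge, and the entry 0 at i + 1 is dropped.\<close>

definition code_del :: "nat \<Rightarrow> (nat \<Rightarrow> nat) \<Rightarrow> nat \<Rightarrow> nat" where
  "code_del i c j = (if j < i then c j else if j = i then c i - 1 else c (Suc j))"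

definition code_on :: "nat \<Rightarrow> (nat \<Rightarrow> nat) \<Rightarrow> bool" where
  "code_on m c \<longleftrightarrow> c 0 = 0 \<and> (\<forall>j>m. c j = 0)"

text \<open>The number of internal nodes of the forest, which is also the degree of its
  polynomial.\<close>

definition code_size :: "(nat \<Rightarrow> nat) \<Rightarrow> nat" where
  "code_size c = (\<Sum>j | c j \<noteq> 0. c j)"

lemma code_size_eq: "code_on m c \<Longrightarrow> code_size c = (\<Sum>j\<le>m. c j)"
  unfolding code_size_def code_on_def by (rule sum.mono_neutral_left) (auto intro: leI)

lemma code_on_mono: "code_on m c \<Longrightarrow> m \<le> m' \<Longrightarrow> code_on m' c"
  by (auto simp: code_on_def)

lemma code_on_del: "code_on m c \<Longrightarrow> 1 \<le> i \<Longrightarrow> i < m \<Longrightarrow> code_on (m - 1) (code_del i c)"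
  and code_on_del': "code_on m c \<Longrightarrow> 1 \<le> i \<Longrightarrow> code_on m (code_del i c)"
  by (auto simp: code_on_def code_del_def)

lemma code_size_del:
  assumes "code_on m c" "1 \<le> i" "code_ready c i"
  shows "code_size c = Suc (code_size (code_del i c))"
proof -
  define k where "k = max m (Suc i)"
  have k: "code_on k c" "i < k" using assms(1) by (auto simp: k_def intro: code_on_mono)
  have split: "(\<Sum>j\<le>l. b j) = (\<Sum>j=0..<i. b j) + b i + (\<Sum>j=Suc i..<Suc l. b j)"
    if "i \<le> l" for l and b :: "nat \<Rightarrow> nat"
  proof -
    have "(\<Sum>j\<le>l. b j) = (\<Sum>j=0..<i. b j) + (\<Sum>j=i..<Suc l. b j)"
      using that sum.atLeastLessThan_concat[of 0 i "Suc l" b]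
      by (simp add: atLeast0LessThan lessThan_Suc_atMost del: sum.op_ivl_Suc)
    then show ?thesis using that by (simp add: sum.atLeast_Suc_lessThan del: sum.op_ivl_Suc)
  qed
  have "(\<Sum>j=Suc i..<Suc k. c j) = c (Suc i) + (\<Sum>j=Suc i..<k. c (Suc j))"
    using k(2) by (simp add: sum.atLeast_Suc_lessThan sum.shift_bounds_Suc_ivl del: sum.op_ivl_Suc)
  then have *: "code_size c = (\<Sum>j=0..<i. c j) + c i + c (Suc i) + (\<Sum>j=Suc i..<k. c (Suc j))"
    unfolding code_size_eq[OF k(1)] using split[of k c] k(2) by simp
  have "code_size (code_del i c)
      = (\<Sum>j=0..<i. code_del i c j) + code_del i c i + (\<Sum>j=Suc i..<k. code_del i c j)"
    unfolding code_size_eq[OF code_on_del[OF k(1) assms(2) k(2)]]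
    using split[of "k - 1" "code_del i c"] k(2) by simp
  also have "\<dots> = (\<Sum>j=0..<i. c j) + (c i - 1) + (\<Sum>j=Suc i..<k. c (Suc j))"
    by (simp add: code_del_def)
  finally show ?thesis using * assms(3) by (simp add: code_ready_def)
qed

lemma code_size_eq_0: "code_on m c \<Longrightarrow> code_size c = 0 \<longleftrightarrow> c = (\<lambda>_. 0)"
  by (auto simp: code_size_eq code_on_def fun_eq_iff) (meson atMost_iff leI)

text \<open>The combinatorial counterpart of \<open>ddiff_commute\<close>. Adjacent indices need no
  relation, since i and i + 1 are never both ready.\<close>

lemma code_ready_del:
  assumes "i + 2 \<le> j"
  shows "code_ready (code_del i c) (j - 1) \<longleftrightarrow> code_ready c j"
    and "code_ready (code_del j c) i \<longleftrightarrow> code_ready c i"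
    and "code_del (j - 1) (code_del i c) = code_del i (code_del j c)"
  using assms by (auto simp: code_ready_def code_del_def fun_eq_iff)

text \<open>The family \<open>Q\<close> supplies the polynomials of the smaller codes. As a
  parameter it can be one stage of the recursion on degree and, at the end, \<open>code_poly\<close>
  itself.\<close>

definition code_poly_spec :: "((nat \<Rightarrow> nat) \<Rightarrow> mpoly) \<Rightarrow> (nat \<Rightarrow> nat) \<Rightarrow> mpoly \<Rightarrow> bool" where
  "code_poly_spec Q c f \<longleftrightarrow> (\<forall>m. code_on m c \<longrightarrow> xt_poly m f) \<and> homogeneous (code_size c) f \<and>
     at_t f = (if c = (\<lambda>_. 0) then 1 else 0) \<and>
     (\<forall>i\<ge>1. ddiff i i f = (if code_ready c i then ren (omit_var i) (Q (code_del i c)) else 0))"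

primrec code_poly_aux :: "nat \<Rightarrow> (nat \<Rightarrow> nat) \<Rightarrow> mpoly" where
  "code_poly_aux 0 c = 1"
| "code_poly_aux (Suc d) c = (SOME f. code_poly_spec (code_poly_aux d) c f)"

definition code_poly :: "(nat \<Rightarrow> nat) \<Rightarrow> mpoly" where
  "code_poly c = code_poly_aux (code_size c) c"

lemma xt_poly_omit: "xt_poly m f \<Longrightarrow> xt_poly m (ren (omit_var i) f)"
  by (erule xt_poly_ren) (auto simp: xt_vars_def omit_var_def split: var.splits)

lemma xt_poly_at_t: "xt_poly m f \<Longrightarrow> xt_poly 0 (at_t f)"
  unfolding at_t_eq_ren by (erule xt_poly_ren) (auto simp: xt_vars_def split: var.splits)

lemma at_t_at_t: "at_t (at_t f) = at_t f"
  unfolding at_t_eq_ren ren_ren by (rule arg_cong[where f = "\<lambda>\<rho>. ren \<rho> f"]) (auto split: var.splits)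

text \<open>The prescribed values of the operators are compatible because deletions in the code and
  omissions of parameters commute. \<open>Q\<close> is the family one degree lower and
  \<open>Q'\<close> the family two degrees lower.\<close>

lemma code_poly_step_exists:
  assumes c: "code_on m c" "code_size c = Suc d"
    and Q: "\<And>m c. code_on m c \<Longrightarrow> code_size c = d \<Longrightarrow> code_poly_spec Q' c (Q c)"
  shows "\<exists>f. code_poly_spec Q c f"
proof -
  \<comment> \<open>The specification bounds the variables for every m with
    \<open>code_on m c\<close>, so the antiderivative is taken with the smallest such bound.\<close>
  define M where "M = (LEAST m. code_on m c)"
  have M: "code_on M c" unfolding M_def by (rule LeastI[of "\<lambda>m. code_on m c", OF c(1)])
  have M_le: "M \<le> k" if "code_on k c" for k unfolding M_def by (rule Least_le[of "\<lambda>m. code_on m c", OF that])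
  define f where "f i = (if code_ready c i then ren (omit_var i) (Q (code_del i c)) else 0)" for i
  have Qdel: "code_poly_spec Q' (code_del i c) (Q (code_del i c))" if "code_ready c i" "1 \<le> i" for i
    using code_size_del[OF c(1)] c(2) that by (intro Q[OF code_on_del'[OF c(1)]]) auto
  have "\<exists>g. xt_poly M g \<and> homogeneous (Suc d) g \<and> (\<forall>i. 1 \<le> i \<and> i \<le> M \<longrightarrow> ddiff i i g = f i)"
  proof (rule ddiff_antiderivative)
    fix i assume i: "1 \<le> i" "i < M"
    then show "xt_poly (M - 1) (f i)"
      using Qdel[of i] code_on_del[OF M i] by (auto simp: f_def code_poly_spec_def intro!: xt_poly_omit)
  next
    assume "1 \<le> M"
    then show "xt_poly M (f M)"
      using Qdel[of M] code_on_del'[OF M] by (auto simp: f_def code_poly_spec_def intro!: xt_poly_omit)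
  next
    fix i assume i: "1 \<le> i" "i \<le> M"
    then show "homogeneous d (f i)"
      using Qdel[of i] code_size_del[OF M, of i] c(2)
      by (auto simp: f_def code_poly_spec_def intro!: homogeneous_ren)
  next
    fix i j assume ij: "1 \<le> i" "i + 2 \<le> j" "j \<le> M"
    \<comment> \<open>Both sides vanish unless i and j are ready; otherwise each is a double
      omission applied to \<open>Q'\<close> of the code with both nodes deleted.\<close>
    have "ddiff (j - 1) j (f i) = (if code_ready c i \<and> code_ready c j
        then ren (omit_var i) (ren (omit_var (j - 1)) (Q' (code_del (j - 1) (code_del i c)))) else 0)"
    proof (cases "code_ready c i")
      case True
      then have "ddiff (j - 1) (j - 1) (Q (code_del i c))
          = (if code_ready c j then ren (omit_var (j - 1)) (Q' (code_del (j - 1) (code_del i c))) else 0)"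
        using Qdel[of i] ij code_ready_del(1)[OF ij(2)] by (auto simp: code_poly_spec_def)
      moreover have "(if j - 1 < i then j - 1 else Suc (j - 1)) = j" using ij by simp
      ultimately show ?thesis
        using ddiff_omit[of "j - 1" "j - 1" i "Q (code_del i c)"] True
        by (cases "code_ready c j") (simp_all only: f_def simp_thms if_True if_False ren_simps)
    qed (simp add: f_def)
    also have "\<dots> = (if code_ready c i \<and> code_ready c j
        then ren (omit_var j) (ren (omit_var i) (Q' (code_del i (code_del j c)))) else 0)"
      using ren_omit_omit[of i j] ij code_ready_del(3)[OF ij(2)] by simp
    also have "\<dots> = ddiff i i (f j)"
    proof (cases "code_ready c j")
      case True
      then have "ddiff i i (Q (code_del j c))
          = (if code_ready c i then ren (omit_var i) (Q' (code_del i (code_del j c))) else 0)"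
        using Qdel[of j] ij code_ready_del(2)[OF ij(2)] by (auto simp: code_poly_spec_def)
      then show ?thesis
        using ddiff_omit[of i i j "Q (code_del j c)"] ij True by (auto simp: f_def)
    qed (simp add: f_def)
    finally show "ddiff (j - 1) j (f i) = ddiff i i (f j)" .
  qed
  then obtain g where g: "xt_poly M g" "homogeneous (Suc d) g"
    "\<And>i. 1 \<le> i \<Longrightarrow> i \<le> M \<Longrightarrow> ddiff i i g = f i" by blast
  have gi: "ddiff i i g = f i" if i: "1 \<le> i" for i
  proof (cases "i \<le> M")
    case False
    then have "f i = 0" using M by (auto simp: f_def code_on_def code_ready_def)
    then show ?thesis using False ddiff_eq_0[OF g(1)] by simp
  qed (use g(3) i in auto)
  \<comment> \<open>\<open>at_t g\<close> contains no x and is killed by every operator. Subtracting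
    it normalises the value at x = t without changing any derivative.\<close>
  have "ddiff i i (at_t g) = 0" if "1 \<le> i" for i
    using ddiff_eq_0[OF xt_poly_at_t[OF g(1)], of i] that by simp
  then have "ddiff i i (g - at_t g) = f i" if "1 \<le> i" for i
    using gi that by (simp add: ddiff_diff)
  moreover have "at_t (g - at_t g) = 0"
    using at_t_at_t[of g] by (simp add: at_t_eq_ren)
  moreover have "homogeneous (Suc d) (g - at_t g)"
    by (intro homogeneous_diff g(2)) (simp add: at_t_eq_ren homogeneous_ren g(2))
  moreover have "xt_poly k (g - at_t g)" if "code_on k c" for k
    using M_le[OF that] g(1) xt_poly_at_t[OF g(1)] by (auto intro!: xt_poly_diff elim: xt_poly_mono)
  moreover have "c \<noteq> (\<lambda>_. 0)" using c code_size_eq_0[OF c(1)] by auto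
  ultimately have "code_poly_spec Q c (g - at_t g)"
    unfolding code_poly_spec_def c(2) f_def by simp
  then show ?thesis ..
qed

lemma code_poly_aux_spec:
  "code_on m c \<Longrightarrow> code_size c = d \<Longrightarrow> code_poly_spec (code_poly_aux (d - 1)) c (code_poly_aux d c)"
proof (induction d arbitrary: m c)
  case 0
  then have "c = (\<lambda>_. 0)" using code_size_eq_0 by auto
  then show ?case
    by (simp add: code_poly_spec_def code_ready_def at_t_eq_ren code_size_def homogeneous_iff_scaling)
next
  case (Suc d)
  have "\<exists>f. code_poly_spec (code_poly_aux d) c f"
    by (rule code_poly_step_exists[OF Suc.prems Suc.IH])
  then show ?case by (simp add: someI_ex)
qed

lemma code_poly:
  assumes "code_on m c"
  shows "code_poly_spec code_poly c (code_poly c)"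
proof -
  have "code_poly_spec (code_poly_aux (code_size c - 1)) c (code_poly c)"
    unfolding code_poly_def by (rule code_poly_aux_spec[OF assms refl])
  moreover have "code_poly_aux (code_size c - 1) (code_del i c) = code_poly (code_del i c)"
    if "code_ready c i" "1 \<le> i" for i
    using code_size_del[OF assms that(2,1)] by (simp add: code_poly_def)
  ultimately show ?thesis
    by (simp add: code_poly_spec_def)
qed

text \<open>If the operator at the last index n + 1 kills f, then f equals its own specialisation
  x_(n+1) = t_(n+1), so this variable does not occur. Then descend.\<close>

lemma xt_poly_0_if_ddiff_0:
  assumes "xt_poly n f" "\<And>i. 1 \<le> i \<Longrightarrow> ddiff i i f = 0"
  shows "xt_poly 0 f"
  using assms(1)
proof (induction n)
  case (Suc n)
  have "ren (ipos (Suc (Suc n)) (Suc n)) f = ren (ipos (Suc n) (Suc n)) f"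
    using ddiff_mult[of "Suc n" "Suc n" f] assms(2)[of "Suc n"] by simp
  moreover have "ren (ipos (Suc (Suc n)) (Suc n)) f = f"
    by (rule xt_poly_ren_id[OF Suc.prems]) (auto simp: xt_vars_def ipos_def split: var.splits)
  moreover have "xt_poly n (ren (ipos (Suc n) (Suc n)) f)"
    by (rule xt_poly_ren[OF Suc.prems]) (auto simp: xt_vars_def ipos_def split: var.splits)
  ultimately show ?case using Suc.IH by simp
qed

lemma xt_poly_exists:
  assumes "\<forall>v\<in>vars f. admissible_var v"
  shows "\<exists>n. xt_poly n f"
proof -
  have fin: "finite (vars f)" by (simp add: vars_def)
  define idx where "idx v = (case v of X j \<Rightarrow> j | T j \<Rightarrow> j)" for v
  have "xt_poly (Max (insert 0 (idx ` vars f))) f"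
    unfolding xt_poly_def
  proof
    fix v assume v: "v \<in> vars f"
    then have "idx v \<le> Max (insert 0 (idx ` vars f))" using fin by (intro Max_ge) auto
    then show "v \<in> xt_vars (Max (insert 0 (idx ` vars f)))"
      using assms v by (auto simp: xt_vars_def admissible_var_def idx_def split: var.splits)
  qed
  then show ?thesis ..
qed

lemma mpoly_eqI_ddiff:
  assumes "\<forall>v\<in>vars f. admissible_var v" "\<forall>v\<in>vars g. admissible_var v"
    and "\<And>i. 1 \<le> i \<Longrightarrow> ddiff i i f = ddiff i i g" "at_t f = at_t g"
  shows "f = g"
proof -
  obtain n m where "xt_poly n f" "xt_poly m g" using xt_poly_exists assms(1,2) by blast
  then have "xt_poly (max n m) (f - g)" by (intro xt_poly_diff) (auto elim: xt_poly_mono)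
  then have "xt_poly 0 (f - g)"
    by (rule xt_poly_0_if_ddiff_0) (simp add: ddiff_diff assms(3))
  then have "at_t (f - g) = f - g"
    unfolding at_t_eq_ren by (rule xt_poly_ren_id) (auto simp: xt_vars_def split: var.splits)
  moreover have "at_t (f - g) = 0" using assms(4) by (simp add: at_t_eq_ren)
  ultimately show ?thesis by simp
qed

section \<open>Indexed forests and their codes\<close>

definition tree_code :: "nat \<Rightarrow> btree \<Rightarrow> nat \<Rightarrow> nat" where
  "tree_code k t i = length (filter (\<lambda>x. fst x = i) (nodes k t))"

lemma tree_code_simps [simp]:
  "tree_code k Lf i = 0"
  "tree_code k (Nd l r) i = (if i = k then 1 else 0) + tree_code k l i + tree_code (k + nleaves l) r i"
  by (auto simp: tree_code_def)

lemma nleaves_pos [simp]: "0 < nleaves t"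
  by (induction t) auto

lemma nleaves_ge_2: "t \<noteq> Lf \<Longrightarrow> 2 \<le> nleaves t"
proof (cases t)
  case (Nd l r)
  then show ?thesis using nleaves_pos[of l] nleaves_pos[of r] by (simp del: nleaves_pos)
qed simp

text \<open>The leaves are k, ..., k + \<open>nleaves t\<close> - 1. A leftmost descendant leaf is
  never the last leaf, because the right subtree of the node still lies to its right.\<close>

lemma tree_code_pos_range: "0 < tree_code k t i \<Longrightarrow> k \<le> i \<and> i + 2 \<le> k + nleaves t"
proof (induction t arbitrary: k)
  case (Nd l r)
  have "1 \<le> nleaves l" "1 \<le> nleaves r" by (simp_all add: Suc_leI)
  with Nd.IH(1)[of k] Nd.IH(2)[of "k + nleaves l"] Nd.prems show ?case by (auto split: if_splits)
qed simp

lemma tree_code_eq_0: "i < k \<or> k + nleaves t < i + 2 \<Longrightarrow> tree_code k t i = 0"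
  using tree_code_pos_range[of k t i] by (cases "tree_code k t i") auto

lemma tree_code_root: "0 < tree_code k t k \<longleftrightarrow> t \<noteq> Lf"
  by (cases t) auto

lemma tree_code_shift: "tree_code (k + s) t (i + s) = tree_code k t i"
proof (induction t arbitrary: k)
  case (Nd l r)
  from Nd(2)[of "k + nleaves l"] have "tree_code (k + s + nleaves l) r (i + s) = tree_code (k + nleaves l) r i"
    by (simp add: add.commute add.left_commute)
  with Nd(1) show ?case by simp
qed simp

lemma fst_nodes: "(i, b) \<in> set (nodes k t) \<Longrightarrow> 0 < tree_code k t i"
  by (force simp: tree_code_def filter_empty_conv)

text \<open>The lowest node with leftmost leaf i has the leaf i as left child, and its right subtree
  starts at leaf i + 1. That subtree is a single leaf exactly if no node has i + 1 as its leftmost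
  leaf.\<close>

lemma terminal_iff_code_ready: "(i, True) \<in> set (nodes k t) \<longleftrightarrow> code_ready (tree_code k t) i"
proof (induction t arbitrary: k)
  case (Nd l r)
  have rng: "tree_code k l x = 0" if "k + nleaves l < x + 2" for x
    using that by (simp add: tree_code_eq_0)
  have rng': "tree_code (k + nleaves l) r x = 0" if "x < k + nleaves l" for x
    using that by (simp add: tree_code_eq_0)
  have rt: "0 < tree_code k l k \<longleftrightarrow> l \<noteq> Lf" "0 < tree_code (k + nleaves l) r (k + nleaves l) \<longleftrightarrow> r \<noteq> Lf"
    by (rule tree_code_root)+
  have low: "tree_code k l x = 0" if "x < k" for x
    using that by (simp add: tree_code_eq_0)
  have IH: "(i, True) \<in> set (nodes k (Nd l r)) \<longleftrightarrow> (i = k \<and> l = Lf \<and> r = Lf)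
      \<or> code_ready (tree_code k l) i \<or> code_ready (tree_code (k + nleaves l) r) i"
    using Nd by auto
  show ?case
  proof (cases "k + nleaves l \<le> Suc i")
    case True
    show ?thesis
    proof (cases "l = Lf")
      case True
      then show ?thesis unfolding IH code_ready_def using rt rng'[of i] rng'[of "Suc i"] low
        by (cases "i = k"; cases "Suc i = k") auto
    next
      case False
      then have "2 \<le> nleaves l" by (rule nleaves_ge_2)
      then show ?thesis unfolding IH code_ready_def using True rng[of i] rng[of "Suc i"] False
        by auto
    qed
  next
    case F: False
    then have "l \<noteq> Lf \<or> Suc i \<le> k" by auto
    then show ?thesis unfolding IH code_ready_def
      using F rt rng'[of i] rng'[of "Suc i"] low[of i] by auto
  qed
qed (simp add: code_ready_def)

lemma contract_tree_id: "(i, True) \<notin> set (nodes k t) \<Longrightarrow> contract_tree k i t = t"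
  by (induction t arbitrary: k) auto

lemma contract_tree_code:
  assumes "(i, True) \<in> set (nodes k t)"
  shows "nleaves t = Suc (nleaves (contract_tree k i t)) \<and>
    tree_code k (contract_tree k i t) = code_del i (tree_code k t)"
  using assms
proof (induction t arbitrary: k)
  case (Nd l r)
  show ?case
  proof (cases "l = Lf \<and> r = Lf")
    case True
    then show ?thesis using Nd.prems by (auto simp: fun_eq_iff code_del_def)
  next
    case nt: False
    then consider "(i, True) \<in> set (nodes k l)" | "(i, True) \<in> set (nodes (k + nleaves l) r)"
      using Nd.prems by auto
    then show ?thesis
    proof cases
      case 1
      note IH = Nd.IH(1)[OF 1]
      have i: "k \<le> i" "i + 2 \<le> k + nleaves l" "0 < tree_code k l i"
        using fst_nodes[OF 1] tree_code_pos_range[of k l i] by auto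
      have "(i, True) \<notin> set (nodes (k + nleaves l) r)"
        using fst_nodes[of i True "k + nleaves l" r] tree_code_pos_range[of "k + nleaves l" r i] i by auto
      then have c: "contract_tree k i (Nd l r) = Nd (contract_tree k i l) r"
        using nt by (auto simp: contract_tree_id)
      \<comment> \<open>Contracting in the left subtree removes one leaf, so the right subtree
        starts one label earlier; this is the shift built into \<open>code_del\<close>.\<close>
      have "tree_code (k + nleaves (contract_tree k i l)) r j = tree_code (k + nleaves l) r (Suc j)" for j
        using tree_code_shift[of "k + nleaves (contract_tree k i l)" 1 r j] IH by simp
      moreover have "tree_code (k + nleaves l) r j = 0" if "j \<le> Suc i" for j
        using that i by (simp add: tree_code_eq_0)
      ultimately show ?thesis unfolding c using IH i by (auto simp: fun_eq_iff code_del_def)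
    next
      case 2
      note IH = Nd.IH(2)[OF 2]
      have i: "k + nleaves l \<le> i" "0 < tree_code (k + nleaves l) r i"
        using fst_nodes[OF 2] tree_code_pos_range[of "k + nleaves l" r i] by auto
      have "(i, True) \<notin> set (nodes k l)"
        using fst_nodes[of i True k l] tree_code_pos_range[of k l i] i by auto
      then have c: "contract_tree k i (Nd l r) = Nd l (contract_tree (k + nleaves l) i r)"
        using nt by (auto simp: contract_tree_id)
      have "tree_code k l j = 0" if "i \<le> j" for j
        using that i by (simp add: tree_code_eq_0)
      moreover have "k < i" using i(1) nleaves_pos[of l] by linarith
      ultimately show ?thesis unfolding c using IH i by (auto simp: fun_eq_iff code_del_def)
    qed
  qed
qed simp

lemma tree_offset_Suc: "tree_offset F (Suc j) = tree_offset F j + nleaves (Rep_iforest F j)"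
  by (simp add: tree_offset_def)

lemma tree_offset_less: "j < j' \<Longrightarrow> tree_offset F j < tree_offset F j'"
  by (rule lift_Suc_mono_less[of "tree_offset F"]) (simp add: tree_offset_Suc)

lemma tree_offset_le: "j \<le> j' \<Longrightarrow> tree_offset F j \<le> tree_offset F j'"
  using tree_offset_less[of j j' F] by (cases "j = j'") auto

lemma tree_offset_0: "tree_offset F 0 = 1"
  by (simp add: tree_offset_def)

lemma tree_offset_exists:
  assumes "1 \<le> i"
  shows "\<exists>j. tree_offset F j \<le> i \<and> i < tree_offset F (Suc j)"
proof -
  have "j < tree_offset F j" for j
    by (induction j) (simp_all add: tree_offset_0, metis Suc_lessI tree_offset_less lessI not_less_eq order.strict_trans)
  then have "\<exists>j. i < tree_offset F j" by blast
  then have L: "i < tree_offset F (LEAST j. i < tree_offset F j)" by (rule LeastI_ex)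
  then obtain m where m: "(LEAST j. i < tree_offset F j) = Suc m"
    using assms by (cases "LEAST j. i < tree_offset F j") (auto simp: tree_offset_0)
  have "\<not> i < tree_offset F m" by (rule not_less_Least) (simp add: m)
  with L m show ?thesis by (intro exI[of _ m]) auto
qed

lemma tree_offset_unique:
  assumes "tree_offset F j \<le> i" "i < tree_offset F (Suc j)" "tree_offset F j' \<le> i" "i < tree_offset F (Suc j')"
  shows "j = j'"
proof (rule ccontr)
  assume "j \<noteq> j'"
  then have "Suc j \<le> j' \<or> Suc j' \<le> j" by auto
  then show False using assms tree_offset_le[of "Suc j" j' F] tree_offset_le[of "Suc j'" j F] by auto
qed

lemma tree_code_pos_offset:
  assumes "0 < tree_code (tree_offset F j) (Rep_iforest F j) i"
  shows "tree_offset F j \<le> i" "Suc i < tree_offset F (Suc j)"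
  using tree_code_pos_range[OF assms] by (auto simp: tree_offset_Suc)

text \<open>Trees occupy disjoint intervals of leaves, so every node counted at i belongs to the
  tree containing leaf i.\<close>

lemma forest_code_eq_tree_code:
  assumes "tree_offset F J \<le> i" "i < tree_offset F (Suc J)"
  shows "forest_code F i = tree_code (tree_offset F J) (Rep_iforest F J) i"
proof -
  let ?N = "\<lambda>j. nodes (tree_offset F j) (Rep_iforest F j)"
  have "j = J" if "p < length (?N j)" "fst (?N j ! p) = i" for j p
  proof -
    have "(i, snd (?N j ! p)) \<in> set (?N j)"
      using that nth_mem[OF that(1)] by (metis prod.collapse)
    then have "0 < tree_code (tree_offset F j) (Rep_iforest F j) i" by (rule fst_nodes)
    from tree_code_pos_offset[OF this] show ?thesis using tree_offset_unique assms by auto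
  qed
  then have "{(j, p). p < length (?N j) \<and> fst (?N j ! p) = i} = Pair J ` {p. p < length (?N J) \<and> fst (?N J ! p) = i}"
    by auto
  then show ?thesis
    unfolding forest_code_def tree_code_def
    by (simp add: card_image inj_on_def length_filter_conv_card)
qed

lemma forest_code_0: "forest_code F 0 = 0"
proof -
  have "fst (nodes (tree_offset F j) (Rep_iforest F j) ! p) \<noteq> 0"
    if "p < length (nodes (tree_offset F j) (Rep_iforest F j))" for j p
  proof -
    obtain x b where x: "nodes (tree_offset F j) (Rep_iforest F j) ! p = (x, b)" by fastforce
    then have "(x, b) \<in> set (nodes (tree_offset F j) (Rep_iforest F j))" using nth_mem[OF that] by simp
    then show ?thesis using tree_code_pos_offset(1)[OF fst_nodes] x tree_offset_le[of 0 j F]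
      by (fastforce simp: tree_offset_0)
  qed
  then have "{(j, p). p < length (nodes (tree_offset F j) (Rep_iforest F j))
      \<and> fst (nodes (tree_offset F j) (Rep_iforest F j) ! p) = 0} = {}" by auto
  then show ?thesis unfolding forest_code_def by (simp only: card.empty)
qed

lemma Qdes_iff: "i \<in> Qdes F \<longleftrightarrow> code_ready (forest_code F) i"
proof
  assume "i \<in> Qdes F"
  then obtain j where j: "(i, True) \<in> set (nodes (tree_offset F j) (Rep_iforest F j))"
    by (auto simp: Qdes_def)
  note off = tree_code_pos_offset[OF fst_nodes[OF j]]
  have "forest_code F i = tree_code (tree_offset F j) (Rep_iforest F j) i"
    "forest_code F (Suc i) = tree_code (tree_offset F j) (Rep_iforest F j) (Suc i)"
    using off by (auto intro!: forest_code_eq_tree_code)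
  with j show "code_ready (forest_code F) i"
    unfolding terminal_iff_code_ready by (simp add: code_ready_def)
next
  assume r: "code_ready (forest_code F) i"
  then have "1 \<le> i" using forest_code_0[of F] by (cases i) (auto simp: code_ready_def)
  then obtain j where j: "tree_offset F j \<le> i" "i < tree_offset F (Suc j)"
    using tree_offset_exists by blast
  have e: "forest_code F i = tree_code (tree_offset F j) (Rep_iforest F j) i"
    by (rule forest_code_eq_tree_code[OF j])
  \<comment> \<open>A positive entry at i shows that i is not the last leaf of its tree, so the
    entry at i + 1 is read off the same tree.\<close>
  then have "Suc i < tree_offset F (Suc j)"
    using r tree_code_pos_offset(2) by (auto simp: code_ready_def)
  with j have "forest_code F (Suc i) = tree_code (tree_offset F j) (Rep_iforest F j) (Suc i)"
    by (intro forest_code_eq_tree_code) auto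
  with e r have "(i, True) \<in> set (nodes (tree_offset F j) (Rep_iforest F j))"
    unfolding terminal_iff_code_ready by (simp add: code_ready_def)
  then show "i \<in> Qdes F" by (auto simp: Qdes_def)
qed

lemma finite_Rep_iforest: "finite {j. Rep_iforest F j \<noteq> Lf}"
  using Rep_iforest[of F] by simp

lemma Rep_contract: "Rep_iforest (contract F i) j = contract_tree (tree_offset F j) i (Rep_iforest F j)"
proof -
  have "finite {j. contract_tree (tree_offset F j) i (Rep_iforest F j) \<noteq> Lf}"
    by (rule finite_subset[OF _ finite_Rep_iforest[of F]]) auto
  then show ?thesis unfolding contract_def by (simp add: Abs_iforest_inverse)
qed

lemma Rep_empty_forest: "Rep_iforest empty_forest j = Lf"
  unfolding empty_forest_def by (simp add: Abs_iforest_inverse)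

lemma empty_forest_iff: "F = empty_forest \<longleftrightarrow> forest_code F = (\<lambda>_. 0)"
proof
  assume F: "F = empty_forest"
  show "forest_code F = (\<lambda>_. 0)"
  proof
    fix i show "forest_code F i = 0"
    proof (cases "i = 0")
      case False
      then obtain j where "tree_offset F j \<le> i" "i < tree_offset F (Suc j)"
        using tree_offset_exists[of i F] by auto
      from forest_code_eq_tree_code[OF this] show ?thesis by (simp add: F Rep_empty_forest)
    qed (simp add: forest_code_0)
  qed
next
  assume c: "forest_code F = (\<lambda>_. 0)"
  have "Rep_iforest F j = Lf" for j
    using forest_code_eq_tree_code[of F j "tree_offset F j"] tree_code_root[of "tree_offset F j" "Rep_iforest F j"]
    by (simp add: c tree_offset_Suc)
  then have "Rep_iforest F = Rep_iforest empty_forest" by (simp add: fun_eq_iff Rep_empty_forest)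
  then show "F = empty_forest" by (simp add: Rep_iforest_inject)
qed

lemma supp_iff: "supp F \<subseteq> {1..n} \<longleftrightarrow> (\<forall>j. Rep_iforest F j \<noteq> Lf \<longrightarrow> tree_offset F (Suc j) \<le> Suc n)"
proof -
  have "{tree_offset F j..<tree_offset F (Suc j)} \<subseteq> {1..n} \<longleftrightarrow> tree_offset F (Suc j) \<le> Suc n" for j
  proof -
    have *: "tree_offset F j < tree_offset F (Suc j)" "1 \<le> tree_offset F j"
      by (simp_all add: tree_offset_less) (simp add: tree_offset_def)
    show ?thesis
    proof
      assume "{tree_offset F j..<tree_offset F (Suc j)} \<subseteq> {1..n}"
      then have "tree_offset F (Suc j) - 1 \<in> {1..n}" using * by (auto dest!: subsetD[of _ _ "tree_offset F (Suc j) - 1"])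
      then show "tree_offset F (Suc j) \<le> Suc n" unfolding atLeastAtMost_iff by linarith
    qed (use * in auto)
  qed
  then show ?thesis unfolding supp_def tree_offset_Suc[symmetric] by blast
qed

lemma supp_bounded: "\<exists>n. supp F \<subseteq> {1..n}"
proof -
  have "tree_offset F (Suc j) \<le> Suc (tree_offset F (Suc (Max {j. Rep_iforest F j \<noteq> Lf})))"
    if "Rep_iforest F j \<noteq> Lf" for j
  proof -
    have "j \<le> Max {j. Rep_iforest F j \<noteq> Lf}" using that finite_Rep_iforest[of F] by simp
    then show ?thesis using tree_offset_le[of "Suc j" "Suc (Max {j. Rep_iforest F j \<noteq> Lf})" F] by simp
  qed
  then show ?thesis unfolding supp_iff by blast
qed

lemma forest_code_less:
  assumes "supp F \<subseteq> {1..n}" "0 < forest_code F i"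
  shows "i < n"
proof -
  have "1 \<le> i" using assms(2) forest_code_0[of F] by (cases i) auto
  then obtain j where j: "tree_offset F j \<le> i" "i < tree_offset F (Suc j)"
    using tree_offset_exists by blast
  have pos: "0 < tree_code (tree_offset F j) (Rep_iforest F j) i"
    using assms(2) by (simp add: forest_code_eq_tree_code[OF j])
  then have "Rep_iforest F j \<noteq> Lf" by auto
  then show ?thesis using assms(1) tree_code_pos_offset(2)[OF pos] unfolding supp_iff by fastforce
qed

lemma code_on_forest_code: "supp F \<subseteq> {1..n} \<Longrightarrow> code_on n (forest_code F)"
  using forest_code_less[of F n] forest_code_0[of F] unfolding code_on_def
  by (metis gr0I less_asym)

lemma contract_offset:
  assumes i: "(i, True) \<in> set (nodes (tree_offset F J) (Rep_iforest F J))"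
  shows "j \<noteq> J \<Longrightarrow> Rep_iforest (contract F i) j = Rep_iforest F j"
    and "tree_offset F j = (if j \<le> J then tree_offset (contract F i) j else Suc (tree_offset (contract F i) j))"
proof -
  show other: "Rep_iforest (contract F i) j = Rep_iforest F j" if "j \<noteq> J" for j
  proof -
    have "(i, True) \<notin> set (nodes (tree_offset F j) (Rep_iforest F j))"
    proof
      assume i': "(i, True) \<in> set (nodes (tree_offset F j) (Rep_iforest F j))"
      have "j = J"
        using tree_code_pos_offset[OF fst_nodes[OF i]] tree_code_pos_offset[OF fst_nodes[OF i']]
        by (intro tree_offset_unique[of F j i J]) auto
      with that show False by simp
    qed
    then show ?thesis by (simp add: Rep_contract contract_tree_id)
  qed
  have J: "nleaves (Rep_iforest F J) = Suc (nleaves (Rep_iforest (contract F i) J))"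
    using contract_tree_code[OF i] by (simp add: Rep_contract)
  show "tree_offset F j = (if j \<le> J then tree_offset (contract F i) j else Suc (tree_offset (contract F i) j))"
  proof (induction j)
    case (Suc j)
    then show ?case using J other[of j] by (cases j J rule: linorder_cases) (auto simp: tree_offset_Suc)
  qed (simp add: tree_offset_0)
qed

lemma forest_code_contract:
  assumes "i \<in> Qdes F"
  shows "forest_code (contract F i) = code_del i (forest_code F)"
proof
  fix x
  obtain J where J: "(i, True) \<in> set (nodes (tree_offset F J) (Rep_iforest F J))"
    using assms by (auto simp: Qdes_def)
  let ?G = "contract F i"
  note offi = tree_code_pos_offset[OF fst_nodes[OF J]]
  note off = contract_offset(2)[OF J]
  show "forest_code ?G x = code_del i (forest_code F) x"
  proof (cases "x = 0")
    case True
    moreover have "0 < i" using offi tree_offset_le[of 0 J F] by (simp add: tree_offset_0)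
    ultimately show ?thesis by (simp add: forest_code_0 code_del_def)
  next
    case False
    then obtain j where j: "tree_offset ?G j \<le> x" "x < tree_offset ?G (Suc j)"
      using tree_offset_exists[of x ?G] by auto
    note cG = forest_code_eq_tree_code[OF j]
    consider "j < J" | "j = J" | "J < j" by linarith
    then show ?thesis
    proof cases
      case 1
      then have jF: "tree_offset F j \<le> x" "x < tree_offset F (Suc j)"
        using j off[of j] off[of "Suc j"] by auto
      moreover have "tree_offset F (Suc j) \<le> i" using 1 offi tree_offset_le[of "Suc j" J F] by simp
      ultimately show ?thesis
        using cG forest_code_eq_tree_code[OF jF] contract_offset(1)[OF J, of j] 1 off[of j]
        by (simp add: code_del_def)
    next
      case 2
      have e: "forest_code F y = tree_code (tree_offset F J) (Rep_iforest F J) y"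
        if "tree_offset F J \<le> y" "y < tree_offset F (Suc J)" for y
        by (rule forest_code_eq_tree_code[OF that])
      have "forest_code ?G x = code_del i (tree_code (tree_offset F J) (Rep_iforest F J)) x"
        using contract_tree_code[OF J] cG 2 off[of J] by (simp add: Rep_contract)
      also have "\<dots> = code_del i (forest_code F) x"
        using e j 2 off[of J] off[of "Suc J"] offi by (auto simp: code_del_def)
      finally show ?thesis .
    next
      case 3
      then have jF: "tree_offset F j \<le> Suc x" "Suc x < tree_offset F (Suc j)"
        using j off[of j] off[of "Suc j"] by auto
      moreover have "tree_offset F (Suc J) \<le> tree_offset F j" using 3 by (intro tree_offset_le) simp
      moreover have "tree_code (tree_offset F j) (Rep_iforest F j) (Suc x)
          = tree_code (tree_offset ?G j) (Rep_iforest ?G j) x"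
        using 3 off[of j] contract_offset(1)[OF J, of j]
          tree_code_shift[of "tree_offset ?G j" 1 "Rep_iforest F j" x] by simp
      ultimately show ?thesis
        using cG forest_code_eq_tree_code[OF jF] offi by (simp add: code_del_def)
    qed
  qed
qed

lemma supp_contract:
  assumes "supp F \<subseteq> {1..n}" "i \<in> Qdes F"
  shows "supp (contract F i) \<subseteq> {1..n - 1}"
  unfolding supp_iff
proof (intro allI impI)
  fix j assume j: "Rep_iforest (contract F i) j \<noteq> Lf"
  obtain J where J: "(i, True) \<in> set (nodes (tree_offset F J) (Rep_iforest F J))"
    using assms by (auto simp: Qdes_def)
  have "i < n" using assms forest_code_less by (auto simp: Qdes_iff code_ready_def)
  have nL: "Rep_iforest F j \<noteq> Lf" using j by (auto simp: Rep_contract)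
  note offi = tree_code_pos_offset[OF fst_nodes[OF J]]
  note off = contract_offset(2)[OF J, of "Suc j"]
  show "tree_offset (contract F i) (Suc j) \<le> Suc (n - 1)"
  proof (cases "j < J")
    case True
    then have "tree_offset F (Suc j) \<le> i" using offi tree_offset_le[of "Suc j" J F] by simp
    then show ?thesis using off True \<open>i < n\<close> by simp
  next
    case False
    then show ?thesis using off assms(1) nL \<open>i < n\<close> unfolding supp_iff by fastforce
  qed
qed

section \<open>Existence and uniqueness of the double forest polynomials\<close>

lemma code_on_forest_code_exists: "\<exists>m. code_on m (forest_code F)"
  using supp_bounded code_on_forest_code by blast

lemma forest_poly_spec_exists: "forest_poly_spec (\<lambda>F. code_poly (forest_code F))"
  unfolding forest_poly_spec_def
proof (intro allI conjI ballI impI)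
  fix F
  obtain m where m: "code_on m (forest_code F)" using code_on_forest_code_exists by blast
  note Q = code_poly[OF m, unfolded code_poly_spec_def]
  show "\<exists>d. homogeneous d (code_poly (forest_code F))" using Q by blast
  show "at_t (code_poly (forest_code F)) = (if F = empty_forest then 1 else 0)"
    using Q by (simp add: empty_forest_iff)
  show "Eop i (code_poly (forest_code F)) = (if i \<in> Qdes F then omit_t i (code_poly (forest_code (contract F i))) else 0)"
    if "i \<ge> 1" for i
    using Q that by (simp add: Eop_eq_ddiff Qdes_iff forest_code_contract omit_t_eq_ren)
  fix v assume "v \<in> vars (code_poly (forest_code F))"
  moreover have "xt_poly m (code_poly (forest_code F))" using Q m by blast
  ultimately show "admissible_var v"
    by (force simp: xt_poly_def xt_vars_def admissible_var_def split: var.splits)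
qed

text \<open>Induction on the number of nodes: the values of all the operators are determined by
  smaller forests, and these values together with the value at x = t determine the
  polynomial.\<close>

lemma forest_poly_spec_unique:
  assumes "forest_poly_spec P" "forest_poly_spec P'"
  shows "P F = P' F"
proof (induction "code_size (forest_code F)" arbitrary: F rule: less_induct)
  case less
  obtain m where m: "code_on m (forest_code F)" using code_on_forest_code_exists by blast
  note P = assms[unfolded forest_poly_spec_def Eop_eq_ddiff, rule_format, of F]
  show ?case
  proof (rule mpoly_eqI_ddiff)
    fix i :: nat assume i: "1 \<le> i"
    have "P (contract F i) = P' (contract F i)" if "i \<in> Qdes F"
      by (rule less) (use code_size_del[OF m i] that in \<open>auto simp: Qdes_iff forest_code_contract\<close>)
    then show "ddiff i i (P F) = ddiff i i (P' F)" using P i by auto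
  qed (use P in auto)
qed

lemma forest_poly_spec: "forest_poly_spec forest_poly"
  unfolding forest_poly_def
proof (rule theI'[of forest_poly_spec])
  show "\<exists>!P. forest_poly_spec P"
    using forest_poly_spec_exists forest_poly_spec_unique by (metis ext)
qed

section \<open>Noncrossing permutations\<close>

text \<open>This describes the permutations of noncrossing partitions without mentioning blocks: the gap
  below a non-minimal element of a block, and the convex hull of a block, are invariant.\<close>

definition ncp :: "nat \<Rightarrow> (nat \<Rightarrow> nat) \<Rightarrow> bool" where
  "ncp n \<sigma> \<longleftrightarrow> \<sigma> permutes {1..n} \<and>
     (\<forall>a b. \<sigma> a < b \<longrightarrow> b < a \<longrightarrow> \<sigma> a < \<sigma> b \<and> \<sigma> b < a) \<and>
     (\<forall>a b. a \<le> b \<longrightarrow> b \<le> \<sigma> a \<longrightarrow> a \<le> \<sigma> b \<and> \<sigma> b \<le> \<sigma> a)"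

section \<open>Inserting and deleting an element of a permutation\<close>

definition up :: "nat \<Rightarrow> nat \<Rightarrow> nat" where
  "up i x = (if x < i then x else Suc x)"

definition dn :: "nat \<Rightarrow> nat \<Rightarrow> nat" where
  "dn i x = (if x < i then x else x - 1)"

text \<open>On permutation matrices: a new row and a new column whose only entry 1 is their common
  one, at position p and value i. \<open>delat\<close> removes them again.\<close>

definition insat :: "nat \<Rightarrow> nat \<Rightarrow> (nat \<Rightarrow> nat) \<Rightarrow> nat \<Rightarrow> nat" where
  "insat p i \<omega> x = (if x = p then i else up i (\<omega> (dn p x)))"

definition delat :: "nat \<Rightarrow> nat \<Rightarrow> (nat \<Rightarrow> nat) \<Rightarrow> nat \<Rightarrow> nat" where
  "delat p i \<sigma> x = dn i (\<sigma> (up p x))"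

abbreviation swap :: "nat \<Rightarrow> (nat \<Rightarrow> nat) \<Rightarrow> nat \<Rightarrow> nat" where
  "swap i \<sigma> \<equiv> \<sigma> \<circ> Defs.transp i (Suc i)"

text \<open>\<open>i\<close> is the minimum of its block and \<open>i + 1\<close> is not: either \<open>{i}\<close> is a block nested under
  the block of \<open>i + 1\<close>, or \<open>i\<close> and \<open>i + 1\<close> share a block. These \<open>i\<close> correspond to \<open>Qdes\<close>.\<close>

definition ready :: "(nat \<Rightarrow> nat) \<Rightarrow> nat \<Rightarrow> bool" where
  "ready \<sigma> i \<longleftrightarrow> i \<le> \<sigma> i \<and> \<sigma> (Suc i) \<le> i"

text \<open>After the insertion the old element i is called i + 1. If it was not the minimum of its
  block, then {i} becomes a fixed point; if it was, then i joins that block as its new minimum.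
  These are the two ways of making i ready.\<close>

definition ins :: "nat \<Rightarrow> (nat \<Rightarrow> nat) \<Rightarrow> nat \<Rightarrow> nat" where
  "ins i \<omega> = insat (if \<omega> i < i then i else Suc i) i \<omega>"

definition del :: "nat \<Rightarrow> (nat \<Rightarrow> nat) \<Rightarrow> nat \<Rightarrow> nat" where
  "del i \<sigma> = delat (if \<sigma> i = i then i else Suc i) i \<sigma>"

lemma dn_up [simp]: "dn i (up i x) = x"
  by (auto simp: dn_def up_def)

lemma up_dn: "x \<noteq> i \<Longrightarrow> up i (dn i x) = x"
  by (auto simp: dn_def up_def)

lemma up_neq [simp]: "up i x \<noteq> i" "i \<noteq> up i x"
  by (auto simp: up_def)

lemma up_less_iff [simp]: "up i x < up i y \<longleftrightarrow> x < y"
  by (auto simp: up_def)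

lemma up_le_iff [simp]: "up i x \<le> up i y \<longleftrightarrow> x \<le> y"
  by (auto simp: up_def)

lemma up_eq_iff [simp]: "up i x = up i y \<longleftrightarrow> x = y"
  by (auto simp: up_def)

lemma up_cases: obtains "x = i" | y where "x = up i y"
  using up_dn[of x i] by metis

lemma insat_same [simp]: "insat p i \<omega> p = i"
  by (simp add: insat_def)

lemma insat_up [simp]: "insat p i \<omega> (up p x) = up i (\<omega> x)"
  by (simp add: insat_def)

lemma insat_delat:
  assumes "inj \<sigma>" "\<sigma> p = i"
  shows "insat p i (delat p i \<sigma>) = \<sigma>"
proof
  fix x
  show "insat p i (delat p i \<sigma>) x = \<sigma> x"
  proof (cases x p rule: up_cases)
    case (2 y)
    then have "\<sigma> (up p y) \<noteq> i" using assms by (metis injD up_neq(1))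
    with 2 show ?thesis by (simp add: delat_def up_dn)
  qed (use assms in simp)
qed

lemma permutes_if_inj_on:
  assumes "finite S" "inj_on f S" "f ` S \<subseteq> S" "\<And>x. x \<notin> S \<Longrightarrow> f x = x"
  shows "f permutes S"
  using assms endo_inj_surj[of S f] by (intro bij_imp_permutes) (simp_all add: bij_betw_def)

lemma insat_permutes:
  assumes "\<omega> permutes {1..n}" "1 \<le> p" "p \<le> Suc n" "1 \<le> i" "i \<le> Suc n"
  shows "insat p i \<omega> permutes {1..Suc n}"
proof (rule permutes_if_inj_on)
  have inj: "inj \<omega>" using assms(1) by (rule permutes_inj)
  show "inj_on (insat p i \<omega>) {1..Suc n}"
  proof (rule inj_onI)
    fix x y assume "insat p i \<omega> x = insat p i \<omega> y"
    then show "x = y"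
      by (cases x p rule: up_cases; cases y p rule: up_cases) (auto dest: injD[OF inj])
  qed
  have in_up: "up q z \<in> {1..Suc n} \<longleftrightarrow> z \<in> {1..n}" if "1 \<le> q" "q \<le> Suc n" for q z
    using that by (auto simp: up_def)
  show "insat p i \<omega> ` {1..Suc n} \<subseteq> {1..Suc n}"
  proof
    fix y assume "y \<in> insat p i \<omega> ` {1..Suc n}"
    then obtain x where x: "x \<in> {1..Suc n}" "y = insat p i \<omega> x" by auto
    show "y \<in> {1..Suc n}"
    proof (cases x p rule: up_cases)
      case (2 z)
      with x assms have "z \<in> {1..n}" using in_up by blast
      then have "\<omega> z \<in> {1..n}" using assms(1) by (simp only: permutes_in_image)
      then show ?thesis using x 2 in_up[of i] assms by simp
    qed (use x assms in auto)
  qed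
  fix x assume x: "x \<notin> {1..Suc n}"
  then have "x \<noteq> p" using assms by auto
  then obtain z where z: "x = up p z" by (metis up_cases)
  with x have "z \<notin> {1..n}" using in_up assms by blast
  then have "\<omega> z = z" using assms(1) by (simp add: permutes_def)
  moreover have "up i z = up p z" using x z assms by (auto simp: up_def split: if_splits)
  ultimately show "insat p i \<omega> x = x" using z by simp
qed simp

lemma delat_permutes:
  assumes "\<sigma> permutes {1..Suc n}" "1 \<le> p" "p \<le> Suc n" "\<sigma> p = i"
  shows "delat p i \<sigma> permutes {1..n}"
proof (rule permutes_if_inj_on)
  have inj: "inj \<sigma>" using assms(1) by (rule permutes_inj)
  have i: "1 \<le> i" "i \<le> Suc n"
    using assms permutes_in_image[OF assms(1), of p] by auto
  have up: "up i (delat p i \<sigma> z) = \<sigma> (up p z)" for z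
    using insat_delat[OF inj assms(4)] by (metis insat_up)
  have in_up: "up q z \<in> {1..Suc n} \<longleftrightarrow> z \<in> {1..n}" if "1 \<le> q" "q \<le> Suc n" for q z
    using that by (auto simp: up_def)
  show "inj_on (delat p i \<sigma>) {1..n}"
    by (rule inj_onI) (metis injD[OF inj] up up_eq_iff)
  show "delat p i \<sigma> ` {1..n} \<subseteq> {1..n}"
  proof
    fix y assume "y \<in> delat p i \<sigma> ` {1..n}"
    then obtain z where z: "z \<in> {1..n}" "y = delat p i \<sigma> z" by auto
    then have "\<sigma> (up p z) \<in> {1..Suc n}"
      using in_up[of p z] assms permutes_in_image[OF assms(1), of "up p z"] by blast
    then show "y \<in> {1..n}" using z in_up[of i y] i up by simp
  qed
  fix x assume x: "x \<notin> {1..n}"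
  then have "up p x \<notin> {1..Suc n}" using in_up assms by blast
  then have "\<sigma> (up p x) = up p x" using assms(1) by (simp add: permutes_def)
  moreover have "up i x = up p x" using x assms i by (auto simp: up_def)
  ultimately show "delat p i \<sigma> x = x" using up[of x] by (metis up_eq_iff)
qed simp

lemma transp_simps [simp]:
  "Defs.transp a b a = b" "Defs.transp a b b = a" "x \<noteq> a \<Longrightarrow> x \<noteq> b \<Longrightarrow> Defs.transp a b x = x"
  by (auto simp: Defs.transp_def)

lemma transp_transp [simp]: "Defs.transp a b (Defs.transp a b x) = x"
  by (auto simp: Defs.transp_def)

lemma comp_transp_transp [simp]: "\<sigma> \<circ> Defs.transp a b \<circ> Defs.transp a b = \<sigma>"
  by (simp add: fun_eq_iff)

lemma transp_permutes: "a \<in> S \<Longrightarrow> b \<in> S \<Longrightarrow> Defs.transp a b permutes S"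
  unfolding permutes_def
proof (intro conjI allI impI)
  fix y show "\<exists>!x. Defs.transp a b x = y"
    by (rule ex1I[of _ "Defs.transp a b y"]) (simp, metis transp_transp)
qed (auto simp: Defs.transp_def)

lemma comp_transp_permutes:
  "\<sigma> permutes S \<Longrightarrow> a \<in> S \<Longrightarrow> b \<in> S \<Longrightarrow> \<sigma> \<circ> Defs.transp a b permutes S"
  by (intro permutes_compose transp_permutes)

text \<open>Reduces the case where i joins a block to the insertion of a fixed point followed by a
  swap.\<close>

lemma insat_Suc: "insat (Suc i) i \<omega> = swap i (insat i i \<omega>)"
proof
  fix x
  consider "x = i" | "x = Suc i" | "x \<noteq> i" "x \<noteq> Suc i" by blast
  then show "insat (Suc i) i \<omega> x = swap i (insat i i \<omega>) x"
    by cases (auto simp: insat_def dn_def)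
qed

lemma ncpD:
  assumes "ncp n \<sigma>"
  shows ncp_permutes: "\<sigma> permutes {1..n}"
    and ncp_inj: "inj \<sigma>"
    and ncp_less: "\<sigma> a < b \<Longrightarrow> b < a \<Longrightarrow> \<sigma> a < \<sigma> b \<and> \<sigma> b < a"
    and ncp_le: "a \<le> b \<Longrightarrow> b \<le> \<sigma> a \<Longrightarrow> a \<le> \<sigma> b \<and> \<sigma> b \<le> \<sigma> a"
  using assms by (auto simp: ncp_def dest: permutes_inj)

lemma ncp_id: "ncp n id"
  by (auto simp: ncp_def permutes_id)

text \<open>If i < \<sigma> i, then i + 1 lies in the invariant interval from i to \<sigma> i, so
  \<sigma> (i + 1) is at least i and hence equal to i.\<close>

lemma ready_cases:
  assumes "ncp n \<sigma>" "ready \<sigma> i"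
  obtains (fixed) "\<sigma> i = i" "\<sigma> (Suc i) < i" | (joined) "i < \<sigma> i" "\<sigma> (Suc i) = i"
proof (cases "\<sigma> i = i")
  case True
  then have "\<sigma> (Suc i) \<noteq> i" using ncp_inj[OF assms(1)] by (metis injD n_not_Suc_n)
  then show ?thesis using True assms(2) fixed by (auto simp: ready_def)
next
  case False
  then have "i < \<sigma> i" using assms(2) by (auto simp: ready_def)
  moreover from this have "i \<le> \<sigma> (Suc i)" using ncp_le[OF assms(1), of i "Suc i"] by simp
  ultimately show ?thesis using assms(2) joined by (auto simp: ready_def)
qed

lemma ready_descent: "ncp n \<sigma> \<Longrightarrow> ready \<sigma> i \<Longrightarrow> \<sigma> (Suc i) < \<sigma> i"
  by (erule (1) ready_cases) auto

text \<open>An interval from the definition of \<open>ncp\<close> that contains exactly one of \<open>i\<close>, \<open>i + 1\<close>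
  ends between them, and then the element \<open>a\<close> defining it has to be one of these two.\<close>

lemma ncp_swap_if_ready:
  assumes nc: "ncp n \<sigma>" and i: "1 \<le> i" "Suc i \<le> n" and r: "ready \<sigma> i"
  shows "ncp n (swap i \<sigma>)"
  unfolding ncp_def
proof (intro conjI allI impI)
  let ?s = "swap i \<sigma>"
  note inj = injD[OF ncp_inj[OF nc]]
  have s: "?s i = \<sigma> (Suc i)" "?s (Suc i) = \<sigma> i" "\<And>x. x \<noteq> i \<Longrightarrow> x \<noteq> Suc i \<Longrightarrow> ?s x = \<sigma> x" by auto
  have ni: "\<sigma> a \<noteq> i" if "a \<noteq> i" "a \<noteq> Suc i" for a
    using nc r by (rule ready_cases) (use inj that in metis)+
  show "?s permutes {1..n}" using ncp_permutes[OF nc] i by (intro comp_transp_permutes) auto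
  fix a b
  {
    assume ab: "?s a < b" "b < a"
    have "?s a < ?s b \<and> ?s b < a"
    proof (cases "a = i \<or> a = Suc i")
      case True
      from nc r show ?thesis
      proof (cases rule: ready_cases)
        case fixed
        with True ab have "a = i" "\<sigma> (Suc i) < b" "b < i" by (auto simp: s)
        then show ?thesis using ncp_less[OF nc, of "Suc i" b] ni[of b] by (auto simp: s)
      qed (use True ab in \<open>auto simp: s\<close>)
    next
      case False
      then have ab': "\<sigma> a < b" "b < a" using ab by (auto simp: s)
      consider "b = i" | "b = Suc i" | "b \<noteq> i" "b \<noteq> Suc i" by blast
      then show ?thesis
        using ncp_less[OF nc, of a b] ncp_less[OF nc, of a i] ncp_less[OF nc, of a "Suc i"] ab' False ni[of a]
        by cases (auto simp: s)
    qed
    then show "?s a < ?s b" "?s b < a" by auto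
  }
  {
    assume ab: "a \<le> b" "b \<le> ?s a"
    have "a \<le> ?s b \<and> ?s b \<le> ?s a"
    proof (cases "a = i \<or> a = Suc i")
      case True
      from nc r show ?thesis
      proof (cases rule: ready_cases)
        case joined
        show ?thesis
        proof (cases "a = i")
          case True
          then show ?thesis using ab joined by (auto simp: s)
        next
          case False
          then have a: "a = Suc i" using True by simp
          then have "i \<le> \<sigma> b \<and> \<sigma> b \<le> \<sigma> i" using ncp_le[OF nc, of i b] ab by (auto simp: s)
          then show ?thesis using a joined ab ni[of b] by (cases "b = Suc i") (auto simp: s)
        qed
      qed (use True ab in \<open>auto simp: s\<close>)
    next
      case False
      then have ab': "a \<le> b" "b \<le> \<sigma> a" using ab by (auto simp: s)
      consider "b = i" | "b = Suc i" | "b \<noteq> i" "b \<noteq> Suc i" by blast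
      then show ?thesis
        using ncp_le[OF nc, of a b] ncp_le[OF nc, of a i] ncp_le[OF nc, of a "Suc i"] ab' False ni[of a]
        by cases (auto simp: s)
    qed
    then show "a \<le> ?s b" "?s b \<le> ?s a" by auto
  }
qed

text \<open>The swap merges the singleton {i} with the block whose minimum is i + 1. No block can
  separate the two neighbours, so the result is again noncrossing.\<close>

lemma ncp_swap_join:
  assumes nc: "ncp n \<sigma>" and i: "1 \<le> i" "Suc i \<le> n" and r: "\<sigma> i = i" "Suc i \<le> \<sigma> (Suc i)"
  shows "ncp n (swap i \<sigma>)"
  unfolding ncp_def
proof (intro conjI allI impI)
  let ?s = "swap i \<sigma>"
  note inj = injD[OF ncp_inj[OF nc]]
  have s: "?s i = \<sigma> (Suc i)" "?s (Suc i) = \<sigma> i" "\<And>x. x \<noteq> i \<Longrightarrow> x \<noteq> Suc i \<Longrightarrow> ?s x = \<sigma> x" by auto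
  have ni: "\<sigma> a \<noteq> i" if "a \<noteq> i" for a
    using inj that r by metis
  show "?s permutes {1..n}" using ncp_permutes[OF nc] i by (intro comp_transp_permutes) auto
  fix a b
  {
    assume ab: "?s a < b" "b < a"
    have "?s a < ?s b \<and> ?s b < a"
    proof (cases "a = i \<or> a = Suc i")
      case False
      then have ab': "\<sigma> a < b" "b < a" using ab by (auto simp: s)
      consider "b = i" | "b = Suc i" | "b \<noteq> i" "b \<noteq> Suc i" by blast
      then show ?thesis
        using ncp_less[OF nc, of a b] ncp_less[OF nc, of a i] ncp_less[OF nc, of a "Suc i"] ab' False ni[of a]
        by cases (auto simp: s)
    qed (use ab r in \<open>auto simp: s\<close>)
    then show "?s a < ?s b" "?s b < a" by auto
  }
  {
    assume ab: "a \<le> b" "b \<le> ?s a"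
    have "a \<le> ?s b \<and> ?s b \<le> ?s a"
    proof (cases "a = i \<or> a = Suc i")
      case True
      then have a: "a = i" using ab r by (auto simp: s)
      then show ?thesis using ncp_le[OF nc, of "Suc i" b] ab r
        by (cases "b = i"; cases "b = Suc i") (auto simp: s)
    next
      case False
      then have ab': "a \<le> b" "b \<le> \<sigma> a" using ab by (auto simp: s)
      consider "b = i" | "b = Suc i" | "b \<noteq> i" "b \<noteq> Suc i" by blast
      then show ?thesis
        using ncp_le[OF nc, of a b] ncp_le[OF nc, of a i] ncp_le[OF nc, of a "Suc i"] ab' False ni[of a]
        by cases (auto simp: s)
    qed
    then show "a \<le> ?s b" "?s b \<le> ?s a" by auto
  }
qed

lemma ncp_insat:
  assumes nc: "ncp n \<omega>" and i: "1 \<le> i" "i \<le> Suc n"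
  shows "ncp (Suc n) (insat i i \<omega>)"
  unfolding ncp_def
proof (intro conjI allI impI)
  let ?s = "insat i i \<omega>"
  show "?s permutes {1..Suc n}" using ncp_permutes[OF nc] i by (intro insat_permutes) auto
  fix a b
  {
    assume ab: "?s a < b" "b < a"
    have "?s a < ?s b \<and> ?s b < a"
    proof (cases a i rule: up_cases)
      case (2 a')
      then show ?thesis using ab ncp_less[OF nc, of a'] by (cases b i rule: up_cases) auto
    qed (use ab in auto)
    then show "?s a < ?s b" "?s b < a" by auto
  }
  {
    assume ab: "a \<le> b" "b \<le> ?s a"
    have "a \<le> ?s b \<and> ?s b \<le> ?s a"
    proof (cases a i rule: up_cases)
      case (2 a')
      then show ?thesis using ab ncp_le[OF nc, of a'] by (cases b i rule: up_cases) auto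
    qed (use ab in auto)
    then show "a \<le> ?s b" "?s b \<le> ?s a" by auto
  }
qed

lemma ncp_delat:
  assumes nc: "ncp (Suc n) \<sigma>" and i: "1 \<le> i" "i \<le> Suc n" "\<sigma> i = i"
  shows "ncp n (delat i i \<sigma>)"
  unfolding ncp_def
proof (intro conjI allI impI)
  let ?w = "delat i i \<sigma>"
  have s: "\<sigma> (up i x) = up i (?w x)" for x
    using insat_delat[OF ncp_inj[OF nc] i(3)] by (metis insat_up)
  show "?w permutes {1..n}" using ncp_permutes[OF nc] i by (intro delat_permutes) auto
  fix a b
  show "?w a < ?w b" "?w b < a" if "?w a < b" "b < a"
    using ncp_less[OF nc, of "up i a" "up i b"] that by (auto simp: s)
  show "a \<le> ?w b" "?w b \<le> ?w a" if "a \<le> b" "b \<le> ?w a"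
    using ncp_le[OF nc, of "up i a" "up i b"] that by (auto simp: s)
qed

lemma ncp_ins:
  assumes "ncp n \<omega>" "1 \<le> i" "i \<le> n"
  shows "ncp (Suc n) (ins i \<omega>)"
proof (cases "\<omega> i < i")
  case True
  then show ?thesis using ncp_insat[OF assms(1), of i] assms by (simp add: ins_def)
next
  case False
  have *: "insat i i \<omega> (Suc i) = Suc (\<omega> i)"
    using insat_up[of i i \<omega> i] False by (simp add: up_def)
  have "ncp (Suc n) (swap i (insat i i \<omega>))"
    by (rule ncp_swap_join[OF ncp_insat[OF assms(1)]]) (use False assms * in auto)
  with False show ?thesis by (simp add: ins_def insat_Suc)
qed

lemma ready_ins: "ready (ins i \<omega>) i"
proof (cases "\<omega> i < i")
  case True
  then show ?thesis using insat_up[of i i \<omega> i] by (simp add: ins_def ready_def up_def)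
next
  case False
  then show ?thesis using insat_up[of "Suc i" i \<omega> i] by (simp add: ins_def ready_def up_def)
qed

lemma ready_del:
  assumes nc: "ncp n \<sigma>" and r: "ready \<sigma> i"
  shows ins_del: "ins i (del i \<sigma>) = \<sigma>"
    and del_less_iff: "del i \<sigma> i < i \<longleftrightarrow> \<sigma> i = i"
proof -
  have "ins i (del i \<sigma>) = \<sigma> \<and> (del i \<sigma> i < i \<longleftrightarrow> \<sigma> i = i)"
    using nc r
  proof (cases rule: ready_cases)
    case fixed
    then have "del i \<sigma> i < i" by (auto simp: del_def delat_def up_def dn_def)
    then show ?thesis using fixed insat_delat[OF ncp_inj[OF nc], of i i] by (simp add: ins_def del_def)
  next
    case joined
    then have "\<not> del i \<sigma> i < i" by (auto simp: del_def delat_def up_def dn_def)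
    then show ?thesis using joined insat_delat[OF ncp_inj[OF nc], of "Suc i" i] by (simp add: ins_def del_def)
  qed
  then show "ins i (del i \<sigma>) = \<sigma>" "del i \<sigma> i < i \<longleftrightarrow> \<sigma> i = i" by auto
qed

lemma ncp_del:
  assumes nc: "ncp n \<sigma>" and i: "1 \<le> i" "Suc i \<le> n" and r: "ready \<sigma> i"
  shows "ncp (n - 1) (del i \<sigma>)"
proof -
  obtain m where m: "n = Suc m" "i \<le> m" using i by (cases n) auto
  from nc r show ?thesis
  proof (cases rule: ready_cases)
    case fixed
    then show ?thesis using ncp_delat[of m \<sigma> i] nc i m by (simp add: del_def)
  next
    case joined
    have "ncp m (delat i i (swap i \<sigma>))"
      using ncp_delat[of m "swap i \<sigma>" i] ncp_swap_if_ready[OF nc i r] m i joined by simp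
    moreover have "delat i i (swap i \<sigma>) = delat (Suc i) i \<sigma>"
    proof
      fix x
      consider "x < i" | "x = i" | "i < x" by linarith
      then show "delat i i (swap i \<sigma>) x = delat (Suc i) i \<sigma> x"
        by cases (auto simp: delat_def up_def)
    qed
    ultimately show ?thesis using joined m by (simp add: del_def)
  qed
qed

text \<open>A permutation that moves nothing down is the identity. Otherwise take the least y with
  \<sigma> y < y; then y - 1 is not moved down, and i = y - 1 is ready.\<close>

lemma ready_exists:
  assumes nc: "ncp n \<sigma>" and "\<sigma> \<noteq> id"
  shows "\<exists>i\<ge>1. Suc i \<le> n \<and> ready \<sigma> i"
proof -
  have "\<exists>y. \<sigma> y < y"
  proof (rule ccontr)
    assume "\<nexists>y. \<sigma> y < y"
    then have ge: "y \<le> \<sigma> y" for y by (meson not_less)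
    have "\<sigma> y = y" for y
    proof (induction y rule: less_induct)
      case (less y)
      obtain x where x: "\<sigma> x = y" using permutes_surj[OF ncp_permutes[OF nc]] by (metis surjD)
      then show ?case using ge[of x] less[of x] by (cases "x = y") auto
    qed
    with assms(2) show False by auto
  qed
  then have y: "\<sigma> (LEAST y. \<sigma> y < y) < (LEAST y. \<sigma> y < y)" by (rule LeastI_ex)
  define y where "y = (LEAST y. \<sigma> y < y)"
  have "y \<in> {1..n}"
    using y ncp_permutes[OF nc] unfolding y_def[symmetric] by (metis less_irrefl permutes_not_in)
  moreover have "\<sigma> y \<noteq> 0"
    using permutes_in_image[OF ncp_permutes[OF nc], of y] \<open>y \<in> {1..n}\<close> by auto
  ultimately obtain i where i: "y = Suc i" "1 \<le> i" "Suc i \<le> n"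
    using y unfolding y_def[symmetric] by (cases y) (auto simp: less_Suc_eq_le Suc_le_eq)
  have "\<not> \<sigma> i < i" by (rule not_less_Least) (use i y_def in auto)
  then have "ready \<sigma> i" using y i unfolding y_def[symmetric] by (simp add: ready_def)
  with i show ?thesis by blast
qed

section \<open>Bruhat order on noncrossing permutations\<close>

lemma ninv_less_transp:
  assumes "inj u" "1 \<le> a" "a < b" "b \<le> n" "u a < u b"
  shows "ninv n u < ninv n (u \<circ> Defs.transp a b)"
proof -
  let ?t = "Defs.transp a b"
  let ?w = "u \<circ> ?t"
  let ?I = "\<lambda>v. {(i, j). 1 \<le> i \<and> i < j \<and> j \<le> n \<and> v j < (v i :: nat)}"
  \<comment> \<open>Injects the inversions of \<open>u\<close> into those of \<open>?w\<close> other
    than (a, b): carry both positions along with the transposition, or keep the pair if that would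
    reverse its order.\<close>
  define \<phi> where "\<phi> x = (case x of (i, j) \<Rightarrow> if ?t i < ?t j then (?t i, ?t j) else (i, j))" for x
  have fin: "finite (?I v)" for v
    by (rule finite_subset[of _ "{..n} \<times> {..n}"]) auto
  have range: "1 \<le> ?t i \<and> ?t i \<le> n" if "1 \<le> i" "i \<le> n" for i
    using that assms by (auto simp: Defs.transp_def)
  have maps: "\<phi> x \<in> ?I ?w - {(a, b)}" if "x \<in> ?I u" for x
  proof -
    obtain i j where x: "x = (i, j)" by fastforce
    with that have ij: "1 \<le> i" "i < j" "j \<le> n" "u j < u i" by auto
    show ?thesis
    proof (cases "?t i < ?t j")
      case True
      moreover have "(?t i, ?t j) \<noteq> (a, b)"
      proof
        assume "(?t i, ?t j) = (a, b)"
        then have "?t (?t i) = ?t a" "?t (?t j) = ?t b" by simp_all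
        then have "i = b" "j = a" by simp_all
        with ij assms show False by simp
      qed
      ultimately show ?thesis using ij range[of i] range[of j] by (simp add: x \<phi>_def)
    next
      case False
      have "(i, j) \<noteq> (a, b)" using ij assms by auto
      moreover have "?t i \<noteq> ?t j" using ij transp_transp by (metis less_irrefl)
      ultimately have "i = a \<and> j \<noteq> b \<and> j \<noteq> a \<or> j = b \<and> i \<noteq> a \<and> i \<noteq> b"
        using False ij assms by (auto simp: Defs.transp_def split: if_splits)
      then show ?thesis using False ij assms \<open>(i, j) \<noteq> (a, b)\<close> by (auto simp: x \<phi>_def)
    qed
  qed
  have "inj_on \<phi> (?I u)"
  proof (rule inj_onI)
    fix x y assume xy: "x \<in> ?I u" "y \<in> ?I u" "\<phi> x = \<phi> y"
    obtain i j i' j' where [simp]: "x = (i, j)" "y = (i', j')" by fastforce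
    have "i < j" "i' < j'" using xy by auto
    then show "x = y" using xy(3)
      by (auto simp: \<phi>_def split: if_splits) (metis transp_transp)+
  qed
  then have "card (?I u) = card (\<phi> ` ?I u)" by (simp add: card_image)
  also have "\<dots> \<le> card (?I ?w - {(a, b)})" by (intro card_mono finite_Diff fin image_subsetI maps)
  also have "\<dots> < card (?I ?w)"
  proof -
    have "(a, b) \<in> ?I ?w" using assms by simp
    then show ?thesis using fin by (meson card_Diff1_less)
  qed
  finally show ?thesis by (simp only: ninv_def)
qed

text \<open>The condition on inversion numbers becomes a comparison of two values: if u a > u b,
  transposing back would increase the number of inversions.\<close>

lemma bruhat_step_iff:
  assumes "inj u"
  shows "bruhat_step n u w \<longleftrightarrow> (\<exists>a b. 1 \<le> a \<and> a < b \<and> b \<le> n \<and> w = u \<circ> Defs.transp a b \<and> u a < u b)"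
proof -
  have "u a < u b" if ab: "1 \<le> a" "a < b" "b \<le> n" "ninv n u < ninv n (u \<circ> Defs.transp a b)" for a b
  proof (rule ccontr)
    assume "\<not> u a < u b"
    moreover have "u a \<noteq> u b" using assms ab by (auto dest: injD)
    ultimately have "(u \<circ> Defs.transp a b) a < (u \<circ> Defs.transp a b) b" by simp
    moreover have "inj (u \<circ> Defs.transp a b)"
      using assms by (metis inj_compose injI transp_transp)
    ultimately have "ninv n (u \<circ> Defs.transp a b) < ninv n (u \<circ> Defs.transp a b \<circ> Defs.transp a b)"
      using ab by (intro ninv_less_transp)
    with ab show False by simp
  qed
  then show ?thesis
    unfolding bruhat_step_def using ninv_less_transp[OF assms] by blast
qed

lemma bruhat_step_permutes:
  "u permutes {1..n} \<Longrightarrow> bruhat_step n u w \<Longrightarrow> w permutes {1..n}"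
  unfolding bruhat_step_def by (auto intro!: comp_transp_permutes)

lemma bruhat_le_refl: "u permutes {1..n} \<Longrightarrow> bruhat_le n u u"
  by (simp add: bruhat_le_def)

lemma bruhat_le_step:
  "bruhat_le n u v \<Longrightarrow> bruhat_step n v w \<Longrightarrow> bruhat_le n u w"
  unfolding bruhat_le_def using bruhat_step_permutes by (meson rtranclp.rtrancl_into_rtrancl)

lemma bruhat_le_induct [consumes 1, case_names refl step]:
  assumes "bruhat_le n u w"
    and "P u"
    and "\<And>v a b. bruhat_le n u v \<Longrightarrow> P v \<Longrightarrow> 1 \<le> a \<Longrightarrow> a < b \<Longrightarrow> b \<le> n \<Longrightarrow> v a < v b \<Longrightarrow> P (v \<circ> Defs.transp a b)"
  shows "P w"
proof -
  have u: "u permutes {1..n}" and "(bruhat_step n)\<^sup>*\<^sup>* u w" using assms(1) by (auto simp: bruhat_le_def)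
  from this(2) have "bruhat_le n u w \<and> P w"
  proof induction
    case base
    then show ?case using assms(2) u by (simp add: bruhat_le_refl)
  next
    case (step v w)
    then have "inj v" by (auto simp: bruhat_le_def dest: permutes_inj)
    with step.hyps(2) obtain a b where ab: "1 \<le> a" "a < b" "b \<le> n" "w = v \<circ> Defs.transp a b" "v a < v b"
      by (auto simp: bruhat_step_iff)
    have "bruhat_le n u w" using step bruhat_le_step by blast
    moreover have "P w" unfolding ab(4) using step.IH ab by (intro assms(3)) auto
    ultimately show ?case ..
  qed
  then show ?thesis ..
qed

lemma bruhat_le_insat:
  assumes "bruhat_le n u w" "1 \<le> p" "p \<le> Suc n" "1 \<le> i" "i \<le> Suc n"
  shows "bruhat_le (Suc n) (insat p i u) (insat p i w)"
  using assms(1)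
proof (induction rule: bruhat_le_induct)
  case refl
  then show ?case using assms by (intro bruhat_le_refl insat_permutes) (auto simp: bruhat_le_def)
next
  case (step v a b)
  have v: "v permutes {1..n}" using step(1) by (simp add: bruhat_le_def)
  have eq: "insat p i (v \<circ> Defs.transp a b) = insat p i v \<circ> Defs.transp (up p a) (up p b)"
  proof
    fix x
    show "insat p i (v \<circ> Defs.transp a b) x = (insat p i v \<circ> Defs.transp (up p a) (up p b)) x"
    proof (cases x p rule: up_cases)
      case 1
      then show ?thesis by (simp add: Defs.transp_def)
    next
      case (2 y)
      then have "Defs.transp (up p a) (up p b) x = up p (Defs.transp a b y)" by (auto simp: Defs.transp_def)
      then show ?thesis using 2 by simp
    qed
  qed
  have "inj (insat p i v)" by (rule permutes_inj[OF insat_permutes[OF v assms(2-5)]])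
  moreover have "1 \<le> up p a" "up p b \<le> Suc n" using step.hyps(2-4) by (auto simp: up_def)
  ultimately have "bruhat_step (Suc n) (insat p i v) (insat p i (v \<circ> Defs.transp a b))"
    unfolding bruhat_step_iff[OF \<open>inj (insat p i v)\<close>] eq using step.hyps(2-5)
    by (intro exI[of _ "up p a"] exI[of _ "up p b"]) simp
  then show ?case using step.IH by (rule bruhat_le_step[rotated])
qed

section \<open>Counts of excedances of prefixes\<close>

definition exc :: "(nat \<Rightarrow> nat) \<Rightarrow> nat \<Rightarrow> nat" where
  "exc u k = card {x \<in> {1..k}. k < u x}"

definition wexc :: "(nat \<Rightarrow> nat) \<Rightarrow> nat \<Rightarrow> nat" where
  "wexc u k = card {x \<in> {1..k}. k \<le> u x}"

text \<open>The Bruhat order on all permutations compares the numbers of x up to p with value at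
  least q, for all p and q. Only q = p + 1 (\<open>exc\<close>) and q = p (\<open>wexc\<close>) are
  kept here. In general this is just a necessary condition (compare 312 with 231), but between
  noncrossing permutations it is sufficient.\<close>

definition exc_le :: "(nat \<Rightarrow> nat) \<Rightarrow> (nat \<Rightarrow> nat) \<Rightarrow> bool" where
  "exc_le u w \<longleftrightarrow> (\<forall>k. exc u k \<le> exc w k \<and> wexc u k \<le> wexc w k)"

lemma card_prefix_transp:
  assumes "1 \<le> a" "a < b" "k < a \<or> b \<le> k"
  shows "card {x \<in> {1..k}. Q ((u \<circ> Defs.transp a b) x)} = card {x \<in> {1..k}. Q (u x)}"
proof -
  have "{x \<in> {1..k}. Q (u x)} = Defs.transp a b ` {x \<in> {1..k}. Q ((u \<circ> Defs.transp a b) x)}" (is "?L = ?R")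
  proof
    show "?L \<subseteq> ?R"
    proof
      fix x assume x: "x \<in> ?L"
      then have "Defs.transp a b x \<in> {1..k}" using assms by (auto simp: Defs.transp_def)
      with x have "Defs.transp a b x \<in> {x \<in> {1..k}. Q ((u \<circ> Defs.transp a b) x)}" by simp
      then have "Defs.transp a b (Defs.transp a b x) \<in> ?R" by (rule imageI)
      then show "x \<in> ?R" by simp
    qed
    show "?R \<subseteq> ?L" using assms by (auto simp: Defs.transp_def)
  qed
  moreover have "inj_on (Defs.transp a b) S" for S by (metis inj_onI transp_transp)
  ultimately show ?thesis by (simp add: card_image)
qed

text \<open>The count changes only if the prefix contains a but not b, and then the value at a rises
  from u a to u b.\<close>

lemma card_prefix_mono:
  fixes u :: "nat \<Rightarrow> nat"
  assumes "1 \<le> a" "a < b" "u a < u b" and mono: "\<And>x y. Q x \<Longrightarrow> x \<le> y \<Longrightarrow> Q y"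
  shows "card {x \<in> {1..k}. Q (u x)} \<le> card {x \<in> {1..k}. Q ((u \<circ> Defs.transp a b) x)}"
proof (cases "k < a \<or> b \<le> k")
  case False
  have "Q ((u \<circ> Defs.transp a b) x)" if "x \<in> {1..k}" "Q (u x)" for x
    using that False mono[OF _ less_imp_le[OF assms(3)]] by (cases "x = a") auto
  then show ?thesis by (intro card_mono) auto
next
  case True
  then show ?thesis using card_prefix_transp[OF assms(1,2), of k Q u] by (simp only: order.refl)
qed

lemma exc_le_if_bruhat_le:
  assumes "bruhat_le n u w"
  shows "exc_le u w"
  using assms
proof (induction rule: bruhat_le_induct)
  case (step v a b)
  have "exc v k \<le> exc (v \<circ> Defs.transp a b) k" for k
    unfolding exc_def using step.hyps(2-5) by (intro card_prefix_mono) auto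
  moreover have "wexc v k \<le> wexc (v \<circ> Defs.transp a b) k" for k
    unfolding wexc_def using step.hyps(2-5) by (intro card_prefix_mono) auto
  ultimately show ?case using step.IH unfolding exc_le_def by (meson order.trans)
qed (simp add: exc_le_def)

lemma wexc_Suc: "wexc u (Suc k) = exc u k + (if Suc k \<le> u (Suc k) then 1 else 0)"
proof -
  have "{x \<in> {1..Suc k}. Suc k \<le> u x}
      = (if Suc k \<le> u (Suc k) then insert (Suc k) {x \<in> {1..k}. k < u x} else {x \<in> {1..k}. k < u x})"
    by (auto simp: le_Suc_eq)
  then show ?thesis by (simp add: wexc_def exc_def)
qed

lemma wexc_eq_exc:
  assumes "inj u"
  shows "wexc u k = exc u k + (if \<exists>x\<in>{1..k}. u x = k then 1 else 0)"
proof (cases "\<exists>x\<in>{1..k}. u x = k")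
  case True
  then obtain x where x: "x \<in> {1..k}" "u x = k" by blast
  have "y \<in> {y \<in> {1..k}. k \<le> u y} \<longleftrightarrow> y \<in> insert x {y \<in> {1..k}. k < u y}" for y
    using x injD[OF assms, of y x] by (cases "u y = k") auto
  then have "{y \<in> {1..k}. k \<le> u y} = insert x {y \<in> {1..k}. k < u y}" by blast
  then show ?thesis using True x by (simp add: wexc_def exc_def)
next
  case False
  then have "{y \<in> {1..k}. k \<le> u y} = {y \<in> {1..k}. k < u y}"
    by (intro Collect_cong) (metis le_less)
  then show ?thesis using False by (simp add: wexc_def exc_def)
qed

lemma exc_swap:
  assumes "1 \<le> i" "k \<noteq> i"
  shows "exc (swap i u) k = exc u k" "wexc (swap i u) k = wexc u k"
proof -
  have "k < i \<or> Suc i \<le> k" using assms by linarith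
  from card_prefix_transp[OF assms(1) lessI this]
  show "exc (swap i u) k = exc u k" "wexc (swap i u) k = wexc u k"
    unfolding exc_def wexc_def by blast+
qed

lemma exc_swap_ready:
  assumes "1 \<le> i" "ready \<sigma> i"
  shows "wexc \<sigma> i = exc \<sigma> (i - 1) + 1" "wexc \<sigma> (Suc i) = exc \<sigma> i"
    and "wexc (swap i \<sigma>) i = exc \<sigma> (i - 1) + (if i \<le> \<sigma> (Suc i) then 1 else 0)"
    and "exc \<sigma> i = exc (swap i \<sigma>) i + (if i < \<sigma> i then 1 else 0)"
proof -
  obtain j where j: "i = Suc j" using assms by (cases i) auto
  show "wexc \<sigma> i = exc \<sigma> (i - 1) + 1" "wexc \<sigma> (Suc i) = exc \<sigma> i"
    using assms wexc_Suc[of \<sigma> j] wexc_Suc[of \<sigma> i] by (auto simp: j ready_def)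
  then show "wexc (swap i \<sigma>) i = exc \<sigma> (i - 1) + (if i \<le> \<sigma> (Suc i) then 1 else 0)"
    using wexc_Suc[of "swap i \<sigma>" j] exc_swap(1)[of i j \<sigma>] assms by (simp add: j)
  show "exc \<sigma> i = exc (swap i \<sigma>) i + (if i < \<sigma> i then 1 else 0)"
    using wexc_Suc[of "swap i \<sigma>" i] exc_swap(2)[of i "Suc i" \<sigma>] assms \<open>wexc \<sigma> (Suc i) = exc \<sigma> i\<close>
    by simp
qed

lemma exc_insat:
  assumes "1 \<le> i"
  shows "k < i \<Longrightarrow> exc (insat i i \<omega>) k = exc \<omega> k" "k < i \<Longrightarrow> wexc (insat i i \<omega>) k = wexc \<omega> k"
    and "i \<le> k \<Longrightarrow> exc (insat i i \<omega>) (Suc k) = exc \<omega> k" "i \<le> k \<Longrightarrow> wexc (insat i i \<omega>) (Suc k) = wexc \<omega> k"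
proof -
  let ?s = "insat i i \<omega>"
  have low: "?s x = up i (\<omega> x)" if "x < i" for x
    using insat_up[of i i \<omega> x] that by (simp add: up_def)
  have "{x \<in> {1..k}. k < ?s x} = {x \<in> {1..k}. k < \<omega> x}" "{x \<in> {1..k}. k \<le> ?s x} = {x \<in> {1..k}. k \<le> \<omega> x}"
    if "k < i" using that low by (auto simp: up_def split: if_splits)
  then show "exc ?s k = exc \<omega> k" "wexc ?s k = wexc \<omega> k" if "k < i"
    using that by (auto simp: exc_def wexc_def)
  have img: "{x \<in> {1..Suc k}. Q (?s x)} = up i ` {x \<in> {1..k}. Q' (\<omega> x)}"
    if "i \<le> k" "\<And>y. Q (up i y) \<longleftrightarrow> Q' y" "\<not> Q i" for Q Q'
  proof -
    have *: "up i y \<in> {1..Suc k} \<longleftrightarrow> y \<in> {1..k}" for y using that assms by (auto simp: up_def)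
    have "x \<in> {x \<in> {1..Suc k}. Q (?s x)} \<longleftrightarrow> x \<in> up i ` {x \<in> {1..k}. Q' (\<omega> x)}" for x
      by (cases x i rule: up_cases) (use that * in \<open>auto simp: image_iff\<close>)
    then show ?thesis by blast
  qed
  have inj: "inj_on (up i) S" for S by (simp add: inj_on_def)
  show "exc ?s (Suc k) = exc \<omega> k" if "i \<le> k"
  proof -
    have "{x \<in> {1..Suc k}. Suc k < ?s x} = up i ` {x \<in> {1..k}. k < \<omega> x}"
      by (rule img) (use that in \<open>auto simp: up_def\<close>)
    then show ?thesis by (simp only: exc_def card_image[OF inj])
  qed
  show "wexc ?s (Suc k) = wexc \<omega> k" if "i \<le> k"
  proof -
    have "{x \<in> {1..Suc k}. Suc k \<le> ?s x} = up i ` {x \<in> {1..k}. k \<le> \<omega> x}"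
      by (rule img) (use that in \<open>auto simp: up_def\<close>)
    then show ?thesis by (simp only: wexc_def card_image[OF inj])
  qed
qed

text \<open>In the path with heights 2 * \<open>wexc\<close> - 1 and 2 * \<open>exc\<close>, a peak
  is inserted at the step between the heights of \<open>exc \<omega> (i - 1)\<close> and
  \<open>wexc \<omega> i\<close>: in front of a down step, behind an up step.\<close>

lemma exc_ins:
  assumes "1 \<le> i"
  shows "k < i \<Longrightarrow> exc (ins i \<omega>) k = exc \<omega> k" "k < i \<Longrightarrow> wexc (ins i \<omega>) k = wexc \<omega> k"
    and "i \<le> k \<Longrightarrow> exc (ins i \<omega>) (Suc k) = exc \<omega> k" "i \<le> k \<Longrightarrow> wexc (ins i \<omega>) (Suc k) = wexc \<omega> k"
    and "exc (ins i \<omega>) i = wexc \<omega> i" "wexc (ins i \<omega>) i = exc \<omega> (i - 1) + 1"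
proof -
  have *: "exc (ins i \<omega>) k = exc (insat i i \<omega>) k" "wexc (ins i \<omega>) k = wexc (insat i i \<omega>) k" if "k \<noteq> i" for k
    using that exc_swap[OF assms, of k "insat i i \<omega>"] by (auto simp: ins_def insat_Suc)
  show "k < i \<Longrightarrow> exc (ins i \<omega>) k = exc \<omega> k" "k < i \<Longrightarrow> wexc (ins i \<omega>) k = wexc \<omega> k"
    "i \<le> k \<Longrightarrow> exc (ins i \<omega>) (Suc k) = exc \<omega> k" "i \<le> k \<Longrightarrow> wexc (ins i \<omega>) (Suc k) = wexc \<omega> k" for k
    using exc_insat[OF assms, of k \<omega>] *[of k] *[of "Suc k"] by auto
  then show "exc (ins i \<omega>) i = wexc \<omega> i" "wexc (ins i \<omega>) i = exc \<omega> (i - 1) + 1"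
    using exc_swap_ready(1,2)[OF assms ready_ins[of i \<omega>]] assms by auto
qed

text \<open>All counts of the smaller permutation reappear in the larger one, and the two additional
  counts are monotone in them.\<close>

lemma exc_le_ins_iff:
  assumes "1 \<le> i"
  shows "exc_le (ins i u) (ins i w) \<longleftrightarrow> exc_le u w"
proof
  assume le: "exc_le u w"
  have "exc (ins i u) k \<le> exc (ins i w) k \<and> wexc (ins i u) k \<le> wexc (ins i w) k" for k
  proof -
    consider "k < i" | "k = i" | l where "k = Suc l" "i \<le> l" by (cases k) (auto simp: less_Suc_eq_le, linarith)
    then show ?thesis
      by cases (use le in \<open>auto simp: exc_ins[OF assms] exc_le_def\<close>)
  qed
  then show "exc_le (ins i u) (ins i w)" by (simp add: exc_le_def)
next
  assume le: "exc_le (ins i u) (ins i w)"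
  have "exc u k \<le> exc w k \<and> wexc u k \<le> wexc w k" for k
  proof (cases "k < i")
    case True
    then show ?thesis using le[unfolded exc_le_def, rule_format, of k] by (simp add: exc_ins[OF assms])
  next
    case False
    then show ?thesis using le[unfolded exc_le_def, rule_format, of "Suc k"] by (simp add: exc_ins[OF assms])
  qed
  then show "exc_le u w" by (simp add: exc_le_def)
qed

lemma exc_le_swap:
  assumes "1 \<le> i" "ready \<sigma> i" "exc_le \<tau> (swap i \<sigma>)"
  shows "exc_le \<tau> \<sigma>"
proof -
  have "exc (swap i \<sigma>) k \<le> exc \<sigma> k \<and> wexc (swap i \<sigma>) k \<le> wexc \<sigma> k" for k
    using exc_swap[OF assms(1), of k \<sigma>] exc_swap_ready[OF assms(1,2)] by (cases "k = i") auto
  then show ?thesis using assms(3) unfolding exc_le_def by (meson order.trans)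
qed

text \<open>The numbers \<open>2 * wexc - 1\<close> and \<open>2 * exc\<close>, interleaved, are the heights of a Dyck path,
  and passing from \<open>\<sigma>\<close> to \<open>swap i \<sigma>\<close> flattens a peak of it. A lower path that does not stay
  below the flattened one shares the peak together with its two neighbours.\<close>

lemma exc_le_not_swap:
  assumes i: "1 \<le> i" and nc: "ncp n \<sigma>" "ncp m \<tau>" and r: "ready \<sigma> i"
    and le: "exc_le \<tau> \<sigma>" and nle: "\<not> exc_le \<tau> (swap i \<sigma>)"
  shows "ready \<tau> i" "\<tau> i = i \<longleftrightarrow> \<sigma> i = i"
proof -
  obtain j where j: "i = Suc j" using i by (cases i) auto
  note ex = exc_swap_ready[OF i r]
  have L: "exc \<tau> k \<le> exc \<sigma> k" "wexc \<tau> k \<le> wexc \<sigma> k" for k using le by (auto simp: exc_le_def)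
  have nle': "\<not> (exc \<tau> i \<le> exc (swap i \<sigma>) i \<and> wexc \<tau> i \<le> wexc (swap i \<sigma>) i)"
    using nle L exc_swap[OF i] unfolding exc_le_def by metis
  note W\<tau> = wexc_Suc[of \<tau> j] wexc_Suc[of \<tau> i] wexc_eq_exc[OF ncp_inj[OF nc(2)], of i]
  note W\<sigma> = wexc_eq_exc[OF ncp_inj[OF nc(1)], of i]
  have "ready \<tau> i \<and> (\<tau> i = i \<longleftrightarrow> \<sigma> i = i)"
    using nc(1) r
  proof (cases rule: ready_cases)
    case fixed
    then have eq: "wexc \<tau> i = wexc \<sigma> i" "wexc \<sigma> i = exc \<sigma> i + 1"
      using ex L[of i] nle' W\<sigma> i by (auto split: if_splits)
    then have "i \<le> \<tau> i" using W\<tau>(1) ex(1) L(1)[of j] by (auto simp: j split: if_splits)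
    moreover have x: "exc \<tau> i = exc \<sigma> i" "\<exists>x\<in>{1..i}. \<tau> x = i"
      using W\<tau>(3) eq L(1)[of i] by (auto split: if_splits)
    moreover from this(1) have "\<tau> (Suc i) \<le> i" using W\<tau>(2) ex(2) L(2)[of "Suc i"] by (auto split: if_splits)
    ultimately have "ready \<tau> i" by (simp add: ready_def)
    moreover from nc(2) this have "\<tau> i = i"
    proof (cases rule: ready_cases)
      case joined
      then show ?thesis using x(2) injD[OF ncp_inj[OF nc(2)], of _ "Suc i"] by force
    qed
    ultimately show ?thesis using fixed by simp
  next
    case joined
    have "\<not> (\<exists>x\<in>{1..i}. \<sigma> x = i)"
      using joined injD[OF ncp_inj[OF nc(1)], of _ "Suc i"] by force
    then have eq: "exc \<tau> i = exc \<sigma> i" "wexc \<sigma> i = exc \<sigma> i"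
      using ex L[of i] nle' W\<sigma> joined by (auto split: if_splits)
    then have x: "wexc \<tau> i = wexc \<sigma> i" "\<not> (\<exists>x\<in>{1..i}. \<tau> x = i)"
      using W\<tau>(3) L(2)[of i] by (auto split: if_splits)
    have "i \<le> \<tau> i" using x(1) W\<tau>(1) ex(1) L(1)[of j] by (auto simp: j split: if_splits)
    moreover have "\<tau> (Suc i) \<le> i" using eq W\<tau>(2) ex(2) L(2)[of "Suc i"] by (auto split: if_splits)
    moreover have "\<tau> i \<noteq> i" using x(2) i by auto
    ultimately show ?thesis using joined by (simp add: ready_def)
  qed
  then show "ready \<tau> i" "\<tau> i = i \<longleftrightarrow> \<sigma> i = i" by auto
qed

text \<open>A nested induction: \<open>swap i \<sigma>\<close> keeps n and has fewer inversions,
  while \<open>del i \<sigma>\<close> lowers n. These are the two permutations that occur in the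
  recursion for evaluations.\<close>

lemma ncp_induct [consumes 1, case_names id step]:
  assumes "ncp n \<sigma>"
    and "\<And>n. P n id"
    and "\<And>n \<sigma> i. ncp n \<sigma> \<Longrightarrow> 1 \<le> i \<Longrightarrow> Suc i \<le> n \<Longrightarrow> ready \<sigma> i \<Longrightarrow>
      P n (swap i \<sigma>) \<Longrightarrow> P (n - 1) (del i \<sigma>) \<Longrightarrow> P n \<sigma>"
  shows "P n \<sigma>"
  using assms(1)
proof (induction n arbitrary: \<sigma> rule: less_induct)
  case n: (less n)
  from n.prems show ?case
  proof (induction "ninv n \<sigma>" arbitrary: \<sigma> rule: less_induct)
    case less
    show ?case
    proof (cases "\<sigma> = id")
      case False
      then obtain i where i: "1 \<le> i" "Suc i \<le> n" "ready \<sigma> i" using ready_exists[OF less.prems] by blast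
      have nc: "ncp n (swap i \<sigma>)" by (rule ncp_swap_if_ready[OF less.prems i])
      have "swap i \<sigma> i < swap i \<sigma> (Suc i)" using ready_descent[OF less.prems i(3)] by simp
      then have "ninv n (swap i \<sigma>) < ninv n (swap i (swap i \<sigma>))"
        using i by (intro ninv_less_transp[OF ncp_inj[OF nc]]) auto
      then have "P n (swap i \<sigma>)" using less.hyps nc by simp
      moreover have "P (n - 1) (del i \<sigma>)"
        by (rule n.IH) (use i ncp_del[OF less.prems i] in auto)
      ultimately show ?thesis using assms(3) less.prems i by blast
    qed (simp add: assms(2))
  qed
qed

text \<open>The hypothesis leaves \<tau> without excedances. Such a permutation maps each prefix to
  itself, which no ready index allows.\<close>

lemma exc_le_id:
  assumes "ncp n \<tau>" "exc_le \<tau> id"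
  shows "\<tau> = id"
proof (rule ccontr)
  assume "\<tau> \<noteq> id"
  then obtain i where i: "1 \<le> i" "ready \<tau> i" using ready_exists[OF assms(1)] by blast
  have z: "exc id k = 0" for k by (auto simp: exc_def)
  then have "exc \<tau> k = 0" for k using assms(2) by (simp add: exc_le_def)
  then have no: "\<not> k < \<tau> x" if "1 \<le> x" "x \<le> k" for x k using that by (auto simp: exc_def)
  from assms(1) i(2) show False
  proof (cases rule: ready_cases)
    case fixed
    have "1 \<le> \<tau> (Suc i)"
      using permutes_in_image[OF ncp_permutes[OF assms(1)], of "Suc i"] ncp_permutes[OF assms(1)] fixed
      by (metis atLeastAtMost_iff not_less_eq permutes_not_in less_Suc_eq)
    have perm: "\<tau> ` {1..i} \<subseteq> {1..i}"
    proof
      fix y assume "y \<in> \<tau> ` {1..i}"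
      then obtain x where x: "x \<in> {1..i}" "y = \<tau> x" by auto
      have "1 \<le> \<tau> x" using x(1) permutes_in_image[OF ncp_permutes[OF assms(1)], of x]
          permutes_not_in[OF ncp_permutes[OF assms(1)], of x] by (cases "x \<in> {1..n}") auto
      then show "y \<in> {1..i}" using no[of x i] x by auto
    qed
    have "\<tau> ` {1..i} = {1..i}"
      by (rule endo_inj_surj[OF _ perm]) (use inj_on_subset[OF ncp_inj[OF assms(1)]] in auto)
    then have "\<tau> (Suc i) \<in> \<tau> ` {1..i}" using fixed \<open>1 \<le> \<tau> (Suc i)\<close> by auto
    then show False using injD[OF ncp_inj[OF assms(1)], of _ "Suc i"] by force
  next
    case joined
    then show False using no[of i i] i by simp
  qed
qed

text \<open>Either \<tau> already lies below \<open>swap i \<sigma>\<close>, which is one Bruhat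
  step below \<sigma>, or i is ready of the same kind in both permutations. In the second case i is
  deleted from both, the induction applies, and i is inserted again.\<close>

lemma bruhat_le_if_exc_le:
  assumes "ncp n \<sigma>" "ncp n \<tau>" "exc_le \<tau> \<sigma>"
  shows "bruhat_le n \<tau> \<sigma>"
  using assms
proof (induction arbitrary: \<tau> rule: ncp_induct)
  case (id n)
  then have "\<tau> = id" by (rule exc_le_id)
  then show ?case using bruhat_le_refl[OF permutes_id] by (simp only:)
next
  case (step n \<sigma> i)
  show ?case
  proof (cases "exc_le \<tau> (swap i \<sigma>)")
    case True
    then have le: "bruhat_le n \<tau> (swap i \<sigma>)" using step by blast
    have "inj (swap i \<sigma>)" using ncp_inj[OF ncp_swap_if_ready[OF step(1-4)]] .
    then have "bruhat_step n (swap i \<sigma>) \<sigma>"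
      using step(2,3) ready_descent[OF step(1,4)]
      unfolding bruhat_step_iff[OF \<open>inj (swap i \<sigma>)\<close>]
      by (intro exI[of _ i] exI[of _ "Suc i"] conjI) simp_all
    with le show ?thesis by (rule bruhat_le_step)
  next
    case False
    note same = exc_le_not_swap[OF step(2,1,7,4,8) False]
    obtain m where m: "n = Suc m" "i \<le> m" using step(3) by (cases n) auto
    have del: "ins i (del i \<sigma>) = \<sigma>" "ins i (del i \<tau>) = \<tau>"
      using ins_del[OF step(1,4)] ins_del[OF step(7) same(1)] .
    have "exc_le (del i \<tau>) (del i \<sigma>)"
      using step(8) exc_le_ins_iff[OF step(2), of "del i \<tau>" "del i \<sigma>"] by (simp add: del)
    then have "bruhat_le m (del i \<tau>) (del i \<sigma>)"
      using step.IH(2) ncp_del[OF step(7,2,3) same(1)] m by simp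
    then have "bruhat_le n (insat p i (del i \<tau>)) (insat p i (del i \<sigma>))" if "p = i \<or> p = Suc i" for p
      using bruhat_le_insat[of m _ _ p i] that m step(2) by auto
    \<comment> \<open>\<open>ins\<close> selects the position of the new value by this inequality.
      Equal outcomes mean that both insertions use the same p, as \<open>bruhat_le_insat\<close>
      requires.\<close>
    moreover have "del i \<tau> i < i \<longleftrightarrow> del i \<sigma> i < i"
      using same(2) del_less_iff[OF step(1,4)] del_less_iff[OF step(7) same(1)] by simp
    ultimately show ?thesis using del unfolding ins_def by (cases "del i \<sigma> i < i") fastforce+
  qed
qed

lemma bruhat_le_iff_exc_le:
  "ncp n \<sigma> \<Longrightarrow> ncp n \<tau> \<Longrightarrow> bruhat_le n \<tau> \<sigma> \<longleftrightarrow> exc_le \<tau> \<sigma>"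
  using bruhat_le_if_exc_le exc_le_if_bruhat_le by blast

text \<open>The disjunction mirrors the sum in \<open>ev_step\<close>: each summand there is nonzero
  exactly under one of the two alternatives.\<close>

lemma exc_le_step_iff:
  assumes "ncp n \<sigma>" "ncp m \<tau>" "1 \<le> i" "ready \<sigma> i"
  shows "exc_le \<tau> \<sigma> \<longleftrightarrow> exc_le \<tau> (swap i \<sigma>) \<or> ready \<tau> i \<and> exc_le (del i \<tau>) (del i \<sigma>)"
proof -
  have "exc_le \<tau> \<sigma> \<longleftrightarrow> exc_le (del i \<tau>) (del i \<sigma>)" if "ready \<tau> i"
    using exc_le_ins_iff[OF assms(3), of "del i \<tau>" "del i \<sigma>"]
    by (simp add: ins_del[OF assms(1,4)] ins_del[OF assms(2) that])
  then show ?thesis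
    using exc_le_swap[OF assms(3,4)] exc_le_not_swap(1)[OF assms(3,1,2,4)] by blast
qed

section \<open>Cycles of noncrossing permutations\<close>

lemma cycle_of_self [simp]: "x \<in> cycle_of \<sigma> x"
  unfolding cycle_of_def by (metis (mono_tags, lifting) funpow_0 mem_Collect_eq)

lemma cycle_of_nonempty [simp]: "cycle_of \<sigma> x \<noteq> {}"
  using cycle_of_self by (metis empty_iff)

lemma cycle_of_step: "y \<in> cycle_of \<sigma> x \<Longrightarrow> \<sigma> y \<in> cycle_of \<sigma> x"
  unfolding cycle_of_def by (smt (verit) funpow.simps(2) mem_Collect_eq o_apply)

lemma cycle_of_subset:
  assumes "x \<in> S" "\<And>y. y \<in> S \<Longrightarrow> \<sigma> y \<in> S"
  shows "cycle_of \<sigma> x \<subseteq> S"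
proof -
  have "(\<sigma> ^^ k) x \<in> S" for k using assms by (induction k) auto
  then show ?thesis by (auto simp: cycle_of_def)
qed

lemma cycle_of_eq_orbit:
  assumes "\<sigma> permutes S" "finite S"
  shows "cycle_of \<sigma> x = orbit \<sigma> x"
proof -
  have "permutation \<sigma>" using assms by (auto simp: permutation_permutes)
  then show ?thesis using orbit_altdef_permutation[of \<sigma> x] by (auto simp: cycle_of_def)
qed

lemma cycle_of_eq:
  assumes "\<sigma> permutes S" "finite S" "y \<in> cycle_of \<sigma> x"
  shows "cycle_of \<sigma> y = cycle_of \<sigma> x"
proof -
  have "permutation \<sigma>" using assms by (auto simp: permutation_permutes)
  then have "x \<in> orbit \<sigma> x" by (rule permutation_self_in_orbit)
  then have "x \<in> orbit \<sigma> y" using assms orbit_swap[of x \<sigma> y] by (simp add: cycle_of_eq_orbit)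
  then show ?thesis
    using assms orbit_trans[of _ \<sigma>] by (auto simp: cycle_of_eq_orbit)
qed

lemma cycle_of_step_iff:
  assumes "\<sigma> permutes S" "finite S"
  shows "\<sigma> y \<in> cycle_of \<sigma> x \<longleftrightarrow> y \<in> cycle_of \<sigma> x"
proof
  assume "\<sigma> y \<in> cycle_of \<sigma> x"
  then have "cycle_of \<sigma> (\<sigma> y) = cycle_of \<sigma> x" by (rule cycle_of_eq[OF assms])
  moreover have "cycle_of \<sigma> (\<sigma> y) = cycle_of \<sigma> y"
    by (rule cycle_of_eq[OF assms]) (simp add: cycle_of_step)
  ultimately show "y \<in> cycle_of \<sigma> x" using cycle_of_self by metis
qed (rule cycle_of_step)

lemma finite_cycle_of:
  assumes "\<sigma> permutes S" "finite S"
  shows "finite (cycle_of \<sigma> x)"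
proof (rule finite_subset)
  show "cycle_of \<sigma> x \<subseteq> insert x S"
    using assms by (intro cycle_of_subset) (auto simp: permutes_in_image permutes_not_in)
qed (use assms in simp)

text \<open>By the hull condition in \<open>ncp\<close>, the interval from i to \<sigma> i is
  invariant whenever i is not moved down. It therefore contains the whole cycle, and its ends belong
  to the cycle.\<close>

lemma cycle_of_min:
  assumes "ncp n \<sigma>" "i \<le> \<sigma> i"
  shows "cycle_of \<sigma> i \<subseteq> {i..\<sigma> i}" "Min (cycle_of \<sigma> i) = i" "Max (cycle_of \<sigma> i) = \<sigma> i"
proof -
  show sub: "cycle_of \<sigma> i \<subseteq> {i..\<sigma> i}"
    by (rule cycle_of_subset) (use assms(2) ncp_le[OF assms(1), of i] in auto)
  have fin: "finite (cycle_of \<sigma> i)" using finite_cycle_of[OF ncp_permutes[OF assms(1)]] by simp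
  show "Min (cycle_of \<sigma> i) = i" using sub by (intro Min_eqI fin) auto
  show "Max (cycle_of \<sigma> i) = \<sigma> i" using sub by (intro Max_eqI fin) (auto intro: cycle_of_step)
qed

lemma cycle_of_gap:
  assumes nc: "ncp n \<sigma>" and "\<sigma> a < c" "c < a"
  shows "cycle_of \<sigma> c \<subseteq> {\<sigma> a<..<a}"
  by (rule cycle_of_subset) (use assms ncp_less[OF nc, of a] in auto)

lemma cycle_of_min_exists:
  assumes nc: "ncp n \<sigma>"
  obtains m where "cycle_of \<sigma> m = cycle_of \<sigma> x" "m \<le> \<sigma> m" "\<And>y. y \<in> cycle_of \<sigma> x \<Longrightarrow> m \<le> y \<and> y \<le> \<sigma> m"
proof -
  note per = ncp_permutes[OF nc]
  have fin: "finite (cycle_of \<sigma> x)" using finite_cycle_of[OF per] by simp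
  define m where "m = Min (cycle_of \<sigma> x)"
  have m: "m \<in> cycle_of \<sigma> x" unfolding m_def using fin by (intro Min_in) auto
  have eq: "cycle_of \<sigma> m = cycle_of \<sigma> x" using cycle_of_eq[OF per _ m] by simp
  have le: "m \<le> \<sigma> m" using Min_le[OF fin cycle_of_step[OF m]] unfolding m_def[symmetric] .
  show ?thesis
    using cycle_of_min(1)[OF nc le] eq by (intro that[of m]) (auto simp: le)
qed

section \<open>Codes of noncrossing permutations\<close>

lemma nc_code_eq:
  assumes nc: "ncp n \<sigma>"
  shows "nc_code \<sigma> i = (if i \<le> \<sigma> i then card (cycle_of \<sigma> i) - (if \<exists>m<i. i < \<sigma> m then 0 else 1) else 0)"
proof (cases "i \<le> \<sigma> i")
  case True
  note min = cycle_of_min[OF nc True]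
  \<comment> \<open>A block with minimum m has maximum \<sigma> m, so nestedness can be tested on
    the two ends of a single arc.\<close>
  have "(\<exists>j. nested (cycle_of \<sigma> i) (cycle_of \<sigma> j)) \<longleftrightarrow> (\<exists>m<i. i < \<sigma> m)"
  proof
    assume "\<exists>j. nested (cycle_of \<sigma> i) (cycle_of \<sigma> j)"
    then obtain j c c' where j: "c \<in> cycle_of \<sigma> j" "c' \<in> cycle_of \<sigma> j" "c < i" "\<sigma> i < c'"
      by (auto simp: nested_def min)
    obtain m where m: "\<And>y. y \<in> cycle_of \<sigma> j \<Longrightarrow> m \<le> y \<and> y \<le> \<sigma> m"
      using cycle_of_min_exists[OF nc, of j] by metis
    from m[OF j(1)] m[OF j(2)] j True show "\<exists>m<i. i < \<sigma> m" by (intro exI[of _ m]) auto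
  next
    assume "\<exists>m<i. i < \<sigma> m"
    then obtain m where m: "m < i" "i < \<sigma> m" by blast
    have "\<sigma> i \<le> \<sigma> m" using ncp_le[OF nc, of m i] m by simp
    moreover have "\<sigma> i \<noteq> \<sigma> m" using m injD[OF ncp_inj[OF nc], of i m] by auto
    ultimately have "\<sigma> i < \<sigma> m" by simp
    moreover have "m \<in> cycle_of \<sigma> m" "\<sigma> m \<in> cycle_of \<sigma> m" by (auto intro: cycle_of_step)
    moreover have "cycle_of \<sigma> i \<noteq> cycle_of \<sigma> m" 
      using min(1) m cycle_of_self[of m \<sigma>] by (metis atLeastAtMost_iff leD subsetD)
    ultimately have "nested (cycle_of \<sigma> i) (cycle_of \<sigma> m)"
      unfolding nested_def min using m by blast
    then show "\<exists>j. nested (cycle_of \<sigma> i) (cycle_of \<sigma> j)" ..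
  qed
  then show ?thesis using True min by (auto simp: nc_code_def Let_def)
next
  case False
  have "finite (cycle_of \<sigma> i)" using finite_cycle_of[OF ncp_permutes[OF nc]] by simp
  then have "Min (cycle_of \<sigma> i) \<le> \<sigma> i" by (intro Min_le) (simp_all add: cycle_of_step)
  with False show ?thesis by (simp add: nc_code_def Let_def)
qed

lemma nc_code_id: "nc_code id i = 0"
proof -
  have "cycle_of id i = {i}" using cycle_of_subset[of i "{i}" id] cycle_of_self[of i id] by auto
  then show ?thesis by (auto simp: nc_code_eq[OF ncp_id])
qed

text \<open>Were i + 1 a block minimum, its code 0 would make it a singleton nested in no block.
  Then i could not be joined to anything beyond i + 1, so {i} would be a singleton too. Its positive
  code would require an arc over i, and that arc would also cover i + 1.\<close>

lemma ready_if_code_ready: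
  assumes nc: "ncp n \<sigma>" and r: "code_ready (nc_code \<sigma>) i"
  shows "ready \<sigma> i"
proof -
  have i: "i \<le> \<sigma> i" "nc_code \<sigma> i > 0" "nc_code \<sigma> (Suc i) = 0"
    using r nc_code_eq[OF nc, of i] by (auto simp: code_ready_def split: if_splits)
  have "\<sigma> (Suc i) \<le> i"
  proof (rule ccontr)
    assume "\<not> \<sigma> (Suc i) \<le> i"
    then have le: "Suc i \<le> \<sigma> (Suc i)" by simp
    have fin: "finite (cycle_of \<sigma> x)" for x using finite_cycle_of[OF ncp_permutes[OF nc]] by simp
    have pos: "0 < card (cycle_of \<sigma> x)" for x using fin[of x] by (simp add: card_gt_0_iff)
    have cov: "\<not> (\<exists>m<Suc i. Suc i < \<sigma> m)" and card: "card (cycle_of \<sigma> (Suc i)) \<le> 1"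
      using i(3) pos[of "Suc i"] le by (auto simp: nc_code_eq[OF nc] split: if_splits)
    have "\<sigma> (Suc i) = Suc i"
      using card fin[of "Suc i"] cycle_of_self[of "Suc i" \<sigma>] cycle_of_step[OF cycle_of_self[of "Suc i" \<sigma>]]
      by (metis One_nat_def card_le_Suc0_iff_eq)
    then have ne: "\<sigma> m \<noteq> Suc i" if "m \<noteq> Suc i" for m
      using that injD[OF ncp_inj[OF nc], of m "Suc i"] by auto
    have "\<sigma> i = i" using i(1) ne[of i] cov by (metis Suc_lessI lessI n_not_Suc_n order_le_less)
    then have "cycle_of \<sigma> i = {i}" using cycle_of_subset[of i "{i}" \<sigma>] cycle_of_self[of i \<sigma>] by auto
    then obtain m where "m < i" "i < \<sigma> m"
      using i(2) by (auto simp: nc_code_eq[OF nc] split: if_splits)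
    then show False using ne[of m] cov by (metis Suc_lessI less_Suc_eq less_irrefl_nat)
  qed
  with i(1) show ?thesis by (simp add: ready_def)
qed

lemma cycle_of_insat: "cycle_of (insat i i \<omega>) (up i x) = up i ` cycle_of \<omega> x"
proof
  show "cycle_of (insat i i \<omega>) (up i x) \<subseteq> up i ` cycle_of \<omega> x"
    by (rule cycle_of_subset) (auto intro: cycle_of_step)
  have "cycle_of \<omega> x \<subseteq> {y. up i y \<in> cycle_of (insat i i \<omega>) (up i x)}"
  proof (rule cycle_of_subset)
    fix y assume "y \<in> {y. up i y \<in> cycle_of (insat i i \<omega>) (up i x)}"
    then have "insat i i \<omega> (up i y) \<in> cycle_of (insat i i \<omega>) (up i x)" by (intro cycle_of_step) simp
    then show "\<omega> y \<in> {y. up i y \<in> cycle_of (insat i i \<omega>) (up i x)}" by simp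
  qed simp
  then show "up i ` cycle_of \<omega> x \<subseteq> cycle_of (insat i i \<omega>) (up i x)" by auto
qed

lemma cycle_of_fixed: "\<sigma> i = i \<Longrightarrow> cycle_of \<sigma> i = {i}"
  using cycle_of_subset[of i "{i}" \<sigma>] cycle_of_self[of i \<sigma>] by auto

lemma nc_code_insat:
  assumes nc: "ncp n \<omega>" and i: "1 \<le> i" "i \<le> Suc n"
  shows "nc_code (insat i i \<omega>) (up i x) = nc_code \<omega> x"
proof -
  have "(\<exists>m<up i x. up i x < insat i i \<omega> m) \<longleftrightarrow> (\<exists>m<x. x < \<omega> m)"
  proof
    assume "\<exists>m<up i x. up i x < insat i i \<omega> m"
    then obtain m where "m < up i x" "up i x < insat i i \<omega> m" by blast
    then show "\<exists>m<x. x < \<omega> m" by (cases m i rule: up_cases) auto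
  next
    assume "\<exists>m<x. x < \<omega> m"
    then obtain m where "m < x" "x < \<omega> m" by blast
    then show "\<exists>m<up i x. up i x < insat i i \<omega> m" by (intro exI[of _ "up i m"]) simp
  qed
  moreover have "card (up i ` cycle_of \<omega> x) = card (cycle_of \<omega> x)"
    by (rule card_image) (simp add: inj_on_def)
  ultimately show ?thesis
    unfolding nc_code_eq[OF nc] nc_code_eq[OF ncp_insat[OF nc i]] cycle_of_insat by simp
qed

lemma cycle_of_swap_join:
  assumes per: "\<sigma> permutes {1..n}" and i: "1 \<le> i" "Suc i \<le> n" "\<sigma> i = i"
  shows "cycle_of (swap i \<sigma>) i = insert i (cycle_of \<sigma> (Suc i))"
    and "x \<notin> insert i (cycle_of \<sigma> (Suc i)) \<Longrightarrow> cycle_of (swap i \<sigma>) x = cycle_of \<sigma> x"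
proof -
  let ?s = "swap i \<sigma>" and ?C = "cycle_of \<sigma> (Suc i)"
  have per': "?s permutes {1..n}" using per i by (intro comp_transp_permutes) auto
  have s: "?s i = \<sigma> (Suc i)" "?s (Suc i) = i" "\<And>x. x \<noteq> i \<Longrightarrow> x \<noteq> Suc i \<Longrightarrow> ?s x = \<sigma> x" using i by auto
  show "cycle_of ?s i = insert i ?C"
  proof
    show "cycle_of ?s i \<subseteq> insert i ?C"
    proof (rule cycle_of_subset)
      fix y assume "y \<in> insert i ?C"
      then show "?s y \<in> insert i ?C"
        using s by (cases "y = i"; cases "y = Suc i") (auto intro: cycle_of_step)
    qed simp
    have "?C \<subseteq> cycle_of ?s i"
    proof (rule cycle_of_subset)
      have "?s (Suc i) \<in> cycle_of ?s i" using s(2) by (metis cycle_of_self)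
      then show "Suc i \<in> cycle_of ?s i" using cycle_of_step_iff[OF per'] by blast
      fix y assume y: "y \<in> cycle_of ?s i"
      show "\<sigma> y \<in> cycle_of ?s i"
      proof (cases "y = Suc i")
        case True
        then show ?thesis using cycle_of_step[OF cycle_of_self[of i ?s]] s(1) by simp
      next
        case False
        then show ?thesis using y cycle_of_step[OF y] s(3)[of y] i(3) by (cases "y = i") simp_all
      qed
    qed
    then show "insert i ?C \<subseteq> cycle_of ?s i" by simp
  qed
  assume x: "x \<notin> insert i ?C"
  have "cycle_of \<sigma> y \<noteq> cycle_of \<sigma> x" if "y = i \<or> y = Suc i" for y
    using x that cycle_of_self[of x \<sigma>] cycle_of_fixed[of \<sigma> i] i(3) by blast
  then have ne: "i \<notin> cycle_of \<sigma> x" "Suc i \<notin> cycle_of \<sigma> x"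
    using cycle_of_eq[OF per] by blast+
  have same: "?s y = \<sigma> y" if "y \<in> cycle_of \<sigma> x" for y
    using that ne by (intro s(3)) auto
  show "cycle_of ?s x = cycle_of \<sigma> x"
  proof
    show "cycle_of ?s x \<subseteq> cycle_of \<sigma> x"
      by (rule cycle_of_subset) (use same in \<open>auto intro: cycle_of_step\<close>)
    have "cycle_of \<sigma> x \<subseteq> cycle_of \<sigma> x \<inter> cycle_of ?s x"
    proof (rule cycle_of_subset)
      fix y assume y: "y \<in> cycle_of \<sigma> x \<inter> cycle_of ?s x"
      then show "\<sigma> y \<in> cycle_of \<sigma> x \<inter> cycle_of ?s x"
        using cycle_of_step[of y \<sigma> x] cycle_of_step[of y ?s x] same[of y] by auto
    qed simp
    then show "cycle_of \<sigma> x \<subseteq> cycle_of ?s x" by blast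
  qed
qed

text \<open>A new nested singleton has code 1, and the entry at i was 0 before. A new minimum of an
  existing block raises its cardinality by one and leaves its nestedness as it was. In both cases i
  + 1 is not a minimum and has code 0.\<close>

lemma nc_code_ins:
  assumes nc: "ncp n \<omega>" and i: "1 \<le> i" "i \<le> n"
  shows "code_ready (nc_code (ins i \<omega>)) i" "code_del i (nc_code (ins i \<omega>)) = nc_code \<omega>"
proof -
  let ?t = "insat i i \<omega>"
  have nct: "ncp (Suc n) ?t" using ncp_insat[OF nc] i by simp
  have t: "nc_code ?t (up i x) = nc_code \<omega> x" for x using nc_code_insat[OF nc] i by simp
  have t_low: "nc_code ?t x = nc_code \<omega> x" if "x < i" for x using t[of x] that by (simp add: up_def)
  have t_high: "nc_code ?t (Suc x) = nc_code \<omega> x" if "i \<le> x" for x using t[of x] that by (simp add: up_def)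
  have ti: "?t (Suc i) = up i (\<omega> i)" using insat_up[of i i \<omega> i] by (simp add: up_def)
  have "code_ready (nc_code (ins i \<omega>)) i \<and> code_del i (nc_code (ins i \<omega>)) = nc_code \<omega>"
  proof (cases "\<omega> i < i")
    case True
    obtain m where m: "\<And>y. y \<in> cycle_of ?t (Suc i) \<Longrightarrow> m \<le> y \<and> y \<le> ?t m"
      using cycle_of_min_exists[OF nct, of "Suc i"] by metis
    have "m \<le> ?t (Suc i)" "Suc i \<le> ?t m" using m[OF cycle_of_step[OF cycle_of_self]] m[OF cycle_of_self] by blast+
    then have "\<exists>m<i. i < ?t m" using True by (intro exI[of _ m]) (auto simp: ti up_def)
    then have one: "nc_code ?t i = 1"
      by (simp add: nc_code_eq[OF nct] cycle_of_fixed)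
    have zero: "nc_code \<omega> i = 0" using True by (simp add: nc_code_eq[OF nc])
    have "code_del i (nc_code ?t) = nc_code \<omega>"
      by (rule ext) (auto simp: code_del_def one zero t_low t_high)
    then show ?thesis using True one zero t_high[of i] by (simp add: ins_def code_ready_def)
  next
    case False
    let ?s = "swap i ?t" and ?C = "cycle_of ?t (Suc i)"
    have s: "?s i = ?t (Suc i)" "?s (Suc i) = i" "\<And>x. x \<noteq> i \<Longrightarrow> x \<noteq> Suc i \<Longrightarrow> ?s x = ?t x" by auto
    have ins: "ins i \<omega> = ?s" using False by (simp add: ins_def insat_Suc)
    have ncs: "ncp (Suc n) ?s" using ncp_ins[OF nc i] ins by simp
    have le: "Suc i \<le> ?t (Suc i)" using False by (simp add: ti up_def)
    note minC = cycle_of_min(1)[OF nct le]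
    note per = ncp_permutes[OF nct]
    have cyc: "cycle_of ?s i = insert i ?C"
      "x \<notin> insert i ?C \<Longrightarrow> cycle_of ?s x = cycle_of ?t x" for x
      using cycle_of_swap_join[OF per, of i] i by auto
    have finC: "finite ?C" using finite_cycle_of[OF per] by simp
    have iC: "i \<notin> ?C" using minC by auto
    have zero: "nc_code ?s (Suc i) = 0" using nc_code_eq[OF ncs, of "Suc i"] by simp
    \<comment> \<open>The enlarged block is nested exactly if the old block with minimum i + 1 was.
      An arc ending in i + 1 would start in that block, hence not to the left of i.\<close>
    have cov_i: "(\<exists>m<i. i < ?s m) \<longleftrightarrow> (\<exists>m<Suc i. Suc i < ?t m)"
    proof
      assume "\<exists>m<i. i < ?s m"
      then obtain m where m: "m < i" "i < ?t m" using s(3) by auto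
      have "?t m \<noteq> Suc i"
      proof
        assume "?t m = Suc i"
        then have "m \<in> ?C" using cycle_of_step_iff[OF per, of m "Suc i"] by simp
        then show False using minC m by auto
      qed
      with m show "\<exists>m<Suc i. Suc i < ?t m" by (intro exI[of _ m]) auto
    next
      assume "\<exists>m<Suc i. Suc i < ?t m"
      then obtain m where m: "m < Suc i" "Suc i < ?t m" by auto
      then have "m < i" by (cases "m = i") auto
      then show "\<exists>m<i. i < ?s m" using m s(3)[of m] by (intro exI[of _ m]) auto
    qed
    have pos: "0 < card ?C" using finC by (simp add: card_gt_0_iff)
    have at_i: "nc_code ?s i = Suc (nc_code \<omega> i)"
    proof -
      have "nc_code ?s i = card (insert i ?C) - (if \<exists>m<Suc i. Suc i < ?t m then 0 else 1)"
        using le unfolding nc_code_eq[OF ncs, of i] cyc(1) cov_i by simp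
      also have "\<dots> = Suc (nc_code ?t (Suc i))"
        using le pos finC iC unfolding nc_code_eq[OF nct, of "Suc i"] by simp
      finally show ?thesis using t_high[of i] by simp
    qed
    have other: "nc_code ?s x = nc_code ?t x" if x: "x \<noteq> i" "x \<noteq> Suc i" for x
    proof (cases "x \<le> ?t x")
      case True
      have "x \<notin> ?C"
      proof
        assume xC: "x \<in> ?C"
        then have "cycle_of ?t x = ?C" by (rule cycle_of_eq[OF per, rotated]) simp
        then have "Suc i \<in> {x..?t x}" using cycle_of_min(1)[OF nct True] cycle_of_self[of "Suc i" ?t] by blast
        moreover have "Suc i \<le> x" using minC xC by auto
        ultimately show False using x by simp
      qed
      then have "cycle_of ?s x = cycle_of ?t x" using cyc(2) x by simp
      moreover have "(\<exists>m<x. x < ?s m) \<longleftrightarrow> (\<exists>m<x. x < ?t m)"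
      proof
        assume "\<exists>m<x. x < ?s m"
        then obtain m where m: "m < x" "x < ?s m" by blast
        consider "m = i" | "m = Suc i" | "m \<noteq> i" "m \<noteq> Suc i" by blast
        then show "\<exists>m<x. x < ?t m"
        proof cases
          case 1
          then show ?thesis using m x s(1) by (intro exI[of _ "Suc i"]) auto
        qed (use m s in auto)
      next
        assume "\<exists>m<x. x < ?t m"
        then obtain m where m: "m < x" "x < ?t m" by blast
        consider "m = i" | "m = Suc i" | "m \<noteq> i" "m \<noteq> Suc i" by blast
        then show "\<exists>m<x. x < ?s m"
        proof cases
          case 2
          then show ?thesis using m s(1) by (intro exI[of _ i]) auto
        next
          case 3
          then show ?thesis using m s(3)[of m] by (intro exI[of _ m]) auto
        qed (use m in auto)
      qed
      ultimately show ?thesis unfolding nc_code_eq[OF ncs] nc_code_eq[OF nct] using s(3)[OF x] by simp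
    next
      case False
      then show ?thesis unfolding nc_code_eq[OF ncs] nc_code_eq[OF nct] using s(3)[OF x] by simp
    qed
    have "code_del i (nc_code ?s) = nc_code \<omega>"
      by (rule ext) (auto simp: code_del_def at_i other t_low t_high simp del: o_apply)
    then show ?thesis using at_i zero unfolding ins by (simp add: code_ready_def)
  qed
  then show "code_ready (nc_code (ins i \<omega>)) i" "code_del i (nc_code (ins i \<omega>)) = nc_code \<omega>" by auto
qed

text \<open>For a ready code, deletion loses only a decrement of a positive entry and an entry known
  to be 0, so it is injective.\<close>

lemma code_eqI:
  assumes "code_ready c i" "code_ready c' i" "code_del i c = code_del i c'"
  shows "c = c'"
proof
  fix x
  have e: "code_del i c y = code_del i c' y" for y using assms(3) by simp
  consider "x \<le> i" | "x = Suc i" | "i < x - 1" by linarith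
  then show "c x = c' x"
  proof cases
    case 1
    then show ?thesis using assms(1,2) e[of x] by (auto simp: code_ready_def code_del_def le_less)
  next
    case 3
    then show ?thesis using e[of "x - 1"] by (simp add: code_del_def)
  qed (use assms(1,2) in \<open>simp add: code_ready_def\<close>)
qed

lemma nc_code_del:
  assumes nc: "ncp n \<sigma>" and i: "1 \<le> i" "Suc i \<le> n" and r: "ready \<sigma> i"
  shows "code_ready (nc_code \<sigma>) i" "nc_code (del i \<sigma>) = code_del i (nc_code \<sigma>)"
  using nc_code_ins[OF ncp_del[OF nc i r], of i] i by (simp_all add: ins_del[OF nc r])

lemma nc_code_inj:
  "ncp n \<sigma> \<Longrightarrow> ncp n \<tau> \<Longrightarrow> nc_code \<sigma> = nc_code \<tau> \<Longrightarrow> \<sigma> = \<tau>"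
proof (induction n arbitrary: \<sigma> \<tau> rule: less_induct)
  case (less n)
  \<comment> \<open>Formulated with bound permutations so that it can be used in both orders; there
    remains only the case where both are the identity.\<close>
  have *: "\<sigma> = \<tau>" if \<sigma>\<tau>: "ncp n \<sigma>" "ncp n \<tau>" "nc_code \<sigma> = nc_code \<tau>" and "\<sigma> \<noteq> id" for \<sigma> \<tau>
  proof -
    obtain i where i: "1 \<le> i" "Suc i \<le> n" "ready \<sigma> i" using ready_exists \<sigma>\<tau>(1) \<open>\<sigma> \<noteq> id\<close> by blast
    have r: "ready \<tau> i" using ready_if_code_ready[OF \<sigma>\<tau>(2)] nc_code_del(1)[OF \<sigma>\<tau>(1) i] \<sigma>\<tau>(3) by simp
    have "del i \<sigma> = del i \<tau>"
    proof (rule less.IH)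
      show "n - 1 < n" using i by simp
      show "ncp (n - 1) (del i \<sigma>)" "ncp (n - 1) (del i \<tau>)"
        using ncp_del[OF \<sigma>\<tau>(1) i] ncp_del[OF \<sigma>\<tau>(2) i(1,2) r] .
      show "nc_code (del i \<sigma>) = nc_code (del i \<tau>)"
        using nc_code_del(2)[OF \<sigma>\<tau>(1) i] nc_code_del(2)[OF \<sigma>\<tau>(2) i(1,2) r] \<sigma>\<tau>(3) by simp
    qed
    then show ?thesis using ins_del[OF \<sigma>\<tau>(1) i(3)] ins_del[OF \<sigma>\<tau>(2) r] by metis
  qed
  show ?case
    using *[OF less.prems] *[OF less.prems(2,1) less.prems(3)[symmetric]] by blast
qed

section \<open>Noncrossing set partitions and the invariant \<open>ncp\<close>\<close>

lemma ncp_perm_of_partition: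
  assumes part: "partition_on {1..n} \<P>" and ncr: "noncrossing \<P>"
  shows "ncp n (perm_of_partition \<P>)"
proof -
  let ?s = "perm_of_partition \<P>"
  have disj: "B = C" if "B \<in> \<P>" "C \<in> \<P>" "a \<in> B" "a \<in> C" for a B C
    using partition_onD2[OF part] that by (auto simp: disjoint_def)
  have sub: "B \<subseteq> {1..n}" if "B \<in> \<P>" for B using partition_onD1[OF part] that by blast
  have fin: "finite B" if "B \<in> \<P>" for B using sub[OF that] by (rule finite_subset) simp
  have ex: "\<exists>B\<in>\<P>. a \<in> B" if "a \<in> {1..n}" for a using partition_onD1[OF part] that by blast
  have val: "?s a = (if a = Min B then Max B else Max {b \<in> B. b < a})" if "B \<in> \<P>" "a \<in> B" for a B
  proof -
    have "(THE B. B \<in> \<P> \<and> a \<in> B) = B" by (rule the_equality) (use that disj in blast)+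
    then show ?thesis using that by (auto simp: perm_of_partition_def Let_def)
  qed
  have out: "?s a = a" if "a \<notin> {1..n}" for a
  proof -
    have "\<not> (\<exists>B\<in>\<P>. a \<in> B)" using that sub by blast
    then show ?thesis by (simp add: perm_of_partition_def)
  qed
  have vmin: "?s a = Max B \<and> Max B \<in> B \<and> a \<le> Max B" if "B \<in> \<P>" "a \<in> B" "a = Min B" for a B
    using val[OF that(1,2)] that(3) Max_in[OF fin[OF that(1)]] Max_ge[OF fin[OF that(1)] that(2)] that(2) by auto
  have vprev: "?s a \<in> B \<and> ?s a < a \<and> (\<forall>b\<in>B. b < a \<longrightarrow> b \<le> ?s a)" if "B \<in> \<P>" "a \<in> B" "a \<noteq> Min B" for a B
  proof -
    have f: "finite {b \<in> B. b < a}" using fin[OF that(1)] by simp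
    have "Min B \<in> B" "Min B \<le> a" using fin[OF that(1)] that(2) by (auto intro: Min_in)
    then have "{b \<in> B. b < a} \<noteq> {}" using that(3) by (auto simp: le_less)
    from Max_in[OF f this] Max_ge[OF f] show ?thesis using val[OF that(1,2)] that(3) by auto
  qed
  have in_block: "?s a \<in> B" if "B \<in> \<P>" "a \<in> B" for a B
    using vmin[OF that] vprev[OF that] by (cases "a = Min B") auto
  have min_iff: "a = Min B \<longleftrightarrow> a \<le> ?s a" if "B \<in> \<P>" "a \<in> B" for a B
    using vmin[OF that] vprev[OF that] by (cases "a = Min B") auto
  have max: "b \<le> ?s a" if "B \<in> \<P>" "a \<in> B" "a \<le> ?s a" "b \<in> B" for a b B
    using that min_iff[OF that(1,2)] vmin[OF that(1,2)] Max_ge[OF fin[OF that(1)] that(4)] by simp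
  have prev: "b \<le> ?s a" if "B \<in> \<P>" "a \<in> B" "?s a < a" "b \<in> B" "b < a" for a b B
    using that min_iff[OF that(1,2)] vprev[OF that(1,2)] by auto
  have min: "a \<le> b" if "B \<in> \<P>" "a \<in> B" "a \<le> ?s a" "b \<in> B" for a b B
    using that min_iff[OF that(1,2)] Min_le[OF fin[OF that(1)] that(4)] by simp
  have inj: "a = a'" if aa: "?s a = ?s a'" "a \<in> {1..n}" "a' \<in> {1..n}" for a a'
  proof -
    obtain B where B: "B \<in> \<P>" "a \<in> B" using ex aa by blast
    obtain B' where B': "B' \<in> \<P>" "a' \<in> B'" using ex aa by blast
    have "B' = B" using disj[of B B' "?s a"] in_block[OF B] in_block[OF B'] aa(1) B B' by simp
    with B' have a': "a' \<in> B" by simp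
    consider "a \<le> ?s a" "a' \<le> ?s a'" | "a \<le> ?s a" "?s a' < a'" | "?s a < a" "a' \<le> ?s a'" | "?s a < a" "?s a' < a'"
      by linarith
    then show ?thesis
    proof cases
      case 1
      then show ?thesis using min[OF B(1)] B a' by (meson antisym)
    next
      case 2
      then show ?thesis using max[OF B 2(1) a'] aa(1) by simp
    next
      case 3
      then show ?thesis using max[OF B(1) a' 3(2) B(2)] aa(1) by simp
    next
      case 4
      then show ?thesis
        using prev[OF B 4(1) a'] prev[OF B(1) a' 4(2) B(2)] aa(1) by (cases a a' rule: linorder_cases) auto
    qed
  qed
  have per: "?s permutes {1..n}"
  proof (rule permutes_if_inj_on)
    show "inj_on ?s {1..n}" using inj by (blast intro: inj_onI)
    show "?s ` {1..n} \<subseteq> {1..n}" using ex in_block sub by blast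
  qed (use out in auto)
  \<comment> \<open>Applied to the blocks of a and b: if b lies inside a gap or hull of the first
    block and its image lies outside, then the four points form a crossing.\<close>
  have cross: False if "B \<in> \<P>" "C \<in> \<P>" "B \<noteq> C" "p \<in> B" "r \<in> B" "q \<in> C" "s \<in> C" "p < q" "q < r" "r < s" for B C p q r s
    using ncr that unfolding noncrossing_def by blast
  show ?thesis
    unfolding ncp_def
  proof (intro conjI allI impI per)
    fix a b
    {
      assume ab: "?s a < b" "b < a"
      have "a \<in> {1..n}" using out[of a] ab by force
      then obtain B where B: "B \<in> \<P>" "a \<in> B" using ex by blast
      have "b \<in> {1..n}" using ab \<open>a \<in> {1..n}\<close> by auto
      then obtain C where C: "C \<in> \<P>" "b \<in> C" using ex by blast
      note sb = in_block[OF C] and sa = in_block[OF B]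
      have "b \<notin> B" using prev[OF B, of b] ab by auto
      then have BC: "B \<noteq> C" using C by auto
      then have ne: "?s b \<noteq> ?s a" "?s b \<noteq> a" using disj[OF B(1) C(1)] sa sb B by metis+
      have "\<not> ?s b < ?s a" using cross[OF C(1) B(1) BC[symmetric] sb C(2) sa B(2)] ab by auto
      moreover have "\<not> a < ?s b" using cross[OF B(1) C(1) BC sa B(2) C(2) sb] ab by auto
      ultimately show "?s a < ?s b" "?s b < a" using ne by auto
    }
    {
      assume ab: "a \<le> b" "b \<le> ?s a"
      have "a \<le> ?s b \<and> ?s b \<le> ?s a"
      proof (cases "a \<in> {1..n}")
        case False
        then show ?thesis using out[of a] ab by auto
      next
        case True
        then obtain B where B: "B \<in> \<P>" "a \<in> B" using ex by blast
        have le: "a \<le> ?s a" using ab by simp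
        note sa = in_block[OF B]
        have "b \<in> {1..n}" using ab True sub[OF B(1)] sa by auto
        then obtain C where C: "C \<in> \<P>" "b \<in> C" using ex by blast
        note sb = in_block[OF C]
        show ?thesis
        proof (cases "B = C")
          case True
          then show ?thesis using max[OF B le] min[OF B le] sb by simp
        next
          case BC: False
          then have ne: "b \<noteq> a" "b \<noteq> ?s a" using disj[OF B(1) C(1)] sa B C by metis+
          have "\<not> ?s b < a" using cross[OF C(1) B(1) BC[symmetric] sb C(2) B(2) sa] ab ne by auto
          moreover have "\<not> ?s a < ?s b" using cross[OF B(1) C(1) BC B(2) sa C(2) sb] ab ne by auto
          ultimately show ?thesis by simp
        qed
      qed
      then show "a \<le> ?s b" "?s b \<le> ?s a" by auto
    }
  qed
qed

lemma ncp_in_NC: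
  assumes nc: "ncp n \<sigma>"
  shows "\<sigma> \<in> NC n"
proof -
  let ?P = "cycle_of \<sigma> ` {1..n}"
  note per = ncp_permutes[OF nc]
  have eq: "cycle_of \<sigma> y = cycle_of \<sigma> x" if "y \<in> cycle_of \<sigma> x" for x y
    using cycle_of_eq[OF per _ that] by simp
  have fin: "finite (cycle_of \<sigma> x)" for x using finite_cycle_of[OF per] by simp
  have in_range: "cycle_of \<sigma> x \<subseteq> {1..n}" if "x \<in> {1..n}" for x
    by (rule cycle_of_subset) (use that permutes_in_image[OF per] in blast)+
  have "partition_on {1..n} ?P"
  proof (rule partition_onI)
    show "\<Union> ?P = {1..n}"
    proof
      show "\<Union> ?P \<subseteq> {1..n}" using in_range by blast
      show "{1..n} \<subseteq> \<Union> ?P" using cycle_of_self by blast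
    qed
    show "disjnt p q" if "p \<in> ?P" "q \<in> ?P" "p \<noteq> q" for p q
      using that eq by (auto simp: disjnt_def) (metis+)
    show "{} \<notin> ?P" by (metis cycle_of_nonempty imageE)
  qed
  moreover have "noncrossing ?P"
    unfolding noncrossing_def
  proof (intro notI, elim exE conjE)
    fix P Q a b c d
    assume PQ: "P \<in> ?P" "Q \<in> ?P" "P \<noteq> Q" "a \<in> P" "b \<in> P" "c \<in> Q" "d \<in> Q" "a < c" "c < b" "b < d"
    then obtain p q where [simp]: "P = cycle_of \<sigma> p" "Q = cycle_of \<sigma> q" by auto
    have disj: "c \<notin> P" using eq[of c p] eq[of c q] PQ by auto
    \<comment> \<open>The next element of P above c. Its image is the preceding element of P, so c
      lies in the gap below x. The whole cycle of c stays in this gap, whereas d lies beyond b and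
      hence beyond x.\<close>
    define x where "x = Min {x \<in> P. c < x}"
    have "finite {x \<in> P. c < x}" "{x \<in> P. c < x} \<noteq> {}" using fin PQ by auto
    then have x: "x \<in> P" "c < x" "\<And>y. y \<in> P \<Longrightarrow> c < y \<Longrightarrow> x \<le> y"
      unfolding x_def using Min_in[of "{x \<in> P. c < x}"] by auto
    have sx: "\<sigma> x \<in> P" using x(1) by (simp add: cycle_of_step)
    have "\<sigma> x < x"
    proof (rule ccontr)
      assume "\<not> \<sigma> x < x"
      then have "cycle_of \<sigma> x \<subseteq> {x..\<sigma> x}" using cycle_of_min(1)[OF nc] by simp
      then show False using eq[of x p] x PQ by auto
    qed
    then have "\<sigma> x < c" using x(3)[OF sx] disj sx by (metis linorder_neqE_nat not_le)
    then have "cycle_of \<sigma> c \<subseteq> {\<sigma> x<..<x}" using cycle_of_gap[OF nc] x(2) by blast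
    then have "d < x" using eq[of c q] PQ by auto
    moreover have "x \<le> b" using x(3) PQ by auto
    ultimately show False using PQ by simp
  qed
  moreover have "perm_of_partition ?P = \<sigma>"
  proof
    fix a
    show "perm_of_partition ?P a = \<sigma> a"
    proof (cases "a \<in> {1..n}")
      case False
      then have "\<not> (\<exists>B\<in>?P. a \<in> B)" using in_range by blast
      then show ?thesis using False permutes_not_in[OF per] by (simp add: perm_of_partition_def)
    next
      case True
      have the: "(THE B. B \<in> ?P \<and> a \<in> B) = cycle_of \<sigma> a"
        by (rule the_equality) (use True eq in auto)
      have ex: "\<exists>B\<in>?P. a \<in> B" using True cycle_of_self by blast
      show ?thesis
      proof (cases "a \<le> \<sigma> a")
        case True
        then show ?thesis using ex cycle_of_min[OF nc True] the by (simp add: perm_of_partition_def)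
      next
        case False
        have sa: "\<sigma> a \<in> cycle_of \<sigma> a" by (simp add: cycle_of_step)
        have "a \<noteq> Min (cycle_of \<sigma> a)" using Min_le[OF fin sa] False by auto
        moreover have "Max {b \<in> cycle_of \<sigma> a. b < a} = \<sigma> a"
        proof (rule Max_eqI)
          fix y assume y: "y \<in> {b \<in> cycle_of \<sigma> a. b < a}"
          show "y \<le> \<sigma> a"
          proof (rule ccontr)
            assume "\<not> y \<le> \<sigma> a"
            then have "cycle_of \<sigma> y \<subseteq> {\<sigma> a<..<a}" using y cycle_of_gap[OF nc] by simp
            moreover have "a \<in> cycle_of \<sigma> y" using eq[of y a] y by simp
            ultimately show False by auto
          qed
        qed (use fin False sa in auto)
        ultimately show ?thesis using ex the by (simp add: perm_of_partition_def)
      qed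
    qed
  qed
  ultimately show ?thesis unfolding NC_def by (metis (mono_tags, lifting) imageI mem_Collect_eq)
qed

lemma NC_iff_ncp: "\<sigma> \<in> NC n \<longleftrightarrow> ncp n \<sigma>"
  using ncp_perm_of_partition ncp_in_NC unfolding NC_def by blast

section \<open>Evaluations at noncrossing permutations\<close>

lemma code_ready_exists:
  assumes "code_on m c" "c \<noteq> (\<lambda>_. 0)"
  shows "\<exists>i\<ge>1. code_ready c i"
proof -
  have sub: "{i. 0 < c i} \<subseteq> {1..m}"
  proof
    fix i assume "i \<in> {i. 0 < c i}"
    then show "i \<in> {1..m}" using assms(1) unfolding code_on_def by (cases "i = 0"; cases "m < i") auto
  qed
  then have fin: "finite {i. 0 < c i}" by (rule finite_subset) simp
  have ne: "{i. 0 < c i} \<noteq> {}" using assms(2) by auto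
  define i where "i = Max {i. 0 < c i}"
  have "0 < c i" using Max_in[OF fin ne] by (simp add: i_def)
  moreover have "c (Suc i) = 0" using Max_ge[OF fin, of "Suc i"] by (force simp: i_def[symmetric])
  moreover have "1 \<le> i" using sub \<open>0 < c i\<close> by auto
  ultimately show ?thesis unfolding code_ready_def by blast
qed

text \<open>Every contraction of the forest is undone on the other side by \<open>ins\<close>. With
  \<open>nc_code_inj\<close> this makes the description defining \<open>ForToNC\<close>
  definite.\<close>

lemma ncp_exists_code:
  "supp F \<subseteq> {1..n} \<Longrightarrow> \<exists>\<sigma>. ncp n \<sigma> \<and> nc_code \<sigma> = forest_code F"
proof (induction "code_size (forest_code F)" arbitrary: F n rule: less_induct)
  case less
  note on = code_on_forest_code[OF less.prems]
  show ?case
  proof (cases "forest_code F = (\<lambda>_. 0)")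
    case True
    then show ?thesis using ncp_id nc_code_id by (intro exI[of _ id]) auto
  next
    case False
    then obtain i where i: "1 \<le> i" "code_ready (forest_code F) i" using code_ready_exists[OF on] by blast
    then have q: "i \<in> Qdes F" by (simp add: Qdes_iff)
    have "i < n" using i forest_code_less[OF less.prems] by (simp add: code_ready_def)
    then obtain m where m: "n = Suc m" "i \<le> m" by (cases n) auto
    have "code_size (forest_code (contract F i)) < code_size (forest_code F)"
      using code_size_del[OF on i] by (simp add: forest_code_contract[OF q])
    from less.hyps[OF this supp_contract[OF less.prems q]] obtain \<omega>
      where \<omega>: "ncp m \<omega>" "nc_code \<omega> = code_del i (forest_code F)"
      by (auto simp: m forest_code_contract[OF q])
    have "nc_code (ins i \<omega>) = forest_code F"
      by (rule code_eqI[OF nc_code_ins(1)[OF \<omega>(1) i(1) m(2)] i(2)])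
        (simp only: nc_code_ins(2)[OF \<omega>(1) i(1) m(2)] \<omega>(2))
    then show ?thesis using ncp_ins[OF \<omega>(1) i(1) m(2)] unfolding m(1) by blast
  qed
qed

lemma ForToNC:
  assumes "supp F \<subseteq> {1..n}"
  shows "ncp n (ForToNC n F)" "nc_code (ForToNC n F) = forest_code F"
proof -
  have "\<exists>!\<sigma>. \<sigma> \<in> NC n \<and> (\<forall>i. nc_code \<sigma> i = forest_code F i)"
    using ncp_exists_code[OF assms] nc_code_inj[of n] unfolding NC_iff_ncp fun_eq_iff[symmetric] by metis
  from theI'[OF this] show "ncp n (ForToNC n F)" "nc_code (ForToNC n F) = forest_code F"
    unfolding ForToNC_def NC_iff_ncp by auto
qed

text \<open>Evaluate the defining equation of E_i at \<sigma> with its value i removed. The two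
  insertions put i back at positions i and i + 1, which gives \<sigma> and
  \<open>swap i \<sigma>\<close>; the kind of readiness decides which is which, and with it the
  sign. The pair (\<open>lo\<close>, \<open>hi\<close>) is (\<sigma> (i + 1), i) if i is fixed and
  (i, \<sigma> i) otherwise.\<close>

lemma ev_step:
  assumes nc: "ncp n \<sigma>" and r: "ready \<sigma> i" and f: "ddiff i i f = ren (omit_var i) g"
  shows "\<exists>lo hi. lo < hi \<and> ev \<sigma> f = ev (swap i \<sigma>) f
    + (Var (T hi) - Var (T lo)) * ren (omit_var i) (ev (del i \<sigma>) g)"
proof -
  \<comment> \<open>The position carrying the value i; skipping it with \<open>up p\<close> leaves
    the values of \<open>del i \<sigma>\<close>, relabelled by \<open>up i\<close>.\<close>
  define p where "p = (if \<sigma> i = i then i else Suc i)"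
  define \<rho> where "\<rho> v = (case v of X j \<Rightarrow> T (\<sigma> (up p j)) | T j \<Rightarrow> T j)" for v
  have p: "\<sigma> p = i" using nc r by (cases rule: ready_cases) (auto simp: p_def)
  have "ren \<rho> (ddiff i i f) = ren (\<lambda>v. \<rho> (omit_var i v)) g"
    by (simp add: f ren_ren)
  also have "\<dots> = ren (omit_var i) (ev (del i \<sigma>) g)"
    unfolding ev_eq_ren ren_ren
  proof (rule arg_cong[where f = "\<lambda>\<rho>. ren \<rho> g"], rule ext)
    fix v
    have "up i (del i \<sigma> j) = \<sigma> (up p j)" for j
    proof -
      have "\<sigma> (up p j) \<noteq> i" using p injD[OF ncp_inj[OF nc], of p "up p j"] by auto
      then show ?thesis by (simp add: del_def delat_def p_def up_dn)
    qed
    then have "omit_var i (T (del i \<sigma> j)) = T (\<sigma> (up p j))" for j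
      by (simp add: omit_var_def flip: up_def) (metis up_def)
    then show "\<rho> (omit_var i v) = omit_var i (case v of X j \<Rightarrow> T (del i \<sigma> j) | T j \<Rightarrow> T j)"
      by (cases v) (auto simp: \<rho>_def omit_var_def)
  qed
  finally have D: "ren \<rho> (ddiff i i f) = ren (omit_var i) (ev (del i \<sigma>) g)" .
  have E: "ren (omit_var i) (ev (del i \<sigma>) g) * (Var (T (\<sigma> (up p i))) - Var (T i))
      = ren (\<lambda>v. \<rho> (ipos (Suc i) i v)) f - ren (\<lambda>v. \<rho> (ipos i i v)) f"
    using arg_cong[OF ddiff_mult[of i i f], of "ren \<rho>"] by (simp add: D ren_ren \<rho>_def)
  \<comment> \<open>A recognition criterion: inserting the value i at position q into the shortened
    word yields the one-line notation of \<open>u\<close>.\<close>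
  have pos: "ren (\<lambda>v. \<rho> (ipos q i v)) f = ev u f"
    if "\<And>j. u j = (if j < q then \<sigma> (up p j) else if j = q then i else \<sigma> (up p (j - 1)))" for q u
    unfolding ev_eq_ren
    by (rule arg_cong[where f = "\<lambda>\<rho>. ren \<rho> f"], rule ext)
      (auto simp: \<rho>_def ipos_def that split: var.splits)
  from nc r show ?thesis
  proof (cases rule: ready_cases)
    case fixed
    then have [simp]: "p = i" by (simp add: p_def)
    have "\<sigma> j = (if j < i then \<sigma> (up p j) else if j = i then i else \<sigma> (up p (j - 1)))" for j
      by (cases j i rule: linorder_cases; cases "j = Suc i") (use fixed in \<open>auto simp: up_def\<close>)
    then have "ren (\<lambda>v. \<rho> (ipos i i v)) f = ev \<sigma> f" by (rule pos)
    moreover have "swap i \<sigma> j = (if j < Suc i then \<sigma> (up p j) else if j = Suc i then i else \<sigma> (up p (j - 1)))" for j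
      by (cases j i rule: linorder_cases; cases "j = Suc i") (use fixed in \<open>auto simp: up_def\<close>)
    then have "ren (\<lambda>v. \<rho> (ipos (Suc i) i v)) f = ev (swap i \<sigma>) f" by (rule pos)
    moreover have "up p i = Suc i" by (simp add: up_def)
    ultimately have "ev \<sigma> f = ev (swap i \<sigma>) f
        + (Var (T i) - Var (T (\<sigma> (Suc i)))) * ren (omit_var i) (ev (del i \<sigma>) g)"
      using E by (simp add: algebra_simps)
    then show ?thesis using fixed(2) by blast
  next
    case joined
    then have [simp]: "p = Suc i" by (simp add: p_def)
    have "\<sigma> j = (if j < Suc i then \<sigma> (up p j) else if j = Suc i then i else \<sigma> (up p (j - 1)))" for j
      by (cases j i rule: linorder_cases; cases "j = Suc i") (use joined in \<open>auto simp: up_def\<close>)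
    then have "ren (\<lambda>v. \<rho> (ipos (Suc i) i v)) f = ev \<sigma> f" by (rule pos)
    moreover have "swap i \<sigma> j = (if j < i then \<sigma> (up p j) else if j = i then i else \<sigma> (up p (j - 1)))" for j
      by (cases j i rule: linorder_cases; cases "j = Suc i") (use joined in \<open>auto simp: up_def\<close>)
    then have "ren (\<lambda>v. \<rho> (ipos i i v)) f = ev (swap i \<sigma>) f" by (rule pos)
    moreover have "up p i = i" by (simp add: up_def)
    ultimately have "ev \<sigma> f = ev (swap i \<sigma>) f
        + (Var (T (\<sigma> i)) - Var (T i)) * ren (omit_var i) (ev (del i \<sigma>) g)"
      using E by (simp add: algebra_simps)
    then show ?thesis using joined(1) by blast
  qed
qed

text \<open>A substitute for nonvanishing that is closed under sums and under multiplication by t_hi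
  - t_lo for lo < hi. It is also closed under omitting a parameter, since a strictly increasing
  sequence stays so when one term is left out.\<close>

definition t_positive :: "mpoly \<Rightarrow> bool" where
  "t_positive f \<longleftrightarrow> (\<forall>t :: nat \<Rightarrow> int. strict_mono t \<longrightarrow> 0 < insertion (\<lambda>v. case v of X j \<Rightarrow> 0 | T j \<Rightarrow> t j) f)"

lemma not_t_positive_0: "\<not> t_positive 0"
proof -
  have "strict_mono int" by (simp add: strict_mono_def)
  then show ?thesis by (auto simp: t_positive_def)
qed

lemma t_positive_1: "t_positive 1"
  by (simp add: t_positive_def)

lemma t_positive_add: "t_positive f \<Longrightarrow> t_positive g \<Longrightarrow> t_positive (f + g)"
  by (auto simp: t_positive_def intro: add_pos_pos)

lemma t_positive_diff_mult: "lo < hi \<Longrightarrow> t_positive f \<Longrightarrow> t_positive ((Var (T hi) - Var (T lo)) * f)"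
  by (auto simp: t_positive_def strict_mono_def)

lemma t_positive_omit:
  assumes "t_positive f"
  shows "t_positive (ren (omit_var i) f)"
  unfolding t_positive_def
proof (intro allI impI)
  fix t :: "nat \<Rightarrow> int" assume "strict_mono t"
  then have "strict_mono (t \<circ> up i)" by (simp add: strict_mono_def)
  moreover have "(\<lambda>v. case omit_var i v of X j \<Rightarrow> 0 | T j \<Rightarrow> t j) = (\<lambda>v. case v of X j \<Rightarrow> 0 | T j \<Rightarrow> (t \<circ> up i) j)"
    by (auto simp: fun_eq_iff omit_var_def up_def split: var.splits)
  ultimately show "0 < insertion (\<lambda>v. case v of X j \<Rightarrow> 0 | T j \<Rightarrow> t j) (ren (omit_var i) f)"
    using assms by (simp add: t_positive_def insertion_ren)
qed

text \<open>\<tau> is tied to F only by its code, so the induction can pass to F/i and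
  \<open>del i \<tau>\<close> without unfolding \<open>ForToNC\<close>. Each summand of
  \<open>ev_step\<close> is zero or positive by induction, and the sum is zero only if both
  are.\<close>

lemma ev_forest_poly_dichotomy:
  assumes "ncp n \<sigma>" "supp F \<subseteq> {1..n}" "ncp n \<tau>" "nc_code \<tau> = forest_code F"
  shows "if exc_le \<tau> \<sigma> then t_positive (ev \<sigma> (forest_poly F)) else ev \<sigma> (forest_poly F) = 0"
  using assms
proof (induction arbitrary: F \<tau> rule: ncp_induct)
  case (id n)
  have "ev id (forest_poly F) = at_t (forest_poly F)"
    unfolding ev_eq_ren at_t_eq_ren by (rule ren_cong) (auto split: var.splits)
  then have e: "ev id (forest_poly F) = (if F = empty_forest then 1 else 0)"
    using forest_poly_spec by (simp add: forest_poly_spec_def)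
  show ?case
  proof (cases "F = empty_forest")
    case True
    then have "nc_code \<tau> = nc_code id" using id(3) nc_code_id by (auto simp: empty_forest_iff)
    then have "\<tau> = id" using nc_code_inj[OF id(2) ncp_id] by blast
    then show ?thesis using True e t_positive_1 by (simp add: exc_le_def)
  next
    case False
    then obtain x where "forest_code F x \<noteq> 0" unfolding empty_forest_iff by blast
    then have "\<tau> \<noteq> id" using id(3) nc_code_id[of x] by metis
    then have "\<not> exc_le \<tau> id" using exc_le_id[OF id(2)] by blast
    then show ?thesis using e False by (simp only: if_False)
  qed
next
  case (step n \<sigma> i)
  let ?G = "contract F i"
  \<comment> \<open>Choosing 0 outside \<open>Qdes\<close> unites the two cases for E_i, so that
    \<open>ev_step\<close> applies uniformly.\<close>
  define g where "g = (if i \<in> Qdes F then forest_poly ?G else 0)"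
  have "ddiff i i (forest_poly F) = ren (omit_var i) g"
    using forest_poly_spec step(2)
    by (simp add: forest_poly_spec_def g_def Eop_eq_ddiff omit_t_eq_ren)
  from ev_step[OF step(1,4) this] obtain lo hi where "lo < hi"
    and ev: "ev \<sigma> (forest_poly F) = ev (swap i \<sigma>) (forest_poly F)
      + (Var (T hi) - Var (T lo)) * ren (omit_var i) (ev (del i \<sigma>) g)" by blast
  let ?c = "ready \<tau> i \<and> exc_le (del i \<tau>) (del i \<sigma>)"
  let ?h = "(Var (T hi) - Var (T lo)) * ren (omit_var i) (ev (del i \<sigma>) g)"
  have h: "if ?c then t_positive ?h else ?h = 0"
  proof (cases "ready \<tau> i")
    case True
    have q: "i \<in> Qdes F"
      using nc_code_del(1)[OF step(8,2,3) True] step(9) by (simp add: Qdes_iff)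
    have "nc_code (del i \<tau>) = forest_code ?G"
      using nc_code_del(2)[OF step(8,2,3) True] step(9) by (simp add: forest_code_contract[OF q])
    from step.IH(2)[OF supp_contract[OF step(7) q] ncp_del[OF step(8,2,3) True] this]
    have "if exc_le (del i \<tau>) (del i \<sigma>) then t_positive (ev (del i \<sigma>) g) else ev (del i \<sigma>) g = 0"
      using q by (simp add: g_def)
    then show ?thesis
      using True \<open>lo < hi\<close> by (auto intro!: t_positive_diff_mult t_positive_omit split: if_splits)
  next
    case False
    then have "i \<notin> Qdes F" using ready_if_code_ready[OF step(8), of i] step(9) by (auto simp: Qdes_iff)
    then show ?thesis using False by (simp add: g_def ev_eq_ren)
  qed
  have swp: "if exc_le \<tau> (swap i \<sigma>) then t_positive (ev (swap i \<sigma>) (forest_poly F)) else ev (swap i \<sigma>) (forest_poly F) = 0"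
    by (rule step.IH(1)[OF step(7,8,9)])
  show ?case
    unfolding exc_le_step_iff[OF step(1,8,2,4)] ev
    using h swp t_positive_add[of "ev (swap i \<sigma>) (forest_poly F)" ?h]
    by (cases ?c; cases "exc_le \<tau> (swap i \<sigma>)")
      (simp_all only: if_True if_False simp_thms add_0_left add_0_right)
qed

theorem theorem8p14:
  fixes n :: nat and \<sigma> :: "nat \<Rightarrow> nat" and F :: iforest
  assumes "\<sigma> \<in> NC n" and "supp F \<subseteq> {1..n}"
  shows "ev \<sigma> (forest_poly F) = 0 \<longleftrightarrow> \<not> bruhat_le n (ForToNC n F) \<sigma>"
proof -
  have nc: "ncp n \<sigma>" using assms(1) by (simp add: NC_iff_ncp)
  note F = ForToNC[OF assms(2)]
  show ?thesis
    using ev_forest_poly_dichotomy[OF nc assms(2) F] not_t_positive_0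
    unfolding bruhat_le_iff_exc_le[OF nc F(1)] by (auto split: if_splits)
qed

end
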